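(* Let $1\le q<p<\infty$, $r=pq/(p-q)$ and $s=1-1/r$. Fix $1/r<\beta\le1$ and define the measure $\mu_\beta$ on $[0,1)$ by $$d\mu_\beta(t)=(1-t)^{s-1}\left(\log\frac{e}{1-t}\right)^{-\beta}dt.$$ Then $\mathcal C_{\mu_\beta}:H^p\to H^q$ is bounded and compact, while $$\int_0^1\frac{d\mu_\beta(t)}{(1-t)^s}=\infty.$$ Thus, for finite positive Borel measures $\mu$ on $[0,1)$ with moments $\mu_n=\int_{[0,1)}t^n\,d\mu(t)$, the conditions $$\int_{[0,1)}\frac{d\mu(t)}{(1-t)^{1-1/r}}<\infty\qquad\text{and}\qquad\sum_{n=0}^\infty(n+1)^{-1/r}\mu_n<\infty$$ are strictly stronger than the condition $$\int_0^1\left(\frac{\mu([t,1))}{(1-t)^{s}}\right)^r\frac{dt}{1-t}<\infty,$$ which is equivalent to the boundedness of $\mathcal C_\mu:H^p\to H^q$.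
   Context: $\mathbb D$ is the open unit disc in $\mathbb C$. For $0<p<\infty$, $H^p$ is the Hardy space of analytic functions $f$ on $\mathbb D$ with $\|f\|_{H^p}=\sup_{0\le\rho<1}\left(\frac1{2\pi}\int_0^{2\pi}|f(\rho e^{i\theta})|^p\,d\theta\right)^{1/p}<\infty$. For a finite positive Borel measure $\mu$ on $[0,1)$ and $f(z)=\sum_{k\ge0}a_kz^k$ analytic in $\mathbb D$, $$\mathcal C_\mu f(z)=\sum_{n=0}^\infty\left(\int_{[0,1)}t^n\,d\mu(t)\right)\left(\sum_{k=0}^na_k\right)z^n=\int_{[0,1)}\frac{f(tz)}{1-tz}\,d\mu(t),\qquad z\in\mathbb D.$$ *)

theory Defs
  imports "HOL-Complex_Analysis.Complex_Analysis"
begin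

text \<open>Elements of the Hardy space are represented by functions on all of \<open>complex\<close>; only
  their values on the open unit disc matter. The means are over circles of radius
  \<open>\<rho> < 1\<close>, where the integrand is continuous. \<open>hardy_norm\<close> is meaningful only
  on \<open>hardy_space\<close>, where the supremum is over a bounded set.\<close>

definition hardy_mean :: "real \<Rightarrow> (complex \<Rightarrow> complex) \<Rightarrow> real \<Rightarrow> real" where
  "hardy_mean p f \<rho> =
     ((1 / (2 * pi)) *
       integral {0..2 * pi} (\<lambda>\<theta>. cmod (f (of_real \<rho> * exp (\<i> * of_real \<theta>))) powr p)) powr (1 / p)"

definition hardy_space :: "real \<Rightarrow> (complex \<Rightarrow> complex) set" where
  "hardy_space p = {f. f holomorphic_on ball 0 1 \<and> bdd_above (hardy_mean p f ` {0..<1})}"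

definition hardy_norm :: "real \<Rightarrow> (complex \<Rightarrow> complex) \<Rightarrow> real" where
  "hardy_norm p f = (SUP \<rho>\<in>{0..<1}. hardy_mean p f \<rho>)"

definition hardy_bounded ::
    "real \<Rightarrow> real \<Rightarrow> ((complex \<Rightarrow> complex) \<Rightarrow> (complex \<Rightarrow> complex)) \<Rightarrow> bool" where
  "hardy_bounded p q T \<longleftrightarrow>
     (\<exists>K. \<forall>f\<in>hardy_space p. T f \<in> hardy_space q \<and> hardy_norm q (T f) \<le> K * hardy_norm p f)"

text \<open>Every norm-bounded sequence in \<open>H\<^sup>p\<close> has a subsequence whose image converges
  in \<open>H\<^sup>q\<close>.\<close>

definition hardy_compact ::
    "real \<Rightarrow> real \<Rightarrow> ((complex \<Rightarrow> complex) \<Rightarrow> (complex \<Rightarrow> complex)) \<Rightarrow> bool" where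
  "hardy_compact p q T \<longleftrightarrow>
     (\<forall>f\<in>hardy_space p. T f \<in> hardy_space q) \<and>
     (\<forall>F :: nat \<Rightarrow> complex \<Rightarrow> complex.
        (\<forall>n. F n \<in> hardy_space p) \<and> (\<exists>K. \<forall>n. hardy_norm p (F n) \<le> K) \<longrightarrow>
        (\<exists>\<sigma> :: nat \<Rightarrow> nat. \<exists>g\<in>hardy_space q. strict_mono \<sigma> \<and>
           (\<lambda>n. hardy_norm q (\<lambda>z. T (F (\<sigma> n)) z - g z)) \<longlonglongrightarrow> 0))"

definition finite_borel_unit :: "real measure \<Rightarrow> bool" where
  "finite_borel_unit \<mu> \<longleftrightarrow>
     sets \<mu> = sets (restrict_space borel {0..<1::real}) \<and> finite_measure \<mu>"

definition moment :: "real measure \<Rightarrow> nat \<Rightarrow> real" where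
  "moment \<mu> n = (\<integral>t. t ^ n \<partial>\<mu>)"

text \<open>\<open>fps_nth (fps_expansion f 0) k\<close> is the \<open>k\<close>-th Taylor coefficient of \<open>f\<close> at 0.
  The value matters only for \<open>z\<close> in the open unit disc, where the series converges if \<open>f\<close> is
  holomorphic there.\<close>

definition cesaro_op :: "real measure \<Rightarrow> (complex \<Rightarrow> complex) \<Rightarrow> complex \<Rightarrow> complex" where
  "cesaro_op \<mu> f z =
     (\<Sum>n. of_real (moment \<mu> n) * (\<Sum>k\<le>n. fps_nth (fps_expansion f 0) k) * z ^ n)"

definition mu_log :: "real \<Rightarrow> real \<Rightarrow> real measure" where
  "mu_log s \<beta> = density (restrict_space lborel {0..<1})
     (\<lambda>t. ennreal ((1 - t) powr (s - 1) * (ln (exp 1 / (1 - t))) powr (- \<beta>)))"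

definition weighted_integral_finite :: "real \<Rightarrow> real measure \<Rightarrow> bool" where
  "weighted_integral_finite r \<mu> \<longleftrightarrow> (\<integral>\<^sup>+t. ennreal (1 / (1 - t) powr (1 - 1 / r)) \<partial>\<mu>) < \<infinity>"

definition weighted_moments_summable :: "real \<Rightarrow> real measure \<Rightarrow> bool" where
  "weighted_moments_summable r \<mu> \<longleftrightarrow> summable (\<lambda>n. (real n + 1) powr (- 1 / r) * moment \<mu> n)"

definition tail_condition :: "real \<Rightarrow> real \<Rightarrow> real measure \<Rightarrow> bool" where
  "tail_condition r s \<mu> \<longleftrightarrow>
     (\<integral>\<^sup>+t\<in>{0..<1}. ennreal ((measure \<mu> {t..<1} / (1 - t) powr s) powr r / (1 - t)) \<partial>lborel) < \<infinity>"

definition strictly_stronger :: "(real measure \<Rightarrow> bool) \<Rightarrow> (real measure \<Rightarrow> bool) \<Rightarrow> bool" where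
  "strictly_stronger P Q \<longleftrightarrow>
     (\<forall>\<mu>. finite_borel_unit \<mu> \<longrightarrow> P \<mu> \<longrightarrow> Q \<mu>) \<and>
     (\<exists>\<mu>. finite_borel_unit \<mu> \<and> Q \<mu> \<and> \<not> P \<mu>)"

end

theory Submission
  imports Defs
begin

text \<open>Write \<open>\<C>\<^sub>\<mu> f(z) = \<integral> f(tz) / (1 - tz) d\<mu>(t)\<close>. On a circle of radius \<open>\<rho> < 1\<close>, the numerator is bounded by a
  Poisson integral of \<open>u = |f|\<close> and the denominator from below by \<open>max (1 - t) |1 - e\<^sup>i\<^sup>\<theta>|\<close>. Split the Poisson
  integral according to whether \<open>|1 - e\<^sup>i\<^sup>\<theta>|\<close> and \<open>|1 - e\<^sup>i\<^sup>\<phi>|\<close> are comparable. The far part is a Hilbert-type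
  integral of \<open>u\<close>, bounded on \<open>L\<^sup>p\<close> by Schur's test since \<open>p > 1\<close>, times the potential
  \<open>G(\<theta>) = \<integral> d\<mu>(t) / max (1 - t) |1 - e\<^sup>i\<^sup>\<theta>|\<close>; the near part is controlled by Jensen's inequality. So
  \<open>\<parallel>\<C>\<^sub>\<mu> f\<parallel>\<^sub>q\<close> is at most a constant times \<open>\<parallel>G\<parallel>\<^sub>r \<parallel>f\<parallel>\<^sub>p\<close>, by Hoelder with \<open>1/q = 1/p + 1/r\<close>, and
  \<open>\<parallel>G\<parallel>\<^sub>r\<close> is bounded, again by the Hilbert-type inequality, through the \<open>L\<^sup>r\<close> norm of \<open>w(t) = \<mu>[t,1) / (1 - t)\<close>,
  whose finiteness is the tail condition. This bound is small for the part of \<open>\<mu>\<close> near 1, which together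
  with Montel's theorem gives compactness.

  Conversely, test the operator on the Stieltjes-type transform of a truncation of \<open>w\<^bsup>r/p\<^esup>\<close>. On the positive
  radius the image is at least a multiple of \<open>w\<^bsup>1 + r/p\<^esup>\<close>. Multiplying by the transform of \<open>w\<^bsup>r(1 - 1/q)\<^esup>\<close> and
  integrating over the radius, which the mean over the circle controls, bounds \<open>I = \<integral> w\<^sup>r\<close> (truncated) by
  \<open>a + C I\<^bsup>1 - 1/r\<^esup>\<close>, uniformly in the truncation.\<close>

section \<open>Hoelder, Jensen and Hilbert-type inequalities\<close>

text \<open>All mapping estimates rest on one kernel, 1 / max a b, in sizes a, b that are either 1 -
  t on the radius or |1 - e^(i\<theta>)| on the circle. The Schur test needs a single integral of
  such a size, so one inequality serves circle to circle (far part) and radius to circle (potential,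
  test functions). It is applied with exponents p, r and the conjugate of q > 1 only, all above 1;
  for q = 1 the near part needs just Jensen and Fubini, and the dual test function is constant.

  The converse closes because 1/r = 1/q - 1/p: the powers of w add up, 1 + r/p + r(1 - 1/q) = r, and
  so do the norms, I^(1/p) I^(1 - 1/q) = I^(1 - 1/r). Truncation makes I finite beforehand, so the
  power below 1 can be absorbed.

  For \<open>mu_log\<close>, with L = log(e / (1 - t)), the quotient \<mu>[t,1) / (1 - t)^s is at
  most L^(-\<beta>) / s. Its r-th power is integrable against dt / (1 - t) since \<beta> r > 1,
  whereas the weighted integral is that of L^(-\<beta>) / (1 - t), infinite for \<beta> \<le> 1.
  Summable weighted moments give a finite weighted integral, and that gives the tail condition, so
  the same measure separates both.\<close>

lemma nn_integral_Hoelder: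
  fixes f g :: "'a \<Rightarrow> real"
  assumes [measurable]: "f \<in> borel_measurable M" "g \<in> borel_measurable M"
    and nn: "\<And>x. x \<in> space M \<Longrightarrow> 0 \<le> f x" "\<And>x. x \<in> space M \<Longrightarrow> 0 \<le> g x"
    and pq: "1 < p" "1 < q" "1 / p + 1 / q = 1"
    and A: "0 \<le> A" "(\<integral>\<^sup>+x. ennreal (f x powr p) \<partial>M) \<le> ennreal A"
    and B: "0 \<le> B" "(\<integral>\<^sup>+x. ennreal (g x powr q) \<partial>M) \<le> ennreal B"
  shows "(\<integral>\<^sup>+x. ennreal (f x * g x) \<partial>M) \<le> ennreal (A powr (1 / p) * B powr (1 / q))"
proof -
  consider "A = 0" | "B = 0" | "A > 0" "B > 0"
    using A B by linarith
  then show ?thesis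
  proof cases
    case 1
    then have "(\<integral>\<^sup>+x. ennreal (f x powr p) \<partial>M) = 0"
      using A by simp
    then have "AE x in M. ennreal (f x powr p) = 0"
      by (subst (asm) nn_integral_0_iff_AE) auto
    then have "AE x in M. ennreal (f x * g x) = 0"
      by (rule AE_mp) (auto intro!: AE_I2)
    then show ?thesis
      by (subst nn_integral_cong_AE[where v = "\<lambda>_. 0"]) auto
  next
    case 2
    then have "(\<integral>\<^sup>+x. ennreal (g x powr q) \<partial>M) = 0"
      using B by simp
    then have "AE x in M. ennreal (g x powr q) = 0"
      by (subst (asm) nn_integral_0_iff_AE) auto
    then have "AE x in M. ennreal (f x * g x) = 0"
      by (rule AE_mp) (auto intro!: AE_I2)
    then show ?thesis
      by (subst nn_integral_cong_AE[where v = "\<lambda>_. 0"]) auto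
  next
    case 3
    define a b where "a = A powr (1 / p)" and "b = B powr (1 / q)"
    have ab: "a > 0" "b > 0" "a powr p = A" "b powr q = B"
      using 3 pq by (auto simp: a_def b_def powr_powr)
    \<comment> \<open>Dividing by a and b normalises both power integrals to at most 1; integrating
      Young's inequality then gives a b (1/p + 1/q) = a b.\<close>
    have le: "f x * g x \<le> a * b / (p * A) * f x powr p + a * b / (q * B) * g x powr q"
      if "x \<in> space M" for x
    proof -
      have "f x / a * (g x / b) \<le> (f x / a) powr p / p + (g x / b) powr q / q"
        using nn that ab pq by (intro Youngs_inequality) auto
      also have "\<dots> = f x powr p / (A * p) + g x powr q / (B * q)"
        using nn that ab pq by (simp add: powr_divide)
      finally have "a * b * (f x / a * (g x / b)) \<le> a * b * (f x powr p / (A * p) + g x powr q / (B * q))"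
        using ab by (intro mult_left_mono) auto
      then show ?thesis
        using ab pq by (simp add: field_simps)
    qed
    have "(\<integral>\<^sup>+x. ennreal (f x * g x) \<partial>M)
        \<le> (\<integral>\<^sup>+x. ennreal (a * b / (p * A)) * ennreal (f x powr p) + ennreal (a * b / (q * B)) * ennreal (g x powr q) \<partial>M)"
      using le ab pq 3 by (intro nn_integral_mono) (auto simp flip: ennreal_mult ennreal_plus intro!: ennreal_leI)
    also have "\<dots> = ennreal (a * b / (p * A)) * (\<integral>\<^sup>+x. ennreal (f x powr p) \<partial>M)
        + ennreal (a * b / (q * B)) * (\<integral>\<^sup>+x. ennreal (g x powr q) \<partial>M)"
      by (subst nn_integral_add) (auto simp: nn_integral_cmult)
    also have "\<dots> \<le> ennreal (a * b / (p * A)) * ennreal A + ennreal (a * b / (q * B)) * ennreal B"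
      by (intro add_mono mult_left_mono A B) auto
    also have "\<dots> = ennreal (a * b / p + a * b / q)"
      using ab pq 3 by (simp flip: ennreal_mult ennreal_plus)
    also have "a * b / p + a * b / q = a * b * (1 / p + 1 / q)"
      by (simp add: field_simps)
    finally show ?thesis
      using pq by (simp add: a_def b_def)
  qed
qed

text \<open>Hoelder for k f = (k^(1/p) f) k^(1 - 1/p), that is, Jensen for the measure k dM of mass
  at most B. As S is only a lower bound of an extended integral, Bochner integrals and
  \<open>enn2real\<close> values can be inserted for it.\<close>

lemma nn_integral_weighted_Jensen:
  fixes f k :: "'a \<Rightarrow> real"
  assumes [measurable]: "f \<in> borel_measurable M" "k \<in> borel_measurable M"
    and nn: "\<And>x. x \<in> space M \<Longrightarrow> 0 \<le> f x" "\<And>x. x \<in> space M \<Longrightarrow> 0 \<le> k x"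
    and p: "1 \<le> p"
    and B: "0 \<le> B" "(\<integral>\<^sup>+x. ennreal (k x) \<partial>M) \<le> ennreal B"
    and S: "0 \<le> S" "ennreal S \<le> (\<integral>\<^sup>+x. ennreal (k x * f x) \<partial>M)"
  shows "ennreal (S powr p) \<le> ennreal (B powr (p - 1)) * (\<integral>\<^sup>+x. ennreal (k x * f x powr p) \<partial>M)"
proof (cases "B = 0")
  case True
  then have "(\<integral>\<^sup>+x. ennreal (k x) \<partial>M) = 0"
    using B by simp
  then have "AE x in M. ennreal (k x) = 0"
    by (subst (asm) nn_integral_0_iff_AE) auto
  then have "AE x in M. ennreal (k x * f x) = 0"
    by (rule AE_mp) (auto intro!: AE_I2 simp: ennreal_eq_0_iff nn mult_nonpos_nonneg)
  then have "(\<integral>\<^sup>+x. ennreal (k x * f x) \<partial>M) = 0"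
    by (subst nn_integral_cong_AE[where v = "\<lambda>_. 0"]) auto
  then have "S = 0"
    using S by simp
  then show ?thesis by simp
next
  case False
  then have B0: "B > 0" using B by simp
  show ?thesis
  proof (cases "p = 1")
    case True
    have "(\<integral>\<^sup>+x. ennreal (k x * f x powr 1) \<partial>M) = (\<integral>\<^sup>+x. ennreal (k x * f x) \<partial>M)"
      by (intro nn_integral_cong) (use nn in auto)
    then show ?thesis
      using S B0 True by simp
  next
    case False
    then have p1: "p > 1" using p by simp
    define q where "q = p / (p - 1)"
    have q: "q > 1" "1 / p + 1 / q = 1"
      using p1 by (auto simp: q_def field_simps)
    show ?thesis
    proof (cases "(\<integral>\<^sup>+x. ennreal (k x * f x powr p) \<partial>M)" rule: ennreal_cases)
      case top
      then show ?thesis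
        using B0 by (simp add: ennreal_mult_top)
    next
      case (real A)
      have "(\<integral>\<^sup>+x. ennreal (k x * f x) \<partial>M) = (\<integral>\<^sup>+x. ennreal ((k x powr (1 / p) * f x) * k x powr (1 / q)) \<partial>M)"
      proof (intro nn_integral_cong arg_cong[where f = ennreal])
        fix x assume "x \<in> space M"
        have "(k x powr (1 / p) * f x) * k x powr (1 / q) = k x powr (1 / p + 1 / q) * f x"
          by (simp only: powr_add ac_simps)
        also have "\<dots> = k x * f x"
          unfolding q using nn[OF \<open>x \<in> space M\<close>] by simp
        finally show "k x * f x = (k x powr (1 / p) * f x) * k x powr (1 / q)" ..
      qed
      also have "\<dots> \<le> ennreal (A powr (1 / p) * B powr (1 / q))"
      proof (rule nn_integral_Hoelder[OF _ _ _ _ p1 q \<open>0 \<le> A\<close> _ B(1)])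
        have "(\<integral>\<^sup>+x. ennreal ((k x powr (1 / p) * f x) powr p) \<partial>M) = (\<integral>\<^sup>+x. ennreal (k x * f x powr p) \<partial>M)"
          using p1 nn by (intro nn_integral_cong arg_cong[where f = ennreal]) (simp add: powr_mult powr_powr)
        then show "(\<integral>\<^sup>+x. ennreal ((k x powr (1 / p) * f x) powr p) \<partial>M) \<le> ennreal A"
          using real by simp
        have "(\<integral>\<^sup>+x. ennreal ((k x powr (1 / q)) powr q) \<partial>M) = (\<integral>\<^sup>+x. ennreal (k x) \<partial>M)"
          using q nn by (intro nn_integral_cong arg_cong[where f = ennreal]) (simp add: powr_powr)
        then show "(\<integral>\<^sup>+x. ennreal ((k x powr (1 / q)) powr q) \<partial>M) \<le> ennreal B"
          using B by simp
      qed (use nn in auto)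
      finally have "S \<le> A powr (1 / p) * B powr (1 / q)"
        using S(2) by (metis (no_types, lifting) ennreal_le_iff order_trans powr_ge_zero mult_nonneg_nonneg)
      then have "S powr p \<le> (A powr (1 / p) * B powr (1 / q)) powr p"
        using S p1 by (intro powr_mono2) auto
      also have "\<dots> = A * B powr (p - 1)"
        using p1 B0 \<open>0 \<le> A\<close> by (simp add: powr_mult powr_powr q_def)
      finally show ?thesis
        unfolding real using \<open>0 \<le> A\<close> by (simp flip: ennreal_mult' add: mult.commute ennreal_leI)
    qed
  qed
qed

text \<open>The model is a x = x on the half-line, where the integral scales exactly like
  c^(-\<alpha>). The condition is the hypothesis of Schur's test for the kernel 1 / max with power
  weights.\<close>

definition size_weight :: "'a measure \<Rightarrow> ('a \<Rightarrow> real) \<Rightarrow> bool" where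
  "size_weight M a \<longleftrightarrow> sigma_finite_measure M \<and> a \<in> borel_measurable M \<and> (\<forall>x\<in>space M. 0 < a x) \<and>
     (\<forall>\<alpha>. 0 < \<alpha> \<longrightarrow> \<alpha> < 1 \<longrightarrow> (\<exists>C\<ge>0. \<forall>c>0.
        (\<integral>\<^sup>+x. ennreal (a x powr (- \<alpha>) / max c (a x)) \<partial>M) \<le> ennreal (C * c powr (- \<alpha>))))"

text \<open>If f is not integrable, its Bochner integral is 0 by convention and the bound is
  trivial.\<close>

lemma ennreal_integral_le_nn_integral:
  fixes f :: "'a \<Rightarrow> real"
  assumes "f \<in> borel_measurable M" "\<And>x. x \<in> space M \<Longrightarrow> 0 \<le> f x"
  shows "ennreal (\<integral>x. f x \<partial>M) \<le> (\<integral>\<^sup>+x. ennreal (f x) \<partial>M)"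
proof (cases "integrable M f")
  case True
  then show ?thesis
    using assms by (subst nn_integral_eq_integral) (auto intro!: AE_I2)
next
  case False
  then show ?thesis
    by (simp add: not_integrable_integral_eq)
qed

text \<open>Schur's test: Jensen in x with weight a^(-\<alpha>) / max a b, then Fubini, then the
  size bound in y. The constant depends on the two sizes and p, not on f.\<close>

lemma hilbert_inequality:
  assumes M: "size_weight M a" and N: "size_weight N b" and p: "1 < p"
  shows "\<exists>C\<ge>0. \<forall>f\<in>borel_measurable M. (\<forall>x\<in>space M. 0 \<le> f x) \<longrightarrow>
    (\<integral>\<^sup>+y. ennreal ((\<integral>x. f x / max (a x) (b y) \<partial>M) powr p) \<partial>N)
      \<le> ennreal C * (\<integral>\<^sup>+x. ennreal (f x powr p) \<partial>M)"
proof -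
  have [measurable]: "a \<in> borel_measurable M" "b \<in> borel_measurable N"
    and apos: "\<And>x. x \<in> space M \<Longrightarrow> a x > 0" and bpos: "\<And>x. x \<in> space N \<Longrightarrow> b x > 0"
    using M N by (auto simp: size_weight_def)
  interpret M: sigma_finite_measure M using M by (auto simp: size_weight_def)
  interpret N: sigma_finite_measure N using N by (auto simp: size_weight_def)
  interpret P: pair_sigma_finite M N ..
  \<comment> \<open>Jensen leaves b^(-\<alpha>(p - 1)) = b^(-\<gamma>) and a^(-\<alpha> + \<alpha>p)
    = a^\<gamma>; the y-integral of b^(-\<gamma>) / max then produces a^(-\<gamma>), and the powers
    of a cancel. Both exponents lie in (0,1) because p > 1.\<close>
  define \<alpha> \<gamma> where "\<alpha> = 1 / p" and "\<gamma> = 1 - 1 / p"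
  have \<alpha>: "0 < \<alpha>" "\<alpha> < 1" "0 < \<gamma>" "\<gamma> < 1" "\<alpha> * (p - 1) = \<gamma>" "\<alpha> * p = 1"
    using p by (auto simp: \<alpha>_def \<gamma>_def field_simps)
  obtain C1 where C1: "C1 \<ge> 0" "\<And>c. c > 0 \<Longrightarrow>
        (\<integral>\<^sup>+x. ennreal (a x powr (- \<alpha>) / max c (a x)) \<partial>M) \<le> ennreal (C1 * c powr (- \<alpha>))"
    using M \<alpha> unfolding size_weight_def by meson
  obtain C2 where C2: "C2 \<ge> 0" "\<And>c. c > 0 \<Longrightarrow>
        (\<integral>\<^sup>+x. ennreal (b x powr (- \<gamma>) / max c (b x)) \<partial>N) \<le> ennreal (C2 * c powr (- \<gamma>))"
    using N \<alpha> unfolding size_weight_def by meson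
  show ?thesis
  proof (intro exI[of _ "C1 powr (p - 1) * C2"] conjI ballI impI)
    show "0 \<le> C1 powr (p - 1) * C2" using C2 by simp
    fix f :: "'a \<Rightarrow> real" assume f[measurable]: "f \<in> borel_measurable M" and "\<forall>x\<in>space M. 0 \<le> f x"
    then have fnn: "\<And>x. x \<in> space M \<Longrightarrow> 0 \<le> f x" by auto
    have *: "ennreal ((\<integral>x. f x / max (a x) (b y) \<partial>M) powr p)
        \<le> ennreal (C1 powr (p - 1)) * (\<integral>\<^sup>+x. ennreal (a x powr \<gamma> * f x powr p) * ennreal (b y powr (- \<gamma>) / max (a x) (b y)) \<partial>M)"
      if y: "y \<in> space N" for y
    proof -
      note by' = bpos[OF y]
      have "ennreal ((\<integral>x. f x / max (a x) (b y) \<partial>M) powr p)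
         \<le> ennreal ((C1 * b y powr (- \<alpha>)) powr (p - 1)) *
           (\<integral>\<^sup>+x. ennreal (a x powr (- \<alpha>) / max (b y) (a x) * (f x * a x powr \<alpha>) powr p) \<partial>M)"
      proof (rule nn_integral_weighted_Jensen)
        show "ennreal (\<integral>x. f x / max (a x) (b y) \<partial>M)
           \<le> (\<integral>\<^sup>+x. ennreal (a x powr (- \<alpha>) / max (b y) (a x) * (f x * a x powr \<alpha>)) \<partial>M)"
        proof -
          have "ennreal (\<integral>x. f x / max (a x) (b y) \<partial>M) \<le> (\<integral>\<^sup>+x. ennreal (f x / max (a x) (b y)) \<partial>M)"
            using fnn apos by (intro ennreal_integral_le_nn_integral) (auto simp: less_imp_le le_max_iff_disj)
          also have "\<dots> = (\<integral>\<^sup>+x. ennreal (a x powr (- \<alpha>) / max (b y) (a x) * (f x * a x powr \<alpha>)) \<partial>M)"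
          proof (intro nn_integral_cong arg_cong[where f = ennreal])
            fix x assume "x \<in> space M"
            then have "a x powr (- \<alpha>) * a x powr \<alpha> = 1"
              using apos[of x] by (simp add: powr_minus)
            then show "f x / max (a x) (b y) = a x powr (- \<alpha>) / max (b y) (a x) * (f x * a x powr \<alpha>)"
              by (simp add: max.commute mult.commute mult.left_commute)
          qed
          finally show ?thesis .
        qed
        show "0 \<le> (\<integral>x. f x / max (a x) (b y) \<partial>M)"
          using fnn by' by (intro integral_nonneg_AE AE_I2) (auto simp: le_max_iff_disj)
        show "(\<integral>\<^sup>+x. ennreal (a x powr (- \<alpha>) / max (b y) (a x)) \<partial>M) \<le> ennreal (C1 * b y powr (- \<alpha>))"
          using C1 by' by auto
      qed (use fnn by' C1 p in \<open>auto simp: le_max_iff_disj\<close>)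
      also have "(C1 * b y powr (- \<alpha>)) powr (p - 1) = C1 powr (p - 1) * b y powr (- \<gamma>)"
        using C1 \<alpha> by (simp add: powr_mult powr_powr)
      also have "ennreal \<dots> * (\<integral>\<^sup>+x. ennreal (a x powr (- \<alpha>) / max (b y) (a x) * (f x * a x powr \<alpha>) powr p) \<partial>M)
        = ennreal (C1 powr (p - 1)) * (\<integral>\<^sup>+x. ennreal (b y powr (- \<gamma>)) * ennreal (a x powr (- \<alpha>) / max (b y) (a x) * (f x * a x powr \<alpha>) powr p) \<partial>M)"
        by (simp add: nn_integral_cmult ennreal_mult' mult.assoc)
      also have "(\<integral>\<^sup>+x. ennreal (b y powr (- \<gamma>)) * ennreal (a x powr (- \<alpha>) / max (b y) (a x) * (f x * a x powr \<alpha>) powr p) \<partial>M)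
        = (\<integral>\<^sup>+x. ennreal (a x powr \<gamma> * f x powr p) * ennreal (b y powr (- \<gamma>) / max (a x) (b y)) \<partial>M)"
      proof (intro nn_integral_cong)
        fix x assume x: "x \<in> space M"
        have "(f x * a x powr \<alpha>) powr p = f x powr p * a x powr 1"
          using fnn[OF x] apos[OF x] \<alpha> by (simp add: powr_mult powr_powr)
        moreover have "a x powr (- \<alpha>) * a x powr 1 = a x powr \<gamma>"
          unfolding powr_add[symmetric] by (simp add: \<alpha>_def \<gamma>_def)
        ultimately have "a x powr (- \<alpha>) / max (b y) (a x) * (f x * a x powr \<alpha>) powr p = a x powr \<gamma> * f x powr p / max (a x) (b y)"
          by (simp add: max.commute)
        then show "ennreal (b y powr (- \<gamma>)) * ennreal (a x powr (- \<alpha>) / max (b y) (a x) * (f x * a x powr \<alpha>) powr p)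
          = ennreal (a x powr \<gamma> * f x powr p) * ennreal (b y powr (- \<gamma>) / max (a x) (b y))"
          by (simp flip: ennreal_mult' add: mult_ac)
      qed
      finally show ?thesis .
    qed
    have "(\<integral>\<^sup>+y. ennreal ((\<integral>x. f x / max (a x) (b y) \<partial>M) powr p) \<partial>N)
      \<le> (\<integral>\<^sup>+y. ennreal (C1 powr (p - 1)) * (\<integral>\<^sup>+x. ennreal (a x powr \<gamma> * f x powr p) * ennreal (b y powr (- \<gamma>) / max (a x) (b y)) \<partial>M) \<partial>N)"
      by (intro nn_integral_mono *)
    also have "\<dots> = ennreal (C1 powr (p - 1)) * (\<integral>\<^sup>+y. (\<integral>\<^sup>+x. ennreal (a x powr \<gamma> * f x powr p) * ennreal (b y powr (- \<gamma>) / max (a x) (b y)) \<partial>M) \<partial>N)"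
      by (intro nn_integral_cmult) measurable
    also have "(\<integral>\<^sup>+y. (\<integral>\<^sup>+x. ennreal (a x powr \<gamma> * f x powr p) * ennreal (b y powr (- \<gamma>) / max (a x) (b y)) \<partial>M) \<partial>N)
      = (\<integral>\<^sup>+x. (\<integral>\<^sup>+y. ennreal (a x powr \<gamma> * f x powr p) * ennreal (b y powr (- \<gamma>) / max (a x) (b y)) \<partial>N) \<partial>M)"
      by (intro P.Fubini') measurable
    also have "\<dots> \<le> (\<integral>\<^sup>+x. ennreal C2 * ennreal (f x powr p) \<partial>M)"
    proof (intro nn_integral_mono)
      fix x assume x: "x \<in> space M"
      have "(\<integral>\<^sup>+y. ennreal (a x powr \<gamma> * f x powr p) * ennreal (b y powr (- \<gamma>) / max (a x) (b y)) \<partial>N)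
        = ennreal (a x powr \<gamma> * f x powr p) * (\<integral>\<^sup>+y. ennreal (b y powr (- \<gamma>) / max (a x) (b y)) \<partial>N)"
        by (intro nn_integral_cmult) measurable
      also have "\<dots> \<le> ennreal (a x powr \<gamma> * f x powr p) * ennreal (C2 * a x powr (- \<gamma>))"
        using C2 apos[OF x] by (intro mult_left_mono) auto
      also have "\<dots> = ennreal (a x powr \<gamma> * f x powr p * (C2 * a x powr (- \<gamma>)))"
        by (simp flip: ennreal_mult')
      also have "a x powr \<gamma> * f x powr p * (C2 * a x powr (- \<gamma>)) = C2 * f x powr p"
        using apos[OF x] by (simp add: powr_minus field_simps)
      finally show "(\<integral>\<^sup>+y. ennreal (a x powr \<gamma> * f x powr p) * ennreal (b y powr (- \<gamma>) / max (a x) (b y)) \<partial>N) \<le> ennreal C2 * ennreal (f x powr p)"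
        by (simp add: ennreal_mult'')
    qed
    also have "\<dots> = ennreal C2 * (\<integral>\<^sup>+x. ennreal (f x powr p) \<partial>M)"
      by (intro nn_integral_cmult) measurable
    finally show "(\<integral>\<^sup>+y. ennreal ((\<integral>x. f x / max (a x) (b y) \<partial>M) powr p) \<partial>N)
      \<le> ennreal (C1 powr (p - 1) * C2) * (\<integral>\<^sup>+x. ennreal (f x powr p) \<partial>M)"
      by (simp add: ennreal_mult'' mult.assoc mult_left_mono C2)
  qed
qed

section \<open>The circle and the Poisson kernel\<close>

text \<open>The two summands of the constant come from (0,c], where the maximum is c, and from
  [c,\<infinity>), where it is x.\<close>

lemma nn_integral_size_weight_real:
  assumes \<alpha>: "0 < \<alpha>" "\<alpha> < 1" and c: "0 < c"
  shows "(\<integral>\<^sup>+x. ennreal (x powr (- \<alpha>) / max c x) * indicator {0<..} x \<partial>lborel)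
    \<le> ennreal ((1 / (1 - \<alpha>) + 1 / \<alpha>) * c powr (- \<alpha>))"
proof -
  have 1: "(\<integral>\<^sup>+x. ennreal (x powr (- \<alpha>)) * indicator {0..c} x \<partial>lborel) = ennreal (c powr (1 - \<alpha>) / (1 - \<alpha>))"
    using has_integral_powr_from_0[of "- \<alpha>" c] \<alpha> c by (intro nn_integral_has_integral_lebesgue') auto
  have 2: "(\<integral>\<^sup>+x. ennreal (x powr (- \<alpha> - 1)) * indicator {c..} x \<partial>lborel) = ennreal (c powr (- \<alpha>) / \<alpha>)"
    using has_integral_powr_to_inf[of "- \<alpha> - 1" c] \<alpha> c by (intro nn_integral_has_integral_lebesgue') auto
  have "(\<integral>\<^sup>+x. ennreal (x powr (- \<alpha>) / max c x) * indicator {0<..} x \<partial>lborel)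
    \<le> (\<integral>\<^sup>+x. ennreal (1 / c) * (ennreal (x powr (- \<alpha>)) * indicator {0..c} x) +
          ennreal (x powr (- \<alpha> - 1)) * indicator {c..} x \<partial>lborel)"
  proof (intro nn_integral_mono)
    fix x :: real
    consider "x \<le> 0" | "0 < x" "x \<le> c" | "c < x" by linarith
    then show "ennreal (x powr (- \<alpha>) / max c x) * indicator {0<..} x
      \<le> ennreal (1 / c) * (ennreal (x powr (- \<alpha>)) * indicator {0..c} x) +
          ennreal (x powr (- \<alpha> - 1)) * indicator {c..} x"
    proof cases
      case 2
      have "ennreal (x powr (- \<alpha>) / max c x) = ennreal (1 / c) * ennreal (x powr (- \<alpha>))"
        using 2 c by (simp add: max_def flip: ennreal_mult')
      then show ?thesis using 2 by (simp add: indicator_def)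
    next
      case 3
      have "x powr (- \<alpha>) / max c x = x powr (- \<alpha> - 1)"
        using 3 c by (simp add: max_def powr_diff)
      then show ?thesis using 3 c by (simp add: indicator_def)
    qed simp
  qed
  also have "\<dots> = ennreal (1 / c) * ennreal (c powr (1 - \<alpha>) / (1 - \<alpha>)) + ennreal (c powr (- \<alpha>) / \<alpha>)"
    unfolding 1[symmetric] 2[symmetric] by (subst nn_integral_add) (auto simp: nn_integral_cmult)
  also have "\<dots> = ennreal (1 / c * (c powr (1 - \<alpha>) / (1 - \<alpha>)) + c powr (- \<alpha>) / \<alpha>)"
    using \<alpha> c by (simp flip: ennreal_mult ennreal_plus)
  also have "1 / c * (c powr (1 - \<alpha>) / (1 - \<alpha>)) = c powr (- \<alpha>) / (1 - \<alpha>)"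
    using \<alpha> c by (simp add: powr_diff powr_minus field_simps)
  finally show ?thesis
    by (simp add: algebra_simps)
qed

section \<open>The radius and the circle as measure spaces with a size\<close>

definition unit_len :: "real measure" where
  "unit_len = restrict_space lborel {0..<1}"

text \<open>The interval is open because |1 - e^(i\<theta>)| vanishes at both ends and a size has to
  be positive on the whole space.\<close>

definition circ :: "real measure" where
  "circ = restrict_space lborel {0<..<2 * pi}"

lemma space_unit_len [simp]: "space unit_len = {0..<1}"
  by (simp add: unit_len_def space_restrict_space)

lemma space_circ [simp]: "space circ = {0<..<2 * pi}"
  by (simp add: circ_def space_restrict_space)

lemma measurable_unit_lenI: "f \<in> borel_measurable borel \<Longrightarrow> f \<in> borel_measurable unit_len"
  unfolding unit_len_def by (intro measurable_restrict_space1) simp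

lemma measurable_circI: "f \<in> borel_measurable borel \<Longrightarrow> f \<in> borel_measurable circ"
  unfolding circ_def by (intro measurable_restrict_space1) simp

lemma finite_measure_unit_len: "finite_measure unit_len"
  by (intro finite_measureI) (simp add: unit_len_def emeasure_restrict_space space_restrict_space)

lemma finite_measure_circ: "finite_measure circ"
  by (intro finite_measureI) (simp add: circ_def emeasure_restrict_space space_restrict_space)

lemma nn_integral_unit_len:
  "(\<integral>\<^sup>+t. f t \<partial>unit_len) = (\<integral>\<^sup>+t. f t * indicator {0..<1} t \<partial>lborel)"
  unfolding unit_len_def by (intro nn_integral_restrict_space) simp

lemma nn_integral_circ:
  "(\<integral>\<^sup>+t. f t \<partial>circ) = (\<integral>\<^sup>+t. f t * indicator {0<..<2 * pi} t \<partial>lborel)"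
  unfolding circ_def by (intro nn_integral_restrict_space) simp

lemma size_weight_unit_len: "size_weight unit_len (\<lambda>t. 1 - t)"
  unfolding size_weight_def
proof (intro conjI allI impI)
  interpret finite_measure unit_len by (rule finite_measure_unit_len)
  show "sigma_finite_measure unit_len" ..
  show "(\<lambda>t. 1 - t) \<in> borel_measurable unit_len"
    by (intro measurable_unit_lenI) simp
  show "\<forall>t\<in>space unit_len. 0 < 1 - t" by simp
  fix \<alpha> :: real assume \<alpha>: "0 < \<alpha>" "\<alpha> < 1"
  show "\<exists>C\<ge>0. \<forall>c>0. (\<integral>\<^sup>+t. ennreal ((1 - t) powr (- \<alpha>) / max c (1 - t)) \<partial>unit_len) \<le> ennreal (C * c powr (- \<alpha>))"
  proof (intro exI[of _ "1 / (1 - \<alpha>) + 1 / \<alpha>"] conjI allI impI)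
    show "0 \<le> 1 / (1 - \<alpha>) + 1 / \<alpha>" using \<alpha> by simp
    fix c :: real assume c: "c > 0"
    have "(\<integral>\<^sup>+t. ennreal ((1 - t) powr (- \<alpha>) / max c (1 - t)) \<partial>unit_len)
      = (\<integral>\<^sup>+t. ennreal ((1 - t) powr (- \<alpha>) / max c (1 - t)) * indicator {0<..1} (1 - t) \<partial>lborel)"
      unfolding nn_integral_unit_len by (intro nn_integral_cong) (auto simp: indicator_def)
    also have "\<dots> = (\<integral>\<^sup>+x. ennreal (x powr (- \<alpha>) / max c x) * indicator {0<..1} x \<partial>lborel)"
      by (subst nn_integral_real_affine[where c = "-1" and t = 1]) auto
    also have "\<dots> \<le> (\<integral>\<^sup>+x. ennreal (x powr (- \<alpha>) / max c x) * indicator {0<..} x \<partial>lborel)"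
      by (intro nn_integral_mono) (auto simp: indicator_def)
    also have "\<dots> \<le> ennreal ((1 / (1 - \<alpha>) + 1 / \<alpha>) * c powr (- \<alpha>))"
      by (intro nn_integral_size_weight_real \<alpha> c)
    finally show "(\<integral>\<^sup>+t. ennreal ((1 - t) powr (- \<alpha>) / max c (1 - t)) \<partial>unit_len)
      \<le> ennreal ((1 / (1 - \<alpha>) + 1 / \<alpha>) * c powr (- \<alpha>))" .
  qed
qed

definition chord :: "real \<Rightarrow> real" where
  "chord \<theta> = cmod (cis \<theta> - 1)"

lemma borel_measurable_chord: "chord \<in> borel_measurable borel"
  unfolding chord_def by (intro borel_measurable_continuous_onI continuous_intros)

lemma chord_nonneg [simp]: "0 \<le> chord \<theta>"
  by (simp add: chord_def)

text \<open>Jordan's inequality: by concavity the graph of the sine lies above its secant from 0 to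
  pi / 2.\<close>

lemma sin_ge_linear:
  assumes "0 \<le> x" "x \<le> pi / 2"
  shows "2 / pi * x \<le> sin x"
proof -
  have "concave_on {0..pi} sin"
    by (rule f''_le0_imp_concave[where f' = cos and f'' = "\<lambda>x. - sin x"])
      (auto intro!: derivative_eq_intros sin_ge_zero)
  then have "(1 - 2 / pi * x) * sin 0 + 2 / pi * x * sin (pi / 2) \<le> sin ((1 - 2 / pi * x) *\<^sub>R 0 + (2 / pi * x) *\<^sub>R (pi / 2))"
    using assms by (intro concave_onD) (auto simp: field_simps)
  then show ?thesis by simp
qed

text \<open>The chord is 2 |sin (\<theta> / 2)|, and Jordan's inequality gives 2 \<theta> / pi on
  [0,pi]; the constant 1/2 is a rounding by pi < 4. Beyond pi, conjugation replaces \<theta> by 2 pi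
  - \<theta>.\<close>

lemma chord_ge:
  assumes "0 \<le> \<theta>" "\<theta> \<le> 2 * pi"
  shows "min \<theta> (2 * pi - \<theta>) / 2 \<le> chord \<theta>"
proof -
  have *: "\<theta> / 2 \<le> chord \<theta>" if "0 \<le> \<theta>" "\<theta> \<le> pi" for \<theta>
  proof -
    have "\<theta> / 2 = \<theta> * (2 * (1 / 4))" by simp
    also have "\<dots> \<le> \<theta> * (2 * (1 / pi))"
      using that pi_less_4 by (intro mult_left_mono divide_left_mono) auto
    also have "\<dots> = 2 * (2 / pi * (\<theta> / 2))"
      by argo
    also have "\<dots> \<le> 2 * sin (\<theta> / 2)"
      using that by (intro mult_left_mono sin_ge_linear) auto
    also have "\<dots> \<le> chord \<theta>"
      unfolding chord_def cis_conv_exp dist_exp_i_1 by simp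
    finally show ?thesis .
  qed
  show ?thesis
  proof (cases "\<theta> \<le> pi")
    case True
    then show ?thesis using *[of \<theta>] assms by simp
  next
    case False
    have "cis (2 * pi - \<theta>) = cnj (cis \<theta>)"
      by (simp add: complex_eq_iff cos_diff sin_diff)
    then have "cmod (cis (2 * pi - \<theta>) - 1) = cmod (cnj (cis \<theta> - 1))"
      by simp
    then have "chord (2 * pi - \<theta>) = chord \<theta>"
      unfolding chord_def complex_mod_cnj .
    then show ?thesis using *[of "2 * pi - \<theta>"] assms False by simp
  qed
qed

lemma chord_pos: "\<theta> \<in> {0<..<2 * pi} \<Longrightarrow> 0 < chord \<theta>"
  using chord_ge[of \<theta>] by auto

lemma size_weight_circ: "size_weight circ chord"
  unfolding size_weight_def
proof (intro conjI allI impI)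
  interpret finite_measure circ by (rule finite_measure_circ)
  show "sigma_finite_measure circ" ..
  show "chord \<in> borel_measurable circ"
    by (intro measurable_circI borel_measurable_chord)
  show "\<forall>t\<in>space circ. 0 < chord t" by (simp add: chord_pos)
  fix \<alpha> :: real assume \<alpha>: "0 < \<alpha>" "\<alpha> < 1"
  let ?C = "1 / (1 - \<alpha>) + 1 / \<alpha>"
  define g where "g c x = x powr (- \<alpha>) / max c x" for c x :: real
  have g_meas [measurable]: "g c \<in> borel_measurable borel" for c
    unfolding g_def by measurable
  have g_nn: "0 \<le> g c x" if "c > 0" for c x
    using that by (auto simp: g_def le_max_iff_disj)
  \<comment> \<open>Halving the argument costs 2^\<alpha> in the power and at most 2 in the
    maximum.\<close>
  have g_le: "g c x \<le> 2 powr (\<alpha> + 1) * g c y" if "0 < y" "y / 2 \<le> x" "c > 0" for c x y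
  proof -
    have "x powr (- \<alpha>) \<le> (y / 2) powr (- \<alpha>)"
      using that \<alpha> by (intro powr_mono2') auto
    also have "\<dots> = 2 powr \<alpha> * y powr (- \<alpha>)"
      using that by (simp add: powr_divide powr_minus field_simps)
    finally have "x powr (- \<alpha>) / max c x \<le> 2 powr \<alpha> * y powr (- \<alpha>) / (max c y / 2)"
      using that by (intro frac_le) auto
    then show ?thesis by (simp add: g_def powr_add mult_ac)
  qed
  show "\<exists>C\<ge>0. \<forall>c>0. (\<integral>\<^sup>+t. ennreal (chord t powr (- \<alpha>) / max c (chord t)) \<partial>circ) \<le> ennreal (C * c powr (- \<alpha>))"
  proof (intro exI[of _ "2 powr (\<alpha> + 1) * (2 * ?C)"] conjI allI impI)
    show "0 \<le> 2 powr (\<alpha> + 1) * (2 * ?C)" using \<alpha> by simp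
    fix c :: real assume c: "c > 0"
    have "(\<integral>\<^sup>+t. ennreal (chord t powr (- \<alpha>) / max c (chord t)) \<partial>circ)
      = (\<integral>\<^sup>+t. ennreal (g c (chord t)) \<partial>circ)"
      by (simp add: g_def)
    \<comment> \<open>The sum over the distances t and 2 pi - t to the two ends replaces their
      minimum; each summand is again the half-line integral.\<close>
    also have "\<dots> \<le> (\<integral>\<^sup>+t. ennreal (2 powr (\<alpha> + 1)) * (ennreal (g c t) * indicator {0<..} t
        + ennreal (g c (2 * pi - t)) * indicator {0<..} (2 * pi - t)) \<partial>lborel)"
      unfolding nn_integral_circ
    proof (intro nn_integral_mono)
      fix t :: real
      show "ennreal (g c (chord t)) * indicator {0<..<2 * pi} t \<le> ennreal (2 powr (\<alpha> + 1)) * (ennreal (g c t) * indicator {0<..} t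
        + ennreal (g c (2 * pi - t)) * indicator {0<..} (2 * pi - t))"
      proof (cases "t \<in> {0<..<2 * pi}")
        case True
        then have "t / 2 \<le> chord t \<or> (2 * pi - t) / 2 \<le> chord t"
          using chord_ge[of t] by (auto simp: min_def split: if_splits)
        then have "g c (chord t) \<le> 2 powr (\<alpha> + 1) * g c t \<or> g c (chord t) \<le> 2 powr (\<alpha> + 1) * g c (2 * pi - t)"
          using g_le[of t "chord t" c] g_le[of "2 * pi - t" "chord t" c] True c by auto
        moreover have "0 \<le> 2 powr (\<alpha> + 1) * g c t" "0 \<le> 2 powr (\<alpha> + 1) * g c (2 * pi - t)"
          using g_nn c by auto
        ultimately have "g c (chord t) \<le> 2 powr (\<alpha> + 1) * (g c t + g c (2 * pi - t))"
          by (auto simp: distrib_left)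
        then show ?thesis
          using True g_nn[OF c] by (simp add: ennreal_leI flip: ennreal_mult ennreal_plus)
      qed simp
    qed
    also have "\<dots> = ennreal (2 powr (\<alpha> + 1)) * ((\<integral>\<^sup>+t. ennreal (g c t) * indicator {0<..} t \<partial>lborel)
        + (\<integral>\<^sup>+t. ennreal (g c (2 * pi - t)) * indicator {0<..} (2 * pi - t) \<partial>lborel))"
      by (simp add: nn_integral_cmult nn_integral_add)
    also have "(\<integral>\<^sup>+t. ennreal (g c (2 * pi - t)) * indicator {0<..} (2 * pi - t) \<partial>lborel)
       = (\<integral>\<^sup>+t. ennreal (g c t) * indicator {0<..} t \<partial>lborel)"
      by (subst (2) nn_integral_real_affine[where c = "-1" and t = "2 * pi"]) auto
    also have "ennreal (2 powr (\<alpha> + 1)) * ((\<integral>\<^sup>+t. ennreal (g c t) * indicator {0<..} t \<partial>lborel)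
        + (\<integral>\<^sup>+t. ennreal (g c t) * indicator {0<..} t \<partial>lborel))
       \<le> ennreal (2 powr (\<alpha> + 1)) * (ennreal (?C * c powr (- \<alpha>)) + ennreal (?C * c powr (- \<alpha>)))"
      unfolding g_def by (intro mult_left_mono add_mono nn_integral_size_weight_real \<alpha> c) auto
    also have "\<dots> = ennreal (2 powr (\<alpha> + 1) * (2 * ?C) * c powr (- \<alpha>))"
      using \<alpha> by (simp flip: ennreal_mult' ennreal_plus)
    finally show "(\<integral>\<^sup>+t. ennreal (chord t powr (- \<alpha>) / max c (chord t)) \<partial>circ) \<le> ennreal (2 powr (\<alpha> + 1) * (2 * ?C) * c powr (- \<alpha>))" .
  qed
qed

lemma nn_integral_circ_eq_integral:
  assumes "continuous_on {0..2 * pi} v" "\<And>\<theta>. \<theta> \<in> {0..2 * pi} \<Longrightarrow> 0 \<le> v \<theta>"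
  shows "(\<integral>\<^sup>+\<theta>. ennreal (v \<theta>) \<partial>circ) = ennreal (integral {0..2 * pi} v)"
proof -
  have "(v has_integral integral {0..2 * pi} v) {0..2 * pi}"
    using assms by (intro integrable_integral integrable_continuous_interval)
  then have "(v has_integral integral {0..2 * pi} v) {0<..<2 * pi}"
    by (simp add: has_integral_Icc_iff_Ioo)
  then show ?thesis
    unfolding nn_integral_circ using assms by (intro nn_integral_has_integral_lebesgue') auto
qed

text \<open>The Poisson kernel of the point t e^(i\<theta>) without the factor 1 / (2 pi), so that
  its mass over the circle is 2 pi.\<close>

definition poisson :: "real \<Rightarrow> real \<Rightarrow> real \<Rightarrow> real" where
  "poisson t \<theta> \<phi> = (1 - t\<^sup>2) / (cmod (cis \<phi> - of_real t * cis \<theta>))\<^sup>2"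

lemma cis_minus_ge: "0 \<le> t \<Longrightarrow> t \<le> 1 \<Longrightarrow> 1 - t \<le> cmod (cis \<phi> - of_real t * cis \<theta>)"
  using norm_triangle_ineq2[of "cis \<phi>" "of_real t * cis \<theta>"] by (simp add: norm_mult)

lemma poisson_nonneg: "0 \<le> t \<Longrightarrow> t < 1 \<Longrightarrow> 0 \<le> poisson t \<theta> \<phi>"
  by (simp add: poisson_def power_le_one)

text \<open>Through this symmetry the kernel can also be integrated out in the angle of the interior
  point, which the near part relies on.\<close>

lemma poisson_commute: "poisson t \<theta> \<phi> = poisson t \<phi> \<theta>"
proof -
  have "(cmod (cis \<phi> - of_real t * cis \<theta>))\<^sup>2 = (cmod (cis \<theta> - of_real t * cis \<phi>))\<^sup>2"
    unfolding cmod_power2 by (simp add: power2_diff power_mult_distrib sin_squared_eq right_diff_distrib)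
  then show ?thesis by (simp add: poisson_def)
qed

lemma continuous_on_poisson: "0 \<le> t \<Longrightarrow> t < 1 \<Longrightarrow> continuous_on A (poisson t \<theta>)"
  unfolding poisson_def
proof (intro continuous_intros ballI)
  fix \<phi> assume "0 \<le> t" "t < 1"
  then show "(cmod (cis \<phi> - of_real t * cis \<theta>))\<^sup>2 \<noteq> 0"
    using cis_minus_ge[of t \<phi> \<theta>] by (intro notI) (simp del: right_minus_eq)
qed

text \<open>Cauchy's formula is applied to f(w) (1 - |z|^2) / (1 - conj(z) w), which is holomorphic
  on the closed disc and agrees with f at z. On the unit circle (1 - conj(z) w)(w - z) = w |w -
  z|^2, which turns the Cauchy kernel into the Poisson kernel.\<close>

lemma poisson_formula:
  fixes f :: "complex \<Rightarrow> complex"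
  assumes f: "f holomorphic_on ball 0 R" and R: "1 < R" and t: "0 \<le> t" "t < 1"
  shows "((\<lambda>\<phi>. of_real (poisson t \<theta> \<phi>) * f (cis \<phi>)) has_integral 2 * pi * f (of_real t * cis \<theta>)) {0..2 * pi}"
proof -
  define z where "z = of_real t * cis \<theta>"
  have z: "cmod z = t" using t by (simp add: z_def norm_mult)
  define g where "g w = f w * (1 - t\<^sup>2) / (1 - cnj z * w)" for w
  have nz: "1 - cnj z * w \<noteq> 0" if "cmod w \<le> 1" for w
  proof
    assume "1 - cnj z * w = 0"
    then have "cmod (cnj z * w) = 1" by simp
    moreover have "cmod (cnj z * w) \<le> t * 1"
      unfolding norm_mult using z that t by (intro mult_mono) auto
    ultimately show False using t by simp
  qed
  have hol: "g holomorphic_on cball 0 1"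
    unfolding g_def using nz R by (intro holomorphic_intros holomorphic_on_subset[OF f]) auto
  then have "((\<lambda>w. g w / (w - z)) has_contour_integral 2 * of_real pi * \<i> * g z) (circlepath 0 1)"
    using z t by (intro Cauchy_integral_circlepath_simple) auto
  then have "((\<lambda>\<phi>. g (cis \<phi>) / (cis \<phi> - z) * \<i> * cis \<phi>) has_integral 2 * of_real pi * \<i> * g z) {0..2 * pi}"
    unfolding circlepath_def by (subst (asm) has_contour_integral_part_circlepath_iff) auto
  then have H: "((\<lambda>\<phi>. - \<i> * (g (cis \<phi>) / (cis \<phi> - z) * \<i> * cis \<phi>)) has_integral - \<i> * (2 * of_real pi * \<i> * g z)) {0..2 * pi}"
    by (rule has_integral_mult_right)
  have E1: "- \<i> * (2 * of_real pi * \<i> * g z) = 2 * pi * f z"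
  proof -
    have "cnj z * z = of_real (t\<^sup>2)"
      using z complex_norm_square[of z] by (simp add: mult.commute)
    moreover have "1 - complex_of_real (t\<^sup>2) \<noteq> 0"
    proof -
      have "t\<^sup>2 \<noteq> 1" using t by (simp add: power2_eq_1_iff)
      then show ?thesis by (metis eq_iff_diff_eq_0 of_real_eq_1_iff)
    qed
    ultimately have "g z = f z"
      by (simp add: g_def)
    then show ?thesis by simp
  qed
  have E2: "- \<i> * (g (cis \<phi>) / (cis \<phi> - z) * \<i> * cis \<phi>) = of_real (poisson t \<theta> \<phi>) * f (cis \<phi>)" for \<phi>
  proof -
    let ?w = "cis \<phi>"
    have ne: "?w - z \<noteq> 0" using z t by (metis eq_iff_diff_eq_0 norm_cis less_irrefl)
    have 1: "(1 - cnj z * ?w) * (?w - z) = ?w * of_real ((cmod (?w - z))\<^sup>2)"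
      unfolding complex_norm_square by (simp add: algebra_simps cis_cnj cis_mult)
    have nz': "1 - cnj z * ?w \<noteq> 0" by (rule nz) simp
    have "- \<i> * (g ?w / (?w - z) * \<i> * ?w) = (- \<i> * \<i>) * (g ?w / (?w - z) * ?w)"
      by (simp only: mult_ac)
    also have "\<dots> = f ?w * (1 - t\<^sup>2) * (?w / ((1 - cnj z * ?w) * (?w - z)))"
      by (simp add: g_def)
    also have "?w / ((1 - cnj z * ?w) * (?w - z)) = 1 / of_real ((cmod (?w - z))\<^sup>2)"
      unfolding 1 by simp
    finally show ?thesis by (simp add: poisson_def z_def)
  qed
  show ?thesis using H unfolding E1 E2 unfolding z_def .
qed

lemma integral_poisson:
  assumes "0 \<le> t" "t < 1"
  shows "(poisson t \<theta> has_integral 2 * pi) {0..2 * pi}"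
proof -
  have "((\<lambda>\<phi>. complex_of_real (poisson t \<theta> \<phi>)) has_integral of_real (2 * pi)) {0..2 * pi}"
    using poisson_formula[of "\<lambda>_. 1" 2 t \<theta>] assms by simp
  from has_integral_linear[OF this bounded_linear_Re] show ?thesis by (simp add: o_def)
qed

lemma nn_integral_poisson:
  assumes "0 \<le> t" "t < 1"
  shows "(\<integral>\<^sup>+\<phi>. ennreal (poisson t \<theta> \<phi>) \<partial>circ) = ennreal (2 * pi)"
  using integral_poisson[OF assms, of \<theta>] assms
  by (subst nn_integral_circ_eq_integral) (auto simp: continuous_on_poisson poisson_nonneg integral_unique)

lemma norm_le_poisson:
  fixes f :: "complex \<Rightarrow> complex"
  assumes f: "f holomorphic_on ball 0 R" and R: "1 < R" and t: "0 \<le> t" "t < 1"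
  shows "ennreal (2 * pi * cmod (f (of_real t * cis \<theta>))) \<le> (\<integral>\<^sup>+\<phi>. ennreal (poisson t \<theta> \<phi> * cmod (f (cis \<phi>))) \<partial>circ)"
proof -
  have fc: "continuous_on A (\<lambda>\<phi>. f (cis \<phi>))" for A
    by (rule continuous_on_compose2[OF holomorphic_on_imp_continuous_on[OF f]])
      (use R in \<open>auto intro!: continuous_intros\<close>)
  have c: "continuous_on {0..2 * pi} (\<lambda>\<phi>. poisson t \<theta> \<phi> * cmod (f (cis \<phi>)))"
    by (intro continuous_intros fc continuous_on_poisson t)
  have "cmod (integral {0..2 * pi} (\<lambda>\<phi>. of_real (poisson t \<theta> \<phi>) * f (cis \<phi>)))
    \<le> integral {0..2 * pi} (\<lambda>\<phi>. poisson t \<theta> \<phi> * cmod (f (cis \<phi>)))"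
    using poisson_nonneg[OF t] c
    by (intro integral_norm_bound_integral integrable_continuous_interval
        has_integral_integrable[OF poisson_formula[OF assms]]) (auto simp: norm_mult)
  also have "integral {0..2 * pi} (\<lambda>\<phi>. of_real (poisson t \<theta> \<phi>) * f (cis \<phi>)) = 2 * pi * f (of_real t * cis \<theta>)"
    using poisson_formula[OF assms] by (rule integral_unique)
  finally show ?thesis
    using poisson_nonneg[OF t] by (subst nn_integral_circ_eq_integral[OF c]) (auto simp: norm_mult intro!: ennreal_leI)
qed

section \<open>The integral form of the operator\<close>

lemma space_finite_borel_unit: "finite_borel_unit \<mu> \<Longrightarrow> space \<mu> = {0..<1}"
  unfolding finite_borel_unit_def by (auto dest: sets_eq_imp_space_eq simp: space_restrict_space)

lemma measurable_finite_borel_unitI: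
  assumes "finite_borel_unit \<mu>" "f \<in> borel_measurable borel"
  shows "f \<in> borel_measurable \<mu>"
proof -
  have "f \<in> borel_measurable (restrict_space borel {0..<1})"
    by (intro measurable_restrict_space1 assms)
  then show ?thesis
    using assms(1) measurable_cong_sets by (metis finite_borel_unit_def)
qed

lemma integrable_bounded_finite_borel_unit:
  fixes f :: "real \<Rightarrow> 'a::{banach, second_countable_topology}"
  assumes "finite_borel_unit \<mu>" "f \<in> borel_measurable \<mu>" "\<And>t. t \<in> {0..<1} \<Longrightarrow> norm (f t) \<le> B"
  shows "integrable \<mu> f"
proof -
  interpret finite_measure \<mu> using assms by (simp add: finite_borel_unit_def)
  show ?thesis
    using assms by (intro integrable_const_bound[where B = B] AE_I2) (auto simp: space_finite_borel_unit)
qed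

lemma moment_bound:
  assumes "finite_borel_unit \<mu>"
  shows "0 \<le> moment \<mu> n" "moment \<mu> n \<le> measure \<mu> (space \<mu>)"
proof -
  interpret finite_measure \<mu> using assms by (simp add: finite_borel_unit_def)
  have i: "integrable \<mu> (\<lambda>t. t ^ n)"
    using assms by (intro integrable_bounded_finite_borel_unit[where B = 1] measurable_finite_borel_unitI[OF assms])
      (auto simp: power_le_one)
  show "0 \<le> moment \<mu> n"
    unfolding moment_def using assms by (intro integral_nonneg_AE AE_I2) (auto simp: space_finite_borel_unit)
  have "moment \<mu> n \<le> (\<integral>t. 1 \<partial>\<mu>)"
    unfolding moment_def using assms i by (intro integral_mono) (auto simp: space_finite_borel_unit power_le_one)
  then show "moment \<mu> n \<le> measure \<mu> (space \<mu>)" by simp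
qed

text \<open>Cauchy product of the Taylor series with the geometric series. Absolute convergence at z
  comes from convergence at a real point x with |z| < x < 1.\<close>

lemma partial_sums_power_series:
  fixes f :: "complex \<Rightarrow> complex"
  assumes f: "f holomorphic_on ball 0 1" and z: "cmod z < 1"
  defines "b \<equiv> \<lambda>n. \<Sum>k\<le>n. fps_nth (fps_expansion f 0) k"
  shows "(\<lambda>n. b n * z ^ n) sums (f z / (1 - z))"
    and "summable (\<lambda>n. cmod (b n * z ^ n))"
proof -
  define a where "a = fps_nth (fps_expansion f 0)"
  have sums: "(\<lambda>n. a n * z ^ n) sums f z" if "cmod z < 1" for z
    using holomorphic_power_series[OF f, of z] that by (simp add: a_def fps_expansion_def)
  have snorm: "summable (\<lambda>n. cmod (a n * z ^ n))" if z: "cmod z < 1" for z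
  proof -
    obtain x where x: "cmod z < x" "x < 1" using dense[OF z] by blast
    have "0 < x" using x norm_ge_zero[of z] by linarith
    then have "summable (\<lambda>n. a n * of_real x ^ n)"
      using x by (intro sums_summable[OF sums]) simp
    then show ?thesis
      by (rule powser_insidea) (use x \<open>0 < x\<close> in simp)
  qed
  have main: "(\<lambda>n. b n * z ^ n) sums (f z / (1 - z))" if z: "cmod z < 1" for z
  proof -
    have "(\<lambda>k. \<Sum>i\<le>k. (a i * z ^ i) * z ^ (k - i)) sums ((\<Sum>k. a k * z ^ k) * (\<Sum>k. z ^ k))"
      using z by (intro Cauchy_product_sums snorm) (auto simp: norm_power)
    also have "(\<lambda>k. \<Sum>i\<le>k. (a i * z ^ i) * z ^ (k - i)) = (\<lambda>k. b k * z ^ k)"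
      by (intro ext) (simp add: b_def a_def sum_distrib_right mult.assoc flip: power_add)
    also have "(\<Sum>k. a k * z ^ k) * (\<Sum>k. z ^ k) = f z / (1 - z)"
      using sums_unique[OF sums[OF z]] z by (simp add: suminf_geometric)
    finally show ?thesis .
  qed
  show "(\<lambda>n. b n * z ^ n) sums (f z / (1 - z))" by (rule main[OF z])
  obtain x where x: "cmod z < x" "x < 1" using dense[OF z] by blast
  have "0 < x" using x norm_ge_zero[of z] by linarith
  then have "summable (\<lambda>n. b n * of_real x ^ n)"
    using x by (intro sums_summable[OF main]) simp
  then show "summable (\<lambda>n. cmod (b n * z ^ n))"
    by (rule powser_insidea) (use x \<open>0 < x\<close> in simp)
qed

lemma norm_scaled_lt_1: "0 \<le> t \<Longrightarrow> t \<le> 1 \<Longrightarrow> cmod z < 1 \<Longrightarrow> cmod (of_real t * z) < 1"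
  using mult_left_le_one_le[of "cmod z" t] by (simp add: norm_mult)

text \<open>The integrand is the power series of f / (1 - z) at tz. Since t^n \<le> 1, its terms are
  dominated by those at z, which are absolutely summable, and \<mu> is finite; hence sum and
  integral may be exchanged, and the powers of t become moments.\<close>

lemma cesaro_op_integral:
  fixes f :: "complex \<Rightarrow> complex"
  assumes \<mu>: "finite_borel_unit \<mu>" and f: "f holomorphic_on ball 0 1" and z: "cmod z < 1"
  shows "integrable \<mu> (\<lambda>t. f (of_real t * z) / (1 - of_real t * z))"
    and "cesaro_op \<mu> f z = (\<integral>t. f (of_real t * z) / (1 - of_real t * z) \<partial>\<mu>)"
    and "summable (\<lambda>n. of_real (moment \<mu> n) * (\<Sum>k\<le>n. fps_nth (fps_expansion f 0) k) * z ^ n)"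
proof -
  define b where "b n = (\<Sum>k\<le>n. fps_nth (fps_expansion f 0) k)" for n
  define m where "m = measure \<mu> (space \<mu>)"
  interpret finite_measure \<mu> using \<mu> by (simp add: finite_borel_unit_def)
  have meas: "(\<lambda>t. b n * (of_real t * z) ^ n) \<in> borel_measurable \<mu>" for n
    by (intro measurable_finite_borel_unitI[OF \<mu>] borel_measurable_continuous_onI continuous_intros)
  have bnd: "cmod (b n * (of_real t * z) ^ n) \<le> cmod (b n * z ^ n)" if "t \<in> {0..<1}" for n t
  proof -
    have "t ^ n \<le> 1" using that by (intro power_le_one) auto
    then show ?thesis
      using that by (simp add: norm_mult norm_power power_mult_distrib mult_left_le_one_le mult_left_mono)
  qed
  have int: "integrable \<mu> (\<lambda>t. b n * (of_real t * z) ^ n)" for n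
    using \<mu> bnd by (intro integrable_bounded_finite_borel_unit meas)
  have eq: "(\<Sum>n. b n * (of_real t * z) ^ n) = f (of_real t * z) / (1 - of_real t * z)"
    and sn: "summable (\<lambda>n. cmod (b n * (of_real t * z) ^ n))" if "t \<in> {0..<1}" for t
    using partial_sums_power_series[OF f norm_scaled_lt_1[OF _ _ z], of t] that
    by (auto simp: b_def sums_iff)
  have sI: "summable (\<lambda>n. \<integral>t. cmod (b n * (of_real t * z) ^ n) \<partial>\<mu>)"
  proof (rule summable_comparison_test', rule summable_mult[of _ m])
    show "summable (\<lambda>n. cmod (b n * z ^ n))"
      using partial_sums_power_series(2)[OF f z] by (simp add: b_def)
    fix n :: nat
    have "(\<integral>t. cmod (b n * (of_real t * z) ^ n) \<partial>\<mu>) \<le> (\<integral>t. cmod (b n * z ^ n) \<partial>\<mu>)"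
      using int bnd \<mu> by (intro integral_mono) (auto simp: space_finite_borel_unit)
    then show "norm (\<integral>t. cmod (b n * (of_real t * z) ^ n) \<partial>\<mu>) \<le> m * cmod (b n * z ^ n)"
      by (simp add: m_def)
  qed
  have AE: "AE t in \<mu>. summable (\<lambda>n. cmod (b n * (of_real t * z) ^ n))"
    using sn \<mu> by (intro AE_I2) (auto simp: space_finite_borel_unit)
  have "integrable \<mu> (\<lambda>t. \<Sum>n. b n * (of_real t * z) ^ n)"
    by (rule integrable_suminf[OF int AE sI])
  then show "integrable \<mu> (\<lambda>t. f (of_real t * z) / (1 - of_real t * z))"
    by (rule Bochner_Integration.integrable_cong[THEN iffD1, rotated 2]) (use eq \<mu> in \<open>auto simp: space_finite_borel_unit\<close>)
  have mom: "(\<integral>t. b n * (of_real t * z) ^ n \<partial>\<mu>) = of_real (moment \<mu> n) * b n * z ^ n" for n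
  proof -
    have "(\<integral>t. b n * (of_real t * z) ^ n \<partial>\<mu>) = (\<integral>t. (b n * z ^ n) * of_real (t ^ n) \<partial>\<mu>)"
      by (simp add: power_mult_distrib mult_ac)
    also have "\<dots> = (b n * z ^ n) * of_real (moment \<mu> n)"
      by (simp add: moment_def del: of_real_power)
    finally show ?thesis by (simp only: mult_ac)
  qed
  have "(\<integral>t. f (of_real t * z) / (1 - of_real t * z) \<partial>\<mu>) = (\<integral>t. (\<Sum>n. b n * (of_real t * z) ^ n) \<partial>\<mu>)"
    using eq \<mu> by (intro Bochner_Integration.integral_cong) (auto simp: space_finite_borel_unit)
  also have "\<dots> = (\<Sum>n. \<integral>t. b n * (of_real t * z) ^ n \<partial>\<mu>)"
    by (rule integral_suminf[OF int AE sI])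
  finally show "cesaro_op \<mu> f z = (\<integral>t. f (of_real t * z) / (1 - of_real t * z) \<partial>\<mu>)"
    unfolding mom by (simp add: cesaro_op_def b_def)
  have "summable (\<lambda>n. \<integral>t. b n * (of_real t * z) ^ n \<partial>\<mu>)"
    using sums_integral[OF int AE sI] by (rule sums_summable)
  then show "summable (\<lambda>n. of_real (moment \<mu> n) * (\<Sum>k\<le>n. fps_nth (fps_expansion f 0) k) * z ^ n)"
    unfolding mom by (simp add: b_def)
qed

lemma holomorphic_cesaro_op:
  assumes "finite_borel_unit \<mu>" "f holomorphic_on ball 0 1"
  shows "cesaro_op \<mu> f holomorphic_on ball 0 1"
proof (rule power_series_holomorphic)
  fix w :: complex assume "w \<in> ball 0 1"
  then show "(\<lambda>n. of_real (moment \<mu> n) * (\<Sum>k\<le>n. fps_nth (fps_expansion f 0) k) * (w - 0) ^ n) sums cesaro_op \<mu> f w"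
    using cesaro_op_integral(3)[OF assms, of w] unfolding cesaro_op_def by (simp add: summable_sums)
qed

lemma cesaro_op_diff:
  assumes "finite_borel_unit \<mu>" "f holomorphic_on ball 0 1" "g holomorphic_on ball 0 1" "cmod z < 1"
  shows "cesaro_op \<mu> (\<lambda>w. f w - g w) z = cesaro_op \<mu> f z - cesaro_op \<mu> g z"
proof -
  have "(\<lambda>w. f w - g w) holomorphic_on ball 0 1"
    by (intro holomorphic_intros assms)
  from cesaro_op_integral(2)[OF assms(1) this assms(4)] show ?thesis
    using assms by (simp add: cesaro_op_integral diff_divide_distrib)
qed

lemma powr_add_le:
  fixes x y r :: real
  assumes "0 \<le> x" "0 \<le> y" "0 \<le> r"
  shows "(x + y) powr r \<le> 2 powr r * (x powr r + y powr r)"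
proof -
  have *: "(x + y) powr r \<le> 2 powr r * (x powr r + y powr r)" if "0 \<le> y" "y \<le> x" for x y :: real
  proof -
    have "(x + y) powr r \<le> (2 * x) powr r"
      using that assms by (intro powr_mono2) auto
    also have "\<dots> = 2 powr r * x powr r"
      using that by (simp add: powr_mult)
    also have "\<dots> \<le> 2 powr r * (x powr r + y powr r)"
      by (intro mult_left_mono) auto
    finally show ?thesis .
  qed
  show ?thesis
    using *[of x y] *[of y x] assms by (cases "y \<le> x") (auto simp: add.commute)
qed

section \<open>Tail function and potential of a measure on [0,1)\<close>

definition tail :: "real measure \<Rightarrow> real \<Rightarrow> real" where
  "tail \<mu> t = measure \<mu> {t..<1} / (1 - t)"

definition pot :: "real measure \<Rightarrow> real \<Rightarrow> real" where
  "pot \<mu> \<theta> = (\<integral>t. 1 / max (1 - t) (chord \<theta>) \<partial>\<mu>)"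

lemma sets_atLeastLessThan_1: "finite_borel_unit \<mu> \<Longrightarrow> 0 \<le> t \<Longrightarrow> {t..<1} \<in> sets \<mu>"
  unfolding finite_borel_unit_def by (auto simp: sets_restrict_space_iff)

lemma antimono_tail_measure:
  assumes "finite_borel_unit \<mu>" "0 \<le> s" "s \<le> t"
  shows "measure \<mu> {t..<1} \<le> measure \<mu> {s..<1}"
proof -
  interpret finite_measure \<mu> using assms by (simp add: finite_borel_unit_def)
  show ?thesis using assms by (intro finite_measure_mono sets_atLeastLessThan_1) auto
qed

lemma tail_nonneg: "t \<in> {0..<1} \<Longrightarrow> 0 \<le> tail \<mu> t"
  by (simp add: tail_def)

text \<open>The mass of [t,1) is antitone in t. Replacing t by max 0 t extends this to the whole
  line while the sets stay inside the space of \<mu>.\<close>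

lemma measurable_tail:
  assumes "finite_borel_unit \<mu>"
  shows "tail \<mu> \<in> borel_measurable unit_len"
proof -
  have m: "mono (\<lambda>t. - measure \<mu> {max 0 t..<1})"
    using antimono_tail_measure[OF assms] by (auto intro!: monoI)
  have "(\<lambda>t. - (- measure \<mu> {max 0 t..<1}) / (1 - t)) \<in> borel_measurable borel"
    using borel_measurable_mono[OF m] by measurable
  then have "(\<lambda>t. - (- measure \<mu> {max 0 t..<1}) / (1 - t)) \<in> borel_measurable unit_len"
    by (rule measurable_unit_lenI)
  then show ?thesis
    by (rule measurable_cong[THEN iffD1, rotated]) (auto simp: tail_def)
qed

lemma pot_nonneg: "0 \<le> pot \<mu> \<theta>"
  unfolding pot_def by (intro integral_nonneg_AE AE_I2) (auto simp: le_max_iff_disj)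

lemma nn_integral_pot:
  assumes "finite_borel_unit \<mu>" "\<theta> \<in> space circ"
  shows "(\<integral>\<^sup>+t. ennreal (1 / max (1 - t) (chord \<theta>)) \<partial>\<mu>) = ennreal (pot \<mu> \<theta>)"
  unfolding pot_def
proof (rule nn_integral_eq_integral)
  have a: "chord \<theta> > 0" using assms chord_pos by auto
  show "integrable \<mu> (\<lambda>t. 1 / max (1 - t) (chord \<theta>))"
    using a by (intro integrable_bounded_finite_borel_unit[where B = "1 / chord \<theta>"] measurable_finite_borel_unitI[OF assms(1)] assms)
      (auto intro!: divide_left_mono)
qed (auto simp: le_max_iff_disj)

lemma measurable_pot:
  assumes "finite_borel_unit \<mu>"
  shows "pot \<mu> \<in> borel_measurable circ"
proof -
  interpret finite_measure \<mu> using assms by (simp add: finite_borel_unit_def)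
  note [measurable] = measurable_circI[OF borel_measurable_chord]
    measurable_finite_borel_unitI[OF assms, of "\<lambda>t. t", simplified]
  show ?thesis unfolding pot_def by measurable
qed

section \<open>The potential of the measure\<close>

text \<open>A layer-cake formula: for d = max (1 - t) a < 1, 1/d is 1 plus the integral of (1 -
  x)^(-2) over [0, 1 - d], and x \<le> 1 - d says that x \<le> t and a \<le> 1 - x. For d \<ge> 1
  the summand 1 suffices.\<close>

lemma inverse_max_le_nn_integral:
  assumes t: "t \<in> {0..<1}" and a: "0 < a"
  shows "ennreal (1 / max (1 - t) a)
    \<le> 1 + (\<integral>\<^sup>+x. (if x \<le> t \<and> a \<le> 1 - x then ennreal (1 / (1 - x)\<^sup>2) else 0) \<partial>unit_len)"
proof (cases "max (1 - t) a < 1")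
  case True
  define d where "d = max (1 - t) a"
  have d: "0 < d" "d < 1" using True a t by (auto simp: d_def)
  have "(\<integral>\<^sup>+x. ennreal (1 / (1 - x)\<^sup>2) * indicator {0..1 - d} x \<partial>lborel) = ennreal (1 / (1 - (1 - d)) - 1 / (1 - 0))"
  proof (rule nn_integral_FTC_Icc)
    fix x :: real assume "x \<in> {0..1 - d}"
    then show "((\<lambda>x. 1 / (1 - x)) has_real_derivative 1 / (1 - x)\<^sup>2) (at x)"
      using d by (auto intro!: derivative_eq_intros simp: power2_eq_square)
  qed (use d in auto)
  then have eq: "(\<integral>\<^sup>+x. ennreal (1 / (1 - x)\<^sup>2) * indicator {0..1 - d} x \<partial>lborel) = ennreal (1 / d - 1)"
    by simp
  have "ennreal (1 / d) = 1 + ennreal (1 / d - 1)"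
    using d by (simp flip: ennreal_plus ennreal_1)
  also have "\<dots> \<le> 1 + (\<integral>\<^sup>+x. (if x \<le> t \<and> a \<le> 1 - x then ennreal (1 / (1 - x)\<^sup>2) else 0) \<partial>unit_len)"
    unfolding eq[symmetric] nn_integral_unit_len using t d
    by (intro add_left_mono nn_integral_mono) (auto simp: indicator_def d_def)
  finally show ?thesis by (simp add: d_def)
next
  case False
  then have "1 / max (1 - t) a \<le> 1"
    by (subst divide_le_eq_1_pos) auto
  then have "ennreal (1 / max (1 - t) a) \<le> 1"
    using ennreal_leI by fastforce
  then show ?thesis by (rule order_trans) simp
qed

text \<open>Integrating the layer-cake formula in \<mu> and applying Fubini turns the condition x
  \<le> t into the mass of [x,1), so the potential becomes a Hilbert-type integral of
  \<open>tail\<close>. The finiteness assumption makes that Bochner integral a genuine one instead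
  of the default value 0.\<close>

lemma pot_le_hilbert:
  assumes \<mu>: "finite_borel_unit \<mu>" and \<theta>: "\<theta> \<in> space circ" and r: "1 \<le> r"
    and fin: "(\<integral>\<^sup>+t. ennreal (tail \<mu> t powr r) \<partial>unit_len) < \<infinity>"
  shows "pot \<mu> \<theta> \<le> measure \<mu> (space \<mu>) + (\<integral>x. tail \<mu> x / max (1 - x) (chord \<theta>) \<partial>unit_len)"
proof -
  define a where "a = chord \<theta>"
  have a: "a > 0" using \<theta> chord_pos by (auto simp: a_def)
  interpret finite_measure \<mu> using \<mu> by (simp add: finite_borel_unit_def)
  interpret L: finite_measure unit_len by (rule finite_measure_unit_len)
  interpret P: pair_sigma_finite unit_len \<mu> ..
  note [measurable] = measurable_tail[OF \<mu>] measurable_unit_lenI[of "\<lambda>t. t", simplified]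
    measurable_finite_borel_unitI[OF \<mu>, of "\<lambda>t. t", simplified]
  have "integrable unit_len (\<lambda>t. tail \<mu> t powr r)"
    using fin by (intro integrableI_nonneg) (auto intro!: AE_I2)
  \<comment> \<open>On a space of finite measure L^r lies in L^1, by w \<le> 1 + w^r.\<close>
  then have it: "integrable unit_len (tail \<mu>)"
  proof (rule Bochner_Integration.integrable_bound[OF Bochner_Integration.integrable_add[OF L.integrable_const[of 1]]])
    show "AE x in unit_len. norm (tail \<mu> x) \<le> norm (1 + tail \<mu> x powr r)"
    proof (intro AE_I2)
      fix x assume "x \<in> space unit_len"
      then have "0 \<le> tail \<mu> x" by (simp add: tail_nonneg)
      moreover have "tail \<mu> x \<le> tail \<mu> x powr r" if "1 \<le> tail \<mu> x"
        using powr_mono[of 1 r "tail \<mu> x"] that r by simp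
      ultimately show "norm (tail \<mu> x) \<le> norm (1 + tail \<mu> x powr r)"
        using powr_ge_zero[of "tail \<mu> x" r] unfolding real_norm_def by (smt (verit))
    qed
  qed measurable
  have it': "integrable unit_len (\<lambda>x. tail \<mu> x / max (1 - x) a)"
  proof (rule Bochner_Integration.integrable_bound)
    show "integrable unit_len (\<lambda>x. tail \<mu> x * (1 / a))" using it by simp
    have "tail \<mu> x / max (1 - x) a \<le> tail \<mu> x * (1 / a)" if "x \<in> {0..<1}" for x
      using a that tail_nonneg[OF that, of \<mu>] by (simp add: divide_left_mono)
    then show "AE x in unit_len. norm (tail \<mu> x / max (1 - x) a) \<le> norm (tail \<mu> x * (1 / a))"
      using a by (intro AE_I2) (auto simp: tail_nonneg)
  qed measurable
  let ?k = "\<lambda>x t. if x \<le> t \<and> a \<le> 1 - x then ennreal (1 / (1 - x)\<^sup>2) else 0"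
  have "ennreal (pot \<mu> \<theta>) = (\<integral>\<^sup>+t. ennreal (1 / max (1 - t) a) \<partial>\<mu>)"
    using nn_integral_pot[OF \<mu> \<theta>] by (simp add: a_def)
  also have "\<dots> \<le> (\<integral>\<^sup>+t. 1 + (\<integral>\<^sup>+x. ?k x t \<partial>unit_len) \<partial>\<mu>)"
    using \<mu> a by (intro nn_integral_mono inverse_max_le_nn_integral) (auto simp: space_finite_borel_unit)
  also have "\<dots> = (\<integral>\<^sup>+t. 1 \<partial>\<mu>) + (\<integral>\<^sup>+t. (\<integral>\<^sup>+x. ?k x t \<partial>unit_len) \<partial>\<mu>)"
    by (intro nn_integral_add) measurable
  also have "(\<integral>\<^sup>+t. 1 \<partial>\<mu>) = ennreal (measure \<mu> (space \<mu>))"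
    by (simp add: emeasure_eq_measure)
  also have "(\<integral>\<^sup>+t. (\<integral>\<^sup>+x. ?k x t \<partial>unit_len) \<partial>\<mu>) = (\<integral>\<^sup>+x. (\<integral>\<^sup>+t. ?k x t \<partial>\<mu>) \<partial>unit_len)"
    by (intro P.Fubini') measurable
  also have "\<dots> \<le> (\<integral>\<^sup>+x. ennreal (tail \<mu> x / max (1 - x) a) \<partial>unit_len)"
  proof (intro nn_integral_mono)
    fix x assume x: "x \<in> space unit_len"
    show "(\<integral>\<^sup>+t. ?k x t \<partial>\<mu>) \<le> ennreal (tail \<mu> x / max (1 - x) a)"
    proof (cases "a \<le> 1 - x")
      case True
      have "(\<integral>\<^sup>+t. ?k x t \<partial>\<mu>) = (\<integral>\<^sup>+t. ennreal (1 / (1 - x)\<^sup>2) * indicator {x..<1} t \<partial>\<mu>)"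
        using True \<mu> by (intro nn_integral_cong) (auto simp: indicator_def space_finite_borel_unit)
      also have "\<dots> = ennreal (1 / (1 - x)\<^sup>2) * ennreal (measure \<mu> {x..<1})"
        using x \<mu> by (subst nn_integral_cmult_indicator) (auto simp: sets_atLeastLessThan_1 emeasure_eq_measure)
      also have "\<dots> = ennreal (tail \<mu> x / max (1 - x) a)"
        using True x by (simp add: tail_def power2_eq_square max_def flip: ennreal_mult)
      finally show ?thesis by simp
    qed simp
  qed
  also have "\<dots> = ennreal (\<integral>x. tail \<mu> x / max (1 - x) a \<partial>unit_len)"
    using it' a by (intro nn_integral_eq_integral) (auto intro!: AE_I2 simp: tail_nonneg le_max_iff_disj)
  finally have "ennreal (pot \<mu> \<theta>) \<le> ennreal (measure \<mu> (space \<mu>)) + ennreal (\<integral>x. tail \<mu> x / max (1 - x) a \<partial>unit_len)"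
    by (simp add: add_left_mono)
  moreover have "0 \<le> (\<integral>x. tail \<mu> x / max (1 - x) a \<partial>unit_len)"
    using a by (intro integral_nonneg_AE AE_I2) (auto simp: tail_nonneg le_max_iff_disj)
  ultimately show ?thesis
    by (simp add: a_def flip: ennreal_plus)
qed

text \<open>C is chosen before \<mu>. For measures whose mass and tail integral tend to 0 the bound
  therefore tends to 0, which is how compactness uses it.\<close>

lemma nn_integral_pot_powr_le:
  assumes r: "1 < r"
  shows "\<exists>C\<ge>0. \<forall>\<mu> A. finite_borel_unit \<mu> \<longrightarrow> 0 \<le> A \<longrightarrow>
    (\<integral>\<^sup>+t. ennreal (tail \<mu> t powr r) \<partial>unit_len) \<le> ennreal A \<longrightarrow>
    (\<integral>\<^sup>+\<theta>. ennreal (pot \<mu> \<theta> powr r) \<partial>circ) \<le> ennreal (C * (A + measure \<mu> (space \<mu>) powr r))"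
proof -
  obtain C where C: "C \<ge> 0" "\<And>f. f \<in> borel_measurable unit_len \<Longrightarrow> \<forall>x\<in>space unit_len. 0 \<le> f x \<Longrightarrow>
    (\<integral>\<^sup>+y. ennreal ((\<integral>x. f x / max (1 - x) (chord y) \<partial>unit_len) powr r) \<partial>circ)
      \<le> ennreal C * (\<integral>\<^sup>+x. ennreal (f x powr r) \<partial>unit_len)"
    using hilbert_inequality[OF size_weight_unit_len size_weight_circ r] by blast
  show ?thesis
  proof (intro exI[of _ "2 powr r * (C + 2 * pi)"] conjI allI impI)
    show "0 \<le> 2 powr r * (C + 2 * pi)" using C by simp
    fix \<mu> :: "real measure" and A :: real
    assume \<mu>: "finite_borel_unit \<mu>" and A: "0 \<le> A"
      and le: "(\<integral>\<^sup>+t. ennreal (tail \<mu> t powr r) \<partial>unit_len) \<le> ennreal A"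
    define m where "m = measure \<mu> (space \<mu>)"
    define H where "H \<theta> = (\<integral>x. tail \<mu> x / max (1 - x) (chord \<theta>) \<partial>unit_len)" for \<theta>
    have m: "m \<ge> 0" by (simp add: m_def)
    have H: "H \<theta> \<ge> 0" for \<theta>
      unfolding H_def by (intro integral_nonneg_AE AE_I2) (auto simp: tail_nonneg le_max_iff_disj)
    interpret L: finite_measure unit_len by (rule finite_measure_unit_len)
    note [measurable] = measurable_tail[OF \<mu>] measurable_unit_lenI[of "\<lambda>t. t", simplified]
       measurable_circI[OF borel_measurable_chord]
    have [measurable]: "H \<in> borel_measurable circ"
      unfolding H_def by measurable
    have "(\<integral>\<^sup>+\<theta>. ennreal (pot \<mu> \<theta> powr r) \<partial>circ)
      \<le> (\<integral>\<^sup>+\<theta>. ennreal (2 powr r) * (ennreal (m powr r) + ennreal (H \<theta> powr r)) \<partial>circ)"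
    proof (intro nn_integral_mono)
      fix \<theta> assume \<theta>: "\<theta> \<in> space circ"
      have "pot \<mu> \<theta> \<le> m + H \<theta>"
        using pot_le_hilbert[OF \<mu> \<theta>, of r] r le_less_trans[OF le ennreal_less_top] by (simp add: m_def H_def)
      then have "pot \<mu> \<theta> powr r \<le> (m + H \<theta>) powr r"
        using r by (intro powr_mono2) (auto simp: pot_nonneg)
      also have "\<dots> \<le> 2 powr r * (m powr r + H \<theta> powr r)"
        using r m H by (intro powr_add_le) auto
      finally show "ennreal (pot \<mu> \<theta> powr r) \<le> ennreal (2 powr r) * (ennreal (m powr r) + ennreal (H \<theta> powr r))"
        by (simp add: ennreal_leI flip: ennreal_mult ennreal_plus)
    qed
    also have "\<dots> = ennreal (2 powr r) * (ennreal (m powr r) * ennreal (2 * pi) + (\<integral>\<^sup>+\<theta>. ennreal (H \<theta> powr r) \<partial>circ))"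
      by (simp add: nn_integral_cmult nn_integral_add) (simp add: circ_def emeasure_restrict_space space_restrict_space)
    also have "\<dots> \<le> ennreal (2 powr r) * (ennreal (m powr r) * ennreal (2 * pi) + ennreal C * ennreal A)"
    proof (intro mult_left_mono add_left_mono)
      have "(\<integral>\<^sup>+\<theta>. ennreal (H \<theta> powr r) \<partial>circ) \<le> ennreal C * (\<integral>\<^sup>+x. ennreal (tail \<mu> x powr r) \<partial>unit_len)"
        unfolding H_def by (intro C) (auto simp: tail_nonneg)
      also have "\<dots> \<le> ennreal C * ennreal A"
        using le by (intro mult_left_mono) auto
      finally show "(\<integral>\<^sup>+\<theta>. ennreal (H \<theta> powr r) \<partial>circ) \<le> ennreal C * ennreal A" .
    qed auto
    also have "\<dots> = ennreal (2 powr r * (m powr r * (2 * pi) + C * A))"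
      using C A by (simp flip: ennreal_mult ennreal_plus)
    also have "\<dots> \<le> ennreal (2 powr r * (C + 2 * pi) * (A + measure \<mu> (space \<mu>) powr r))"
    proof -
      have "m powr r * (2 * pi) + C * A \<le> (C + 2 * pi) * (A + m powr r)"
        using C A by (simp add: algebra_simps)
      then show ?thesis
        by (simp add: m_def mult.assoc ennreal_leI mult_left_mono)
    qed
    finally show "(\<integral>\<^sup>+\<theta>. ennreal (pot \<mu> \<theta> powr r) \<partial>circ) \<le> ennreal (2 powr r * (C + 2 * pi) * (A + measure \<mu> (space \<mu>) powr r))" .
  qed
qed

section \<open>Measurability and pointwise bounds of the kernels\<close>

lemma borel_measurable_cis [measurable (raw)]:
  "f \<in> borel_measurable M \<Longrightarrow> (\<lambda>x. cis (f x)) \<in> borel_measurable M"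
  by (rule measurable_compose[of f M borel cis]) (auto intro!: borel_measurable_continuous_onI continuous_intros)

lemma borel_measurable_poisson [measurable (raw)]:
  "f \<in> borel_measurable M \<Longrightarrow> g \<in> borel_measurable M \<Longrightarrow> h \<in> borel_measurable M \<Longrightarrow>
    (\<lambda>x. poisson (f x) (g x) (h x)) \<in> borel_measurable M"
proof -
  assume [measurable]: "f \<in> borel_measurable M" "g \<in> borel_measurable M" "h \<in> borel_measurable M"
  have [measurable]: "(\<lambda>x. complex_of_real (f x)) \<in> borel_measurable M"
    by (rule measurable_compose[OF _ borel_measurable_of_real]) measurable
  have [measurable]: "(\<lambda>x. cis (h x) - complex_of_real (f x) * cis (g x)) \<in> borel_measurable M"
    by (intro borel_measurable_diff borel_measurable_times borel_measurable_cis) measurable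
  show ?thesis unfolding poisson_def by measurable
qed

lemma chord_diff_le: "\<bar>chord \<theta> - chord \<phi>\<bar> \<le> cmod (cis \<theta> - cis \<phi>)"
  unfolding chord_def using norm_triangle_ineq3[of "cis \<theta> - 1" "cis \<phi> - 1"] by simp

text \<open>Let d be the distance from t e^(i\<theta>) to e^(i\<phi>) and m the larger chord. If the
  chords are not comparable, they differ by at least m/2, so m/2 \<le> d + (1 - t) \<le> 2 d. With 1
  - t^2 \<le> 2 d the kernel is at most 2/d \<le> 8/m.\<close>

lemma poisson_far_le:
  assumes t: "0 \<le> t" "t < 1" and pos: "0 < chord \<theta>" "0 < chord \<phi>"
    and far: "\<not> (chord \<theta> \<le> 2 * chord \<phi> \<and> chord \<phi> \<le> 2 * chord \<theta>)"
  shows "poisson t \<theta> \<phi> \<le> 8 / max (chord \<phi>) (chord \<theta>)"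
proof -
  let ?d = "cmod (cis \<phi> - of_real t * cis \<theta>)" and ?m = "max (chord \<phi>) (chord \<theta>)"
  have "?m / 2 \<le> \<bar>chord \<theta> - chord \<phi>\<bar>"
    using far pos by (auto simp: max_def abs_if)
  also have "\<dots> \<le> cmod (cis \<phi> - cis \<theta>)"
    unfolding norm_minus_commute[of "cis \<phi>"] by (rule chord_diff_le)
  also have "cis \<phi> - cis \<theta> = (cis \<phi> - of_real t * cis \<theta>) - of_real (1 - t) * cis \<theta>"
    by (simp add: algebra_simps)
  also have "cmod \<dots> \<le> ?d + cmod (of_real (1 - t) * cis \<theta>)"
    by (rule norm_triangle_ineq4)
  also have "cmod (of_real (1 - t) * cis \<theta>) = 1 - t"
    using t by (simp add: norm_mult del: of_real_diff)
  also have d: "1 - t \<le> ?d" using t by (intro cis_minus_ge) auto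
  finally have m: "?m / 4 \<le> ?d" by simp
  have "1 - t\<^sup>2 = (1 - t) * (1 + t)" by (simp add: power2_eq_square algebra_simps)
  also have "\<dots> \<le> ?d * 2"
    using d t by (intro mult_mono) auto
  finally have "poisson t \<theta> \<phi> \<le> ?d * 2 / ?d\<^sup>2"
    unfolding poisson_def by (intro divide_right_mono) auto
  also have "\<dots> = 2 / ?d"
    by (simp add: power2_eq_square)
  also have "\<dots> \<le> 2 / (?m / 4)"
    using m pos d t by (intro divide_left_mono mult_pos_pos) (auto simp: less_max_iff_disj)
  finally show ?thesis by simp
qed

text \<open>Moving t \<rho> e^(i\<theta>) out to the circle costs 1 - t \<rho>, which is no more
  than its distance to 1; hence the factor 2, uniformly in \<rho>.\<close>

lemma inverse_norm_le:
  assumes t: "0 \<le> t" "t < 1" and \<rho>: "0 \<le> \<rho>" "\<rho> < 1" and pos: "0 < chord \<theta>"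
  shows "1 / cmod (1 - of_real (t * \<rho>) * cis \<theta>) \<le> 2 / max (1 - t) (chord \<theta>)"
proof -
  let ?d = "cmod (1 - of_real (t * \<rho>) * cis \<theta>)"
  have "1 - t * \<rho> \<le> ?d"
    using t \<rho> norm_triangle_ineq2[of 1 "of_real (t * \<rho>) * cis \<theta>"] by (simp add: norm_mult)
  moreover have "t * \<rho> \<le> t * 1" using t \<rho> by (intro mult_left_mono) auto
  moreover have "chord \<theta> \<le> ?d + (1 - t * \<rho>)"
  proof -
    have "cis \<theta> - 1 = of_real (1 - t * \<rho>) * cis \<theta> - (1 - of_real (t * \<rho>) * cis \<theta>)"
      by (simp add: algebra_simps)
    then have "chord \<theta> \<le> cmod (of_real (1 - t * \<rho>) * cis \<theta>) + ?d"
      unfolding chord_def by (metis norm_triangle_ineq4)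
    moreover have "cmod (of_real (1 - t * \<rho>) * cis \<theta>) = 1 - t * \<rho>"
      using t \<open>t * \<rho> \<le> t * 1\<close> by (simp add: norm_mult del: of_real_diff of_real_mult)
    ultimately show ?thesis by simp
  qed
  ultimately have "max (1 - t) (chord \<theta>) / 2 \<le> ?d"
    using t by (auto simp: max_def)
  then have "1 / ?d \<le> 1 / (max (1 - t) (chord \<theta>) / 2)"
    using t pos by (intro divide_left_mono mult_pos_pos) (auto intro: less_le_trans[of _ "max (1 - t) (chord \<theta>) / 2"])
  then show ?thesis by simp
qed

section \<open>Near and far parts of the Poisson integral\<close>

lemma norm_le_poisson_dilation:
  fixes f :: "complex \<Rightarrow> complex"
  assumes f: "f holomorphic_on ball 0 1" and \<rho>: "0 \<le> \<rho>" "\<rho> < 1" and t: "0 \<le> t" "t < 1"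
  shows "ennreal (2 * pi * cmod (f (of_real t * (of_real \<rho> * cis \<theta>))))
    \<le> (\<integral>\<^sup>+\<phi>. ennreal (poisson t \<theta> \<phi> * cmod (f (of_real \<rho> * cis \<phi>))) \<partial>circ)"
proof -
  define h where "h w = f (of_real \<rho> * w)" for w
  \<comment> \<open>The dilate by \<rho> is holomorphic on the ball of radius 1 / \<rho>. For \<rho>
    = 0 it is constant, and 2 stands for any radius above 1.\<close>
  define R where "R = (if \<rho> = 0 then 2 else 1 / \<rho>)"
  have R: "1 < R" using \<rho> by (auto simp: R_def)
  have h: "h holomorphic_on ball 0 R"
  proof -
    have "(\<lambda>w. complex_of_real \<rho> * w) ` ball 0 R \<subseteq> ball 0 1"
      using \<rho> by (auto simp: R_def norm_mult field_simps split: if_splits)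
    then show ?thesis
      unfolding h_def by (intro holomorphic_on_compose_gen[OF _ f, unfolded o_def] holomorphic_intros) auto
  qed
  from norm_le_poisson[OF h R t, of \<theta>] show ?thesis
    by (simp add: h_def mult.left_commute)
qed

lemma continuous_on_circle_norm:
  fixes f :: "complex \<Rightarrow> complex"
  assumes "f holomorphic_on ball 0 1" and "0 \<le> \<rho>" "\<rho> < 1"
  shows "continuous_on A (\<lambda>\<phi>. cmod (f (of_real \<rho> * cis \<phi>)))"
  using assms(2,3)
  by (intro continuous_intros continuous_on_compose2[OF holomorphic_on_imp_continuous_on[OF assms(1)]])
    (auto simp: norm_mult)

text \<open>The factor pi is the mass 2 pi of the Poisson kernel divided by the 2 lost in
  \<open>inverse_norm_le\<close>.\<close>

lemma cesaro_op_le_poisson: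
  assumes \<mu>: "finite_borel_unit \<mu>" and f: "f holomorphic_on ball 0 1"
    and \<rho>: "0 \<le> \<rho>" "\<rho> < 1" and \<theta>: "\<theta> \<in> space circ"
  shows "ennreal (pi * cmod (cesaro_op \<mu> f (of_real \<rho> * cis \<theta>)))
    \<le> (\<integral>\<^sup>+t. \<integral>\<^sup>+\<phi>. ennreal (poisson t \<theta> \<phi> * cmod (f (of_real \<rho> * cis \<phi>)) / max (1 - t) (chord \<theta>)) \<partial>circ \<partial>\<mu>)"
proof -
  let ?z = "of_real \<rho> * cis \<theta>"
  have z: "cmod ?z < 1" using \<rho> by (simp add: norm_mult)
  have pos: "0 < chord \<theta>" using \<theta> chord_pos by auto
  let ?u = "\<lambda>\<phi>. cmod (f (of_real \<rho> * cis \<phi>))"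
  have cu: "?u \<in> borel_measurable borel"
    by (intro borel_measurable_continuous_onI continuous_on_circle_norm f \<rho>)
  have pm: "(\<lambda>\<phi>. poisson t \<theta> \<phi> * ?u \<phi>) \<in> borel_measurable circ" for t
    by (intro measurable_circI borel_measurable_times cu borel_measurable_poisson) auto
  have "ennreal (cmod (cesaro_op \<mu> f ?z)) \<le> ennreal (\<integral>t. cmod (f (of_real t * ?z) / (1 - of_real t * ?z)) \<partial>\<mu>)"
    unfolding cesaro_op_integral(2)[OF \<mu> f z] by (intro ennreal_leI integral_norm_bound)
  also have "\<dots> = (\<integral>\<^sup>+t. ennreal (cmod (f (of_real t * ?z) / (1 - of_real t * ?z))) \<partial>\<mu>)"
    by (intro nn_integral_eq_integral[symmetric] integrable_norm cesaro_op_integral(1)[OF \<mu> f z]) auto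
  finally have "ennreal pi * ennreal (cmod (cesaro_op \<mu> f ?z))
      \<le> ennreal pi * (\<integral>\<^sup>+t. ennreal (cmod (f (of_real t * ?z) / (1 - of_real t * ?z))) \<partial>\<mu>)"
    by (rule mult_left_mono) simp
  also have "\<dots> = (\<integral>\<^sup>+t. ennreal pi * ennreal (cmod (f (of_real t * ?z) / (1 - of_real t * ?z))) \<partial>\<mu>)"
    using measurable_compose[OF measurable_compose[OF
        cesaro_op_integral(1)[OF \<mu> f z, THEN borel_measurable_integrable] borel_measurable_norm] measurable_ennreal]
    by (rule nn_integral_cmult[symmetric])
  also have "\<dots> \<le> (\<integral>\<^sup>+t. \<integral>\<^sup>+\<phi>. ennreal (poisson t \<theta> \<phi> * ?u \<phi> / max (1 - t) (chord \<theta>)) \<partial>circ \<partial>\<mu>)"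
  proof (intro nn_integral_mono)
    fix t assume "t \<in> space \<mu>"
    then have t: "0 \<le> t" "t < 1" using \<mu> by (auto simp: space_finite_borel_unit)
    let ?m = "max (1 - t) (chord \<theta>)"
    have "pi * cmod (f (of_real t * ?z) / (1 - of_real t * ?z)) = pi * cmod (f (of_real t * ?z)) * (1 / cmod (1 - of_real (t * \<rho>) * cis \<theta>))"
      by (simp add: norm_divide mult_ac)
    also have "\<dots> \<le> pi * cmod (f (of_real t * ?z)) * (2 / ?m)"
      using inverse_norm_le[OF t \<rho> pos] by (intro mult_left_mono) auto
    also have "\<dots> = (1 / ?m) * (2 * pi * cmod (f (of_real t * ?z)))" by simp
    finally have "ennreal (pi * cmod (f (of_real t * ?z) / (1 - of_real t * ?z)))
        \<le> ennreal (1 / ?m) * ennreal (2 * pi * cmod (f (of_real t * ?z)))"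
      using t by (simp add: ennreal_leI flip: ennreal_mult')
    also have "\<dots> \<le> ennreal (1 / ?m) * (\<integral>\<^sup>+\<phi>. ennreal (poisson t \<theta> \<phi> * ?u \<phi>) \<partial>circ)"
      by (intro mult_left_mono norm_le_poisson_dilation[OF f \<rho> t]) simp
    also have "\<dots> = (\<integral>\<^sup>+\<phi>. ennreal (1 / ?m) * ennreal (poisson t \<theta> \<phi> * ?u \<phi>) \<partial>circ)"
      using measurable_compose[OF pm measurable_ennreal] by (rule nn_integral_cmult[symmetric])
    also have "\<dots> = (\<integral>\<^sup>+\<phi>. ennreal (poisson t \<theta> \<phi> * ?u \<phi> / ?m) \<partial>circ)"
      using t by (intro nn_integral_cong) (simp add: max_def flip: ennreal_mult')
    finally show "ennreal pi * ennreal (cmod (f (of_real t * ?z) / (1 - of_real t * ?z)))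
      \<le> (\<integral>\<^sup>+\<phi>. ennreal (poisson t \<theta> \<phi> * ?u \<phi> / ?m) \<partial>circ)"
      by (simp add: ennreal_mult'')
  qed
  finally show ?thesis by (simp add: ennreal_mult'')
qed

definition near :: "real \<Rightarrow> real \<Rightarrow> real" where
  "near \<theta> \<phi> = (if chord \<theta> \<le> 2 * chord \<phi> \<and> chord \<phi> \<le> 2 * chord \<theta> then 1 else 0)"

text \<open>A single integral over the product space, with u times the cut-off as the function and
  everything else as the weight: the form in which Jensen's inequality applies.\<close>

definition near_part :: "real measure \<Rightarrow> (real \<Rightarrow> real) \<Rightarrow> real \<Rightarrow> ennreal" where
  "near_part \<mu> u \<theta> = (\<integral>\<^sup>+w. ennreal (poisson (fst w) \<theta> (snd w) / max (1 - fst w) (chord \<theta>) * (u (snd w) * near \<theta> (snd w))) \<partial>(\<mu> \<Otimes>\<^sub>M circ))"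

lemma max_near_le:
  assumes "chord \<phi> \<le> 2 * chord \<theta>" "0 < chord \<phi>" "t < 1"
  shows "1 / max (1 - t) (chord \<theta>) \<le> 2 * (1 / max (1 - t) (chord \<phi>))"
proof -
  have "max (1 - t) (chord \<phi>) / 2 \<le> max (1 - t) (chord \<theta>)"
    using assms by (auto simp: max_def)
  then have "1 / max (1 - t) (chord \<theta>) \<le> 1 / (max (1 - t) (chord \<phi>) / 2)"
    using assms by (intro divide_left_mono mult_pos_pos) (auto simp: less_max_iff_disj)
  then show ?thesis by simp
qed

lemma pot_near_le:
  assumes \<mu>: "finite_borel_unit \<mu>" and sp: "\<theta> \<in> space circ" "\<phi> \<in> space circ"
    and le: "chord \<phi> \<le> 2 * chord \<theta>"
  shows "pot \<mu> \<theta> \<le> 2 * pot \<mu> \<phi>"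
proof -
  have pos: "0 < chord \<phi>" using sp chord_pos by auto
  have id[measurable]: "(\<lambda>t. t) \<in> borel_measurable \<mu>"
    by (rule measurable_finite_borel_unitI[OF \<mu>]) simp
  have "ennreal (pot \<mu> \<theta>) \<le> (\<integral>\<^sup>+t. ennreal 2 * ennreal (1 / max (1 - t) (chord \<phi>)) \<partial>\<mu>)"
    unfolding nn_integral_pot[OF \<mu> sp(1), symmetric]
  proof (intro nn_integral_mono)
    fix t assume "t \<in> space \<mu>"
    then have "ennreal (1 / max (1 - t) (chord \<theta>)) \<le> ennreal (2 * (1 / max (1 - t) (chord \<phi>)))"
      using max_near_le[OF le pos] \<mu> by (intro ennreal_leI) (auto simp: space_finite_borel_unit)
    then show "ennreal (1 / max (1 - t) (chord \<theta>)) \<le> ennreal 2 * ennreal (1 / max (1 - t) (chord \<phi>))"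
      by (subst ennreal_mult'[symmetric]) auto
  qed
  also have "\<dots> = ennreal 2 * ennreal (pot \<mu> \<phi>)"
    unfolding nn_integral_pot[OF \<mu> sp(2), symmetric] by (intro nn_integral_cmult) measurable
  also have "\<dots> = ennreal (2 * pot \<mu> \<phi>)"
    by (subst ennreal_mult') auto
  finally show ?thesis
    by (simp add: pot_nonneg)
qed

context
  fixes \<mu> :: "real measure" and u :: "real \<Rightarrow> real" and B :: real
  assumes \<mu>: "finite_borel_unit \<mu>" and u: "u \<in> borel_measurable borel"
    and unn: "\<And>x. 0 \<le> u x" and uB: "\<And>x. u x \<le> B"
begin

interpretation finite_measure \<mu> using \<mu> by (simp add: finite_borel_unit_def)
interpretation C: finite_measure circ by (rule finite_measure_circ)
interpretation P: pair_sigma_finite \<mu> circ ..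
interpretation T: pair_sigma_finite circ "\<mu> \<Otimes>\<^sub>M circ" ..

lemma potential_measurability:
  shows "(\<lambda>t. t) \<in> borel_measurable \<mu>" "(\<lambda>t. t) \<in> borel_measurable circ"
    "chord \<in> borel_measurable circ" "u \<in> borel_measurable circ" "pot \<mu> \<in> borel_measurable circ"
  using \<mu> u borel_measurable_chord
  by (auto intro!: measurable_circI measurable_pot measurable_finite_borel_unitI[OF \<mu>])

text \<open>This is the mass of the Jensen weight in the near part: the \<phi>-integral of the
  Poisson kernel gives 2 pi, and what remains in t is the potential.\<close>

lemma nn_integral_poisson_kernel:
  assumes \<theta>: "\<theta> \<in> space circ"
  shows "(\<integral>\<^sup>+w. ennreal (poisson (fst w) \<theta> (snd w) / max (1 - fst w) (chord \<theta>)) \<partial>(\<mu> \<Otimes>\<^sub>M circ)) = ennreal (2 * pi * pot \<mu> \<theta>)"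
proof -
  note [measurable] = potential_measurability
  have "(\<integral>\<^sup>+w. ennreal (poisson (fst w) \<theta> (snd w) / max (1 - fst w) (chord \<theta>)) \<partial>(\<mu> \<Otimes>\<^sub>M circ))
    = (\<integral>\<^sup>+t. \<integral>\<^sup>+\<phi>. ennreal (poisson t \<theta> \<phi> / max (1 - t) (chord \<theta>)) \<partial>circ \<partial>\<mu>)"
    by (subst C.nn_integral_fst[symmetric]) auto
  also have "\<dots> = (\<integral>\<^sup>+t. ennreal (2 * pi) * ennreal (1 / max (1 - t) (chord \<theta>)) \<partial>\<mu>)"
  proof (intro nn_integral_cong)
    fix t assume "t \<in> space \<mu>"
    then have t: "0 \<le> t" "t < 1" using \<mu> by (auto simp: space_finite_borel_unit)
    have "(\<integral>\<^sup>+\<phi>. ennreal (poisson t \<theta> \<phi> / max (1 - t) (chord \<theta>)) \<partial>circ)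
       = (\<integral>\<^sup>+\<phi>. ennreal (1 / max (1 - t) (chord \<theta>)) * ennreal (poisson t \<theta> \<phi>) \<partial>circ)"
      using t by (intro nn_integral_cong) (simp add: le_max_iff_disj flip: ennreal_mult')
    also have "\<dots> = ennreal (1 / max (1 - t) (chord \<theta>)) * ennreal (2 * pi)"
      unfolding nn_integral_poisson[OF t, of \<theta>, symmetric] by (intro nn_integral_cmult) measurable
    finally show "(\<integral>\<^sup>+\<phi>. ennreal (poisson t \<theta> \<phi> / max (1 - t) (chord \<theta>)) \<partial>circ)
       = ennreal (2 * pi) * ennreal (1 / max (1 - t) (chord \<theta>))"
      by (simp add: mult.commute)
  qed
  also have "\<dots> = ennreal (2 * pi) * ennreal (pot \<mu> \<theta>)"
    unfolding nn_integral_pot[OF \<mu> \<theta>, symmetric] by (intro nn_integral_cmult) measurable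
  finally show ?thesis
    by (simp add: ennreal_mult')
qed

text \<open>Finiteness allows the passage to real numbers by \<open>enn2real\<close>. It rests on
  the bound B of u, which on a circle of radius below 1 exists by compactness and which enters no
  quantitative estimate.\<close>

lemma near_part_less_top:
  assumes \<theta>: "\<theta> \<in> space circ"
  shows "near_part \<mu> u \<theta> < \<infinity>"
proof -
  note [measurable] = potential_measurability
  have "near_part \<mu> u \<theta> \<le> (\<integral>\<^sup>+w. ennreal B * ennreal (poisson (fst w) \<theta> (snd w) / max (1 - fst w) (chord \<theta>)) \<partial>(\<mu> \<Otimes>\<^sub>M circ))"
    unfolding near_part_def
  proof (intro nn_integral_mono)
    fix w assume "w \<in> space (\<mu> \<Otimes>\<^sub>M circ)"
    then have t: "0 \<le> fst w" "fst w < 1" using \<mu> by (auto simp: space_finite_borel_unit space_pair_measure)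
    have "poisson (fst w) \<theta> (snd w) / max (1 - fst w) (chord \<theta>) * (u (snd w) * near \<theta> (snd w))
       \<le> poisson (fst w) \<theta> (snd w) / max (1 - fst w) (chord \<theta>) * B"
      using poisson_nonneg[OF t] t unn[of "snd w"] uB[of "snd w"]
      by (intro mult_left_mono) (auto simp: near_def le_max_iff_disj)
    then show "ennreal (poisson (fst w) \<theta> (snd w) / max (1 - fst w) (chord \<theta>) * (u (snd w) * near \<theta> (snd w)))
      \<le> ennreal B * ennreal (poisson (fst w) \<theta> (snd w) / max (1 - fst w) (chord \<theta>))"
      using order_trans[OF unn uB] by (simp add: ennreal_leI mult.commute flip: ennreal_mult')
  qed
  also have "\<dots> = ennreal B * ennreal (2 * pi * pot \<mu> \<theta>)"
    unfolding nn_integral_poisson_kernel[OF \<theta>, symmetric] by (intro nn_integral_cmult) measurable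
  also have "\<dots> < \<infinity>" by (simp add: ennreal_mult_less_top)
  finally show ?thesis .
qed

lemma poisson_le_near_far:
  assumes \<theta>: "\<theta> \<in> space circ"
  shows "(\<integral>\<^sup>+t. \<integral>\<^sup>+\<phi>. ennreal (poisson t \<theta> \<phi> * u \<phi> / max (1 - t) (chord \<theta>)) \<partial>circ \<partial>\<mu>)
    \<le> near_part \<mu> u \<theta> + ennreal (8 * (pot \<mu> \<theta> * (\<integral>\<phi>. u \<phi> / max (chord \<phi>) (chord \<theta>) \<partial>circ)))"
proof -
  note [measurable] = potential_measurability
  have pos: "0 < chord \<theta>" using \<theta> chord_pos by auto
  let ?F = "\<integral>\<phi>. u \<phi> / max (chord \<phi>) (chord \<theta>) \<partial>circ"
  have F: "(\<integral>\<^sup>+\<phi>. ennreal (u \<phi> / max (chord \<phi>) (chord \<theta>)) \<partial>circ) = ennreal ?F"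
  proof (rule nn_integral_eq_integral)
    have "norm (u \<phi> / max (chord \<phi>) (chord \<theta>)) \<le> B / chord \<theta>" for \<phi>
      using pos unn[of \<phi>] uB[of \<phi>] by (auto intro!: frac_le)
    then show "integrable circ (\<lambda>\<phi>. u \<phi> / max (chord \<phi>) (chord \<theta>))"
      by (intro C.integrable_const_bound[where B = "B / chord \<theta>"] AE_I2) auto
  qed (use unn in \<open>auto simp: le_max_iff_disj\<close>)
  have F0: "0 \<le> ?F"
    using unn by (intro integral_nonneg_AE AE_I2) (auto simp: le_max_iff_disj)
  let ?n = "\<lambda>t \<phi>. ennreal (poisson t \<theta> \<phi> / max (1 - t) (chord \<theta>) * (u \<phi> * near \<theta> \<phi>))"
  \<comment> \<open>In the far bound t and \<phi> separate, so the double integral factors into the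
    potential and a Hilbert-type integral of u.\<close>
  let ?g = "\<lambda>t \<phi>. ennreal (8 * (1 / max (1 - t) (chord \<theta>))) * ennreal (u \<phi> / max (chord \<phi>) (chord \<theta>))"
  have [measurable]: "near \<theta> \<in> borel_measurable circ"
    unfolding near_def by measurable
  have "(\<integral>\<^sup>+t. \<integral>\<^sup>+\<phi>. ennreal (poisson t \<theta> \<phi> * u \<phi> / max (1 - t) (chord \<theta>)) \<partial>circ \<partial>\<mu>)
    \<le> (\<integral>\<^sup>+t. \<integral>\<^sup>+\<phi>. ?n t \<phi> + ?g t \<phi> \<partial>circ \<partial>\<mu>)"
  proof (intro nn_integral_mono)
    fix t \<phi> assume "t \<in> space \<mu>" and \<phi>: "\<phi> \<in> space circ"
    then have t: "0 \<le> t" "t < 1" using \<mu> by (auto simp: space_finite_borel_unit)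
    have pos': "0 < chord \<phi>" using \<phi> chord_pos by auto
    show "ennreal (poisson t \<theta> \<phi> * u \<phi> / max (1 - t) (chord \<theta>)) \<le> ?n t \<phi> + ?g t \<phi>"
    proof (cases "chord \<theta> \<le> 2 * chord \<phi> \<and> chord \<phi> \<le> 2 * chord \<theta>")
      case True
      then show ?thesis by (simp add: near_def)
    next
      case False
      have "poisson t \<theta> \<phi> * (u \<phi> / max (1 - t) (chord \<theta>)) \<le> 8 / max (chord \<phi>) (chord \<theta>) * (u \<phi> / max (1 - t) (chord \<theta>))"
        using poisson_far_le[OF t pos pos' False] unn[of \<phi>] t
        by (intro mult_right_mono) (auto simp: le_max_iff_disj)
      then show ?thesis
        using False t unn[of \<phi>] by (simp add: near_def ennreal_leI mult_ac le_max_iff_disj flip: ennreal_mult)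
    qed
  qed
  also have "\<dots> = (\<integral>\<^sup>+t. (\<integral>\<^sup>+\<phi>. ?n t \<phi> \<partial>circ) + (\<integral>\<^sup>+\<phi>. ?g t \<phi> \<partial>circ) \<partial>\<mu>)"
    by (intro nn_integral_cong nn_integral_add) measurable
  also have "\<dots> = (\<integral>\<^sup>+t. (\<integral>\<^sup>+\<phi>. ?n t \<phi> \<partial>circ) \<partial>\<mu>) + (\<integral>\<^sup>+t. (\<integral>\<^sup>+\<phi>. ?g t \<phi> \<partial>circ) \<partial>\<mu>)"
    by (intro nn_integral_add) measurable
  also have "(\<integral>\<^sup>+t. (\<integral>\<^sup>+\<phi>. ?n t \<phi> \<partial>circ) \<partial>\<mu>) = near_part \<mu> u \<theta>"
    unfolding near_part_def by (subst C.nn_integral_fst[symmetric]) auto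
  also have "(\<integral>\<^sup>+t. (\<integral>\<^sup>+\<phi>. ?g t \<phi> \<partial>circ) \<partial>\<mu>) = (\<integral>\<^sup>+t. ennreal (8 * ?F) * ennreal (1 / max (1 - t) (chord \<theta>)) \<partial>\<mu>)"
  proof (intro nn_integral_cong)
    fix t assume "t \<in> space \<mu>"
    then have t: "0 \<le> t" "t < 1" using \<mu> by (auto simp: space_finite_borel_unit)
    have "(\<integral>\<^sup>+\<phi>. ?g t \<phi> \<partial>circ) = ennreal (8 * (1 / max (1 - t) (chord \<theta>))) * ennreal ?F"
      unfolding F[symmetric] by (intro nn_integral_cmult) measurable
    also have "\<dots> = ennreal (8 * ?F) * ennreal (1 / max (1 - t) (chord \<theta>))"
      using F0 t by (simp add: le_max_iff_disj mult_ac flip: ennreal_mult)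
    finally show "(\<integral>\<^sup>+\<phi>. ?g t \<phi> \<partial>circ) = ennreal (8 * ?F) * ennreal (1 / max (1 - t) (chord \<theta>))" .
  qed
  also have "\<dots> = ennreal (8 * ?F) * ennreal (pot \<mu> \<theta>)"
    unfolding nn_integral_pot[OF \<mu> \<theta>, symmetric] by (intro nn_integral_cmult) measurable
  also have "\<dots> = ennreal (8 * (pot \<mu> \<theta> * ?F))"
    using F0 by (simp add: pot_nonneg mult_ac flip: ennreal_mult)
  finally show ?thesis .
qed

text \<open>On the near region the potential and its kernel at \<open>\<theta>\<close> and at \<open>\<phi>\<close> are comparable, so
  after Jensen's inequality the Poisson kernel can be integrated out in \<open>\<theta>\<close>; this replaces the
  Hardy-Littlewood maximal function.\<close>

lemma nn_integral_near_part_le: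
  assumes q: "1 \<le> q"
  shows "(\<integral>\<^sup>+\<theta>. ennreal (enn2real (near_part \<mu> u \<theta>) powr q) \<partial>circ)
    \<le> ennreal ((4 * pi) powr q) * (\<integral>\<^sup>+\<phi>. ennreal ((u \<phi> * pot \<mu> \<phi>) powr q) \<partial>circ)"
proof -
  note [measurable] = potential_measurability
  have [measurable]: "(\<lambda>w. near (fst w) (snd (snd w))) \<in> borel_measurable (circ \<Otimes>\<^sub>M (\<mu> \<Otimes>\<^sub>M circ))"
    "\<And>\<theta>. (\<lambda>w. near \<theta> (snd w)) \<in> borel_measurable (\<mu> \<Otimes>\<^sub>M circ)"
    unfolding near_def by measurable
  let ?k = "\<lambda>\<theta> w. poisson (fst w) \<theta> (snd w) / max (1 - fst w) (chord \<theta>)"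
  have kk: "0 \<le> ?k \<theta> w" if "w \<in> space (\<mu> \<Otimes>\<^sub>M circ)" for \<theta> w
    using that \<mu> by (auto simp: space_finite_borel_unit space_pair_measure poisson_nonneg le_max_iff_disj)
  \<comment> \<open>The Jensen bound with \<theta> replaced by \<phi>: the potential costs a factor
    2, turning 2 pi into 4 pi, and the kernel 1 / max another 2. Only the Poisson factor left
    outside \<open>?h\<close> still contains \<theta>.\<close>
  let ?h = "\<lambda>w. ennreal ((4 * pi * pot \<mu> (snd w)) powr (q - 1) * (2 * (1 / max (1 - fst w) (chord (snd w)))) * u (snd w) powr q)"
  have 1: "ennreal (enn2real (near_part \<mu> u \<theta>) powr q)
      \<le> (\<integral>\<^sup>+w. ?h w * ennreal (poisson (fst w) \<theta> (snd w)) \<partial>(\<mu> \<Otimes>\<^sub>M circ))" if \<theta>: "\<theta> \<in> space circ" for \<theta>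
  proof -
    have "ennreal (enn2real (near_part \<mu> u \<theta>) powr q)
      \<le> ennreal ((2 * pi * pot \<mu> \<theta>) powr (q - 1)) * (\<integral>\<^sup>+w. ennreal (?k \<theta> w * (u (snd w) * near \<theta> (snd w)) powr q) \<partial>(\<mu> \<Otimes>\<^sub>M circ))"
    proof (rule nn_integral_weighted_Jensen)
      show "ennreal (enn2real (near_part \<mu> u \<theta>)) \<le> (\<integral>\<^sup>+w. ennreal (?k \<theta> w * (u (snd w) * near \<theta> (snd w))) \<partial>(\<mu> \<Otimes>\<^sub>M circ))"
        using near_part_less_top[OF \<theta>] by (simp add: near_part_def)
      show "(\<integral>\<^sup>+w. ennreal (?k \<theta> w) \<partial>(\<mu> \<Otimes>\<^sub>M circ)) \<le> ennreal (2 * pi * pot \<mu> \<theta>)"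
        using nn_integral_poisson_kernel[OF \<theta>] by simp
    qed (use q kk unn in \<open>auto simp: pot_nonneg near_def\<close>)
    also have "\<dots> = (\<integral>\<^sup>+w. ennreal ((2 * pi * pot \<mu> \<theta>) powr (q - 1)) * ennreal (?k \<theta> w * (u (snd w) * near \<theta> (snd w)) powr q) \<partial>(\<mu> \<Otimes>\<^sub>M circ))"
      by (intro nn_integral_cmult[symmetric]) measurable
    also have "\<dots> \<le> (\<integral>\<^sup>+w. ?h w * ennreal (poisson (fst w) \<theta> (snd w)) \<partial>(\<mu> \<Otimes>\<^sub>M circ))"
    proof (intro nn_integral_mono)
      fix w assume w: "w \<in> space (\<mu> \<Otimes>\<^sub>M circ)"
      obtain t \<phi> where tp: "w = (t, \<phi>)" by (cases w)
      have t: "0 \<le> t" "t < 1" and \<phi>: "\<phi> \<in> space circ"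
        using w \<mu> by (auto simp: tp space_finite_borel_unit space_pair_measure)
      have pos: "0 < chord \<phi>" using \<phi> chord_pos by auto
      show "ennreal ((2 * pi * pot \<mu> \<theta>) powr (q - 1)) * ennreal (?k \<theta> w * (u (snd w) * near \<theta> (snd w)) powr q)
        \<le> ?h w * ennreal (poisson (fst w) \<theta> (snd w))"
      proof (cases "chord \<theta> \<le> 2 * chord \<phi> \<and> chord \<phi> \<le> 2 * chord \<theta>")
        case True
        have a: "(2 * pi * pot \<mu> \<theta>) powr (q - 1) \<le> (4 * pi * pot \<mu> \<phi>) powr (q - 1)"
          using pot_near_le[OF \<mu> \<theta> \<phi>] True q by (intro powr_mono2) (auto simp: pot_nonneg)
        have b: "1 / max (1 - t) (chord \<theta>) \<le> 2 * (1 / max (1 - t) (chord \<phi>))"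
          using True by (intro max_near_le pos t) auto
        have "(2 * pi * pot \<mu> \<theta>) powr (q - 1) * (1 / max (1 - t) (chord \<theta>)) * (u \<phi> powr q * poisson t \<theta> \<phi>)
          \<le> (4 * pi * pot \<mu> \<phi>) powr (q - 1) * (2 * (1 / max (1 - t) (chord \<phi>))) * (u \<phi> powr q * poisson t \<theta> \<phi>)"
          using a b t poisson_nonneg[OF t] by (intro mult_right_mono mult_mono) (auto simp: le_max_iff_disj)
        then have "(2 * pi * pot \<mu> \<theta>) powr (q - 1) * (poisson t \<theta> \<phi> / max (1 - t) (chord \<theta>) * u \<phi> powr q)
          \<le> (4 * pi * pot \<mu> \<phi>) powr (q - 1) * (2 * (1 / max (1 - t) (chord \<phi>))) * u \<phi> powr q * poisson t \<theta> \<phi>"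
          by (simp add: mult_ac)
        then show ?thesis
          using True t poisson_nonneg[OF t] by (simp add: tp near_def ennreal_leI le_max_iff_disj flip: ennreal_mult)
      next
        case False
        then show ?thesis by (auto simp: tp near_def)
      qed
    qed
    finally show ?thesis .
  qed
  have "(\<integral>\<^sup>+\<theta>. ennreal (enn2real (near_part \<mu> u \<theta>) powr q) \<partial>circ)
    \<le> (\<integral>\<^sup>+\<theta>. \<integral>\<^sup>+w. ?h w * ennreal (poisson (fst w) \<theta> (snd w)) \<partial>(\<mu> \<Otimes>\<^sub>M circ) \<partial>circ)"
    by (intro nn_integral_mono 1)
  also have "\<dots> = (\<integral>\<^sup>+w. \<integral>\<^sup>+\<theta>. ?h w * ennreal (poisson (fst w) \<theta> (snd w)) \<partial>circ \<partial>(\<mu> \<Otimes>\<^sub>M circ))"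
    by (intro T.Fubini'[symmetric]) measurable
  also have "\<dots> = (\<integral>\<^sup>+w. ?h w * ennreal (2 * pi) \<partial>(\<mu> \<Otimes>\<^sub>M circ))"
  proof (intro nn_integral_cong)
    fix w assume w: "w \<in> space (\<mu> \<Otimes>\<^sub>M circ)"
    have t: "0 \<le> fst w" "fst w < 1"
      using w \<mu> by (auto simp: space_finite_borel_unit space_pair_measure)
    \<comment> \<open>The integration is over the angle of the interior point; symmetry reduces it
      to the usual mass.\<close>
    have "(\<integral>\<^sup>+\<theta>. ennreal (poisson (fst w) \<theta> (snd w)) \<partial>circ) = ennreal (2 * pi)"
      using nn_integral_poisson[OF t, of "snd w"] by (simp add: poisson_commute[of _ _ "snd w"])
    then show "(\<integral>\<^sup>+\<theta>. ?h w * ennreal (poisson (fst w) \<theta> (snd w)) \<partial>circ) = ?h w * ennreal (2 * pi)"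
      by (subst nn_integral_cmult) auto
  qed
  also have "\<dots> = (\<integral>\<^sup>+\<phi>. \<integral>\<^sup>+t. ?h (t, \<phi>) * ennreal (2 * pi) \<partial>\<mu> \<partial>circ)"
    by (subst P.nn_integral_snd[symmetric]) auto
  also have "\<dots> = (\<integral>\<^sup>+\<phi>. ennreal ((4 * pi) powr q) * ennreal ((u \<phi> * pot \<mu> \<phi>) powr q) \<partial>circ)"
  proof (intro nn_integral_cong)
    fix \<phi> assume \<phi>: "\<phi> \<in> space circ"
    let ?c = "ennreal ((4 * pi * pot \<mu> \<phi>) powr (q - 1) * (4 * pi) * u \<phi> powr q)"
    have "(\<integral>\<^sup>+t. ?h (t, \<phi>) * ennreal (2 * pi) \<partial>\<mu>) = (\<integral>\<^sup>+t. ?c * ennreal (1 / max (1 - t) (chord \<phi>)) \<partial>\<mu>)"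
      by (intro nn_integral_cong) (simp add: mult_ac flip: ennreal_mult' ennreal_mult'')
    also have "\<dots> = ?c * ennreal (pot \<mu> \<phi>)"
      unfolding nn_integral_pot[OF \<mu> \<phi>, symmetric] by (intro nn_integral_cmult) measurable
    also have "\<dots> = ennreal ((4 * pi) powr q * (u \<phi> * pot \<mu> \<phi>) powr q)"
    proof -
      have *: "x powr (q - 1) * x = x powr q" if "0 \<le> x" for x :: real
        using that powr_add[of x "q - 1" 1] by simp
      have "(4 * pi * pot \<mu> \<phi>) powr (q - 1) * (4 * pi) * u \<phi> powr q * pot \<mu> \<phi>
        = ((4 * pi * pot \<mu> \<phi>) powr (q - 1) * (4 * pi * pot \<mu> \<phi>)) * u \<phi> powr q"
        by (simp only: mult_ac)
      also have "\<dots> = (4 * pi * pot \<mu> \<phi>) powr q * u \<phi> powr q"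
        by (subst *) (auto simp: pot_nonneg)
      also have "\<dots> = (4 * pi) powr q * (u \<phi> * pot \<mu> \<phi>) powr q"
        by (simp add: powr_mult pot_nonneg unn)
      finally show ?thesis by (simp add: pot_nonneg flip: ennreal_mult')
    qed
    finally show "(\<integral>\<^sup>+t. ?h (t, \<phi>) * ennreal (2 * pi) \<partial>\<mu>) = ennreal ((4 * pi) powr q) * ennreal ((u \<phi> * pot \<mu> \<phi>) powr q)"
      by (simp add: ennreal_mult')
  qed
  also have "\<dots> = ennreal ((4 * pi) powr q) * (\<integral>\<^sup>+\<phi>. ennreal ((u \<phi> * pot \<mu> \<phi>) powr q) \<partial>circ)"
    by (intro nn_integral_cmult) measurable
  finally show ?thesis .
qed

end

section \<open>Boundedness\<close>

lemma nn_integral_circle_powr: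
  fixes f :: "complex \<Rightarrow> complex"
  assumes f: "f holomorphic_on ball 0 1" and \<rho>: "0 \<le> \<rho>" "\<rho> < 1" and p: "0 < p"
  shows "(\<integral>\<^sup>+\<theta>. ennreal (cmod (f (of_real \<rho> * cis \<theta>)) powr p) \<partial>circ) = ennreal (2 * pi * hardy_mean p f \<rho> powr p)"
proof -
  let ?I = "integral {0..2 * pi} (\<lambda>\<theta>. cmod (f (of_real \<rho> * cis \<theta>)) powr p)"
  have c: "continuous_on {0..2 * pi} (\<lambda>\<theta>. cmod (f (of_real \<rho> * cis \<theta>)) powr p)"
    using p by (intro continuous_on_powr' continuous_on_circle_norm f \<rho> continuous_intros) auto
  have "0 \<le> ?I"
    by (intro integral_nonneg integrable_continuous_interval c) auto
  then have "hardy_mean p f \<rho> powr p = ?I / (2 * pi)"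
    using p by (simp add: hardy_mean_def powr_powr flip: cis_conv_exp)
  then show ?thesis
    by (subst nn_integral_circ_eq_integral[OF c]) auto
qed

lemma hardy_mean_nonneg: "0 \<le> hardy_mean p f \<rho>"
  by (simp add: hardy_mean_def)

lemma hardy_mean_leI:
  assumes f: "f holomorphic_on ball 0 1" and \<rho>: "0 \<le> \<rho>" "\<rho> < 1" and p: "0 < p" and K: "0 \<le> K"
    and le: "(\<integral>\<^sup>+\<theta>. ennreal (cmod (f (of_real \<rho> * cis \<theta>)) powr p) \<partial>circ) \<le> ennreal (2 * pi * K powr p)"
  shows "hardy_mean p f \<rho> \<le> K"
proof (rule ccontr)
  assume "\<not> hardy_mean p f \<rho> \<le> K"
  then have "K powr p < hardy_mean p f \<rho> powr p"
    using K p by (intro powr_less_mono2) auto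
  moreover have "hardy_mean p f \<rho> powr p \<le> K powr p"
    using le unfolding nn_integral_circle_powr[OF f \<rho> p] by (subst (asm) ennreal_le_iff) auto
  ultimately show False by simp
qed

text \<open>A crude triangle inequality that asks only for a pointwise majorant of |f|, as the near
  and far parts are not holomorphic. The constant is 4 = 2 * 2: one 2 from
  \<open>powr_add_le\<close>, the other from 2 \<le> 2^q when the two terms are added.\<close>

lemma hardy_mean_leI':
  assumes f: "f holomorphic_on ball 0 1" and \<rho>: "0 \<le> \<rho>" "\<rho> < 1" and q: "1 \<le> q"
    and [measurable]: "a \<in> borel_measurable circ" "b \<in> borel_measurable circ"
    and nn: "\<And>\<theta>. \<theta> \<in> space circ \<Longrightarrow> 0 \<le> a \<theta>" "\<And>\<theta>. \<theta> \<in> space circ \<Longrightarrow> 0 \<le> b \<theta>" and XY: "0 \<le> X" "0 \<le> Y"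
    and le: "\<And>\<theta>. \<theta> \<in> space circ \<Longrightarrow> cmod (f (of_real \<rho> * cis \<theta>)) \<le> a \<theta> + b \<theta>"
    and a: "(\<integral>\<^sup>+\<theta>. ennreal (a \<theta> powr q) \<partial>circ) \<le> ennreal (2 * pi * X powr q)"
    and b: "(\<integral>\<^sup>+\<theta>. ennreal (b \<theta> powr q) \<partial>circ) \<le> ennreal (2 * pi * Y powr q)"
  shows "hardy_mean q f \<rho> \<le> 4 * (X + Y)"
proof (rule hardy_mean_leI[OF f \<rho>])
  have "(\<integral>\<^sup>+\<theta>. ennreal (cmod (f (of_real \<rho> * cis \<theta>)) powr q) \<partial>circ)
    \<le> (\<integral>\<^sup>+\<theta>. ennreal (2 powr q) * (ennreal (a \<theta> powr q) + ennreal (b \<theta> powr q)) \<partial>circ)"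
  proof (intro nn_integral_mono)
    fix \<theta> assume \<theta>: "\<theta> \<in> space circ"
    have "cmod (f (of_real \<rho> * cis \<theta>)) powr q \<le> (a \<theta> + b \<theta>) powr q"
      using q le[OF \<theta>] by (intro powr_mono2) auto
    also have "\<dots> \<le> 2 powr q * (a \<theta> powr q + b \<theta> powr q)"
      using q nn \<theta> by (intro powr_add_le) auto
    finally show "ennreal (cmod (f (of_real \<rho> * cis \<theta>)) powr q) \<le> ennreal (2 powr q) * (ennreal (a \<theta> powr q) + ennreal (b \<theta> powr q))"
      by (simp add: ennreal_leI flip: ennreal_mult ennreal_plus)
  qed
  also have "\<dots> = ennreal (2 powr q) * ((\<integral>\<^sup>+\<theta>. ennreal (a \<theta> powr q) \<partial>circ) + (\<integral>\<^sup>+\<theta>. ennreal (b \<theta> powr q) \<partial>circ))"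
    by (subst nn_integral_cmult) (auto simp: nn_integral_add)
  also have "\<dots> \<le> ennreal (2 powr q) * (ennreal (2 * pi * X powr q) + ennreal (2 * pi * Y powr q))"
    by (intro mult_left_mono add_mono a b) auto
  also have "\<dots> = ennreal (2 powr q * (2 * pi * X powr q + 2 * pi * Y powr q))"
    by (simp flip: ennreal_mult' ennreal_plus)
  also have "\<dots> \<le> ennreal (2 * pi * (4 * (X + Y)) powr q)"
  proof (rule ennreal_leI)
    have "X powr q \<le> (X + Y) powr q" "Y powr q \<le> (X + Y) powr q"
      using XY q by (auto intro!: powr_mono2)
    then have "2 powr q * (2 * pi * X powr q + 2 * pi * Y powr q) \<le> 2 powr q * (2 * pi * (X + Y) powr q + 2 * pi * (X + Y) powr q)"
      by (intro mult_left_mono add_mono) auto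
    also have "\<dots> = 2 powr q * 2 powr 1 * (2 * pi * (X + Y) powr q)"
      by simp
    also have "\<dots> \<le> 2 powr q * 2 powr q * (2 * pi * (X + Y) powr q)"
      using q by (intro mult_right_mono mult_left_mono powr_mono) auto
    also have "2 powr q * 2 powr q = (4 :: real) powr q"
      by (simp flip: powr_mult)
    also have "4 powr q * (2 * pi * (X + Y) powr q) = 2 * pi * (4 * (X + Y)) powr q"
      using XY by (subst powr_mult) auto
    finally show "2 powr q * (2 * pi * X powr q + 2 * pi * Y powr q) \<le> 2 * pi * (4 * (X + Y)) powr q" .
  qed
  finally show "(\<integral>\<^sup>+\<theta>. ennreal (cmod (f (of_real \<rho> * cis \<theta>)) powr q) \<partial>circ) \<le> ennreal (2 * pi * (4 * (X + Y)) powr q)" .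
qed (use q XY in auto)

text \<open>Hoelder for the q-th powers with exponents p/q and r/q, which are conjugate by the
  choice of r.\<close>

lemma nn_integral_mult_pot_powr_le:
  assumes [measurable]: "v \<in> borel_measurable circ" "g \<in> borel_measurable circ"
    and nn: "\<And>x. x \<in> space circ \<Longrightarrow> 0 \<le> v x" "\<And>x. x \<in> space circ \<Longrightarrow> 0 \<le> g x"
    and q: "1 \<le> q" "q < p" and r: "r = p * q / (p - q)"
    and V: "0 \<le> V" "(\<integral>\<^sup>+\<theta>. ennreal (v \<theta> powr p) \<partial>circ) \<le> ennreal V"
    and W: "0 \<le> W" "(\<integral>\<^sup>+\<theta>. ennreal (g \<theta> powr r) \<partial>circ) \<le> ennreal W"
  shows "(\<integral>\<^sup>+\<theta>. ennreal ((v \<theta> * g \<theta>) powr q) \<partial>circ) \<le> ennreal ((V powr (1 / p) * W powr (1 / r)) powr q)"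
proof -
  have r0: "r > 0" using q r by simp
  have "(\<integral>\<^sup>+\<theta>. ennreal ((v \<theta> * g \<theta>) powr q) \<partial>circ) = (\<integral>\<^sup>+\<theta>. ennreal (v \<theta> powr q * g \<theta> powr q) \<partial>circ)"
    using nn by (intro nn_integral_cong) (auto simp: powr_mult)
  also have "\<dots> \<le> ennreal (V powr (1 / (p / q)) * W powr (1 / (r / q)))"
  proof (rule nn_integral_Hoelder)
    show "1 < p / q" "1 < r / q" "1 / (p / q) + 1 / (r / q) = 1"
      using q by (auto simp: r field_simps)
    have "(\<integral>\<^sup>+\<theta>. ennreal ((v \<theta> powr q) powr (p / q)) \<partial>circ) = (\<integral>\<^sup>+\<theta>. ennreal (v \<theta> powr p) \<partial>circ)"
      using q by (simp add: powr_powr)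
    then show "(\<integral>\<^sup>+\<theta>. ennreal ((v \<theta> powr q) powr (p / q)) \<partial>circ) \<le> ennreal V"
      using V by simp
    have "(\<integral>\<^sup>+\<theta>. ennreal ((g \<theta> powr q) powr (r / q)) \<partial>circ) = (\<integral>\<^sup>+\<theta>. ennreal (g \<theta> powr r) \<partial>circ)"
      using q by (simp add: powr_powr)
    then show "(\<integral>\<^sup>+\<theta>. ennreal ((g \<theta> powr q) powr (r / q)) \<partial>circ) \<le> ennreal W"
      using W by simp
  qed (use V W in auto)
  also have "V powr (1 / (p / q)) * W powr (1 / (r / q)) = (V powr (1 / p) * W powr (1 / r)) powr q"
    using V W by (simp add: powr_mult powr_powr)
  finally show ?thesis .
qed

lemma conjugate_gt_1: "1 \<le> q \<Longrightarrow> q < p \<Longrightarrow> r = p * q / (p - q) \<Longrightarrow> 1 < r" for p q r :: real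
proof -
  assume a: "1 \<le> q" "q < p" "r = p * q / (p - q)"
  have "p * 1 \<le> p * q" using a by (intro mult_left_mono) auto
  then have "p - q < p * q" using a by linarith
  then show "1 < r" using a by simp
qed

text \<open>The same radius \<rho> stands on both sides, and C is fixed before \<mu>, A, f and
  \<rho>. Taking suprema gives boundedness; inserting the part of \<mu> near 1 gives the smallness
  behind compactness.\<close>

lemma cesaro_op_circle_bound:
  assumes q: "1 \<le> q" "q < p" and r: "r = p * q / (p - q)"
  shows "\<exists>C\<ge>0. \<forall>\<mu> A f \<rho>. finite_borel_unit \<mu> \<longrightarrow> 0 \<le> A \<longrightarrow>
    (\<integral>\<^sup>+t. ennreal (tail \<mu> t powr r) \<partial>unit_len) \<le> ennreal A \<longrightarrow> f holomorphic_on ball 0 1 \<longrightarrow> 0 \<le> \<rho> \<longrightarrow> \<rho> < 1 \<longrightarrow>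
    hardy_mean q (cesaro_op \<mu> f) \<rho> \<le> C * (A + measure \<mu> (space \<mu>) powr r) powr (1 / r) * hardy_mean p f \<rho>"
proof -
  have r1: "1 < r" by (rule conjugate_gt_1[OF q r])
  have p: "1 < p" using q by simp
  obtain C1 where C1: "C1 \<ge> 0" "\<And>f. f \<in> borel_measurable circ \<Longrightarrow> \<forall>x\<in>space circ. 0 \<le> f x \<Longrightarrow>
    (\<integral>\<^sup>+y. ennreal ((\<integral>x. f x / max (chord x) (chord y) \<partial>circ) powr p) \<partial>circ)
      \<le> ennreal C1 * (\<integral>\<^sup>+x. ennreal (f x powr p) \<partial>circ)"
    using hilbert_inequality[OF size_weight_circ size_weight_circ p] by blast
  obtain C2 where C2: "C2 \<ge> 0" "\<And>\<mu> A. finite_borel_unit \<mu> \<Longrightarrow> 0 \<le> A \<Longrightarrow>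
    (\<integral>\<^sup>+t. ennreal (tail \<mu> t powr r) \<partial>unit_len) \<le> ennreal A \<Longrightarrow>
    (\<integral>\<^sup>+\<theta>. ennreal (pot \<mu> \<theta> powr r) \<partial>circ) \<le> ennreal (C2 * (A + measure \<mu> (space \<mu>) powr r))"
    using nn_integral_pot_powr_le[OF r1] by blast
  \<comment> \<open>D1 belongs to the near part, with 4 pi from
    \<open>nn_integral_near_part_le\<close>; D2 to the far part, with 8 from the pointwise kernel
    bound and C1 from the circle-to-circle inequality. The power of 2 pi undoes the normalisation of
    \<open>hardy_mean\<close>.\<close>
  define D1 where "D1 = 4 * pi * (2 * pi) powr (1 / p) * C2 powr (1 / r)"
  define D2 where "D2 = 8 * (C1 * (2 * pi)) powr (1 / p) * C2 powr (1 / r)"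
  have D: "0 \<le> D1" "0 \<le> D2" by (auto simp: D1_def D2_def)
  show ?thesis
  proof (intro exI[of _ "4 * (D1 + D2)"] conjI allI impI)
    show "0 \<le> 4 * (D1 + D2)" using D by simp
    fix \<mu> A f and \<rho> :: real assume \<mu>: "finite_borel_unit \<mu>" and A: "0 \<le> A"
      and le: "(\<integral>\<^sup>+t. ennreal (tail \<mu> t powr r) \<partial>unit_len) \<le> ennreal A"
      and f: "f holomorphic_on ball 0 1" and \<rho>: "0 \<le> \<rho>" "\<rho> < 1"
    define u where "u \<phi> = cmod (f (of_real \<rho> * cis \<phi>))" for \<phi>
    define h where "h = hardy_mean p f \<rho>"
    define E where "E = (A + measure \<mu> (space \<mu>) powr r) powr (1 / r)"
    define W where "W = C2 * (A + measure \<mu> (space \<mu>) powr r)"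
    define V where "V = 2 * pi * h powr p"
    have h: "0 \<le> h" by (simp add: h_def hardy_mean_nonneg)
    have E: "0 \<le> E" by (simp add: E_def)
    have W: "0 \<le> W" using C2 A by (simp add: W_def)
    have V: "0 \<le> V" by (simp add: V_def)
    have WE: "W powr (1 / r) = C2 powr (1 / r) * E"
      using C2 A by (simp add: W_def E_def powr_mult)
    have um: "u \<in> borel_measurable borel"
      unfolding u_def by (intro borel_measurable_continuous_onI continuous_on_circle_norm f \<rho>)
    have unn: "0 \<le> u x" for x by (simp add: u_def)
    obtain B where uB: "\<And>x. u x \<le> B"
    proof -
      have "compact ((\<lambda>w. cmod (f w)) ` sphere 0 \<rho>)"
        using \<rho> by (intro compact_continuous_image continuous_intros continuous_on_subset[OF holomorphic_on_imp_continuous_on[OF f]]) auto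
      then have "bdd_above ((\<lambda>w. cmod (f w)) ` sphere 0 \<rho>)"
        by (intro bounded_imp_bdd_above compact_imp_bounded)
      then obtain B where B: "\<forall>w\<in>sphere 0 \<rho>. cmod (f w) \<le> B"
        by (auto simp: bdd_above_def)
      show ?thesis
        using \<rho> by (intro that[of B]) (auto simp: u_def norm_mult intro!: B[rule_format])
    qed
    note [measurable] = potential_measurability[OF \<mu> um unn uB]
    have uV: "(\<integral>\<^sup>+\<theta>. ennreal (u \<theta> powr p) \<partial>circ) \<le> ennreal V"
      using p unfolding u_def V_def h_def by (subst nn_integral_circle_powr[OF f \<rho>]) auto
    have pW: "(\<integral>\<^sup>+\<theta>. ennreal (pot \<mu> \<theta> powr r) \<partial>circ) \<le> ennreal W"
      unfolding W_def by (rule C2(2)[OF \<mu> A le])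
    define F where "F \<theta> = (\<integral>\<phi>. u \<phi> / max (chord \<phi>) (chord \<theta>) \<partial>circ)" for \<theta>
    interpret C: finite_measure circ by (rule finite_measure_circ)
    have [measurable]: "F \<in> borel_measurable circ" unfolding F_def by measurable
    have F: "0 \<le> F \<theta>" for \<theta>
      unfolding F_def using unn by (intro integral_nonneg_AE AE_I2) (auto simp: le_max_iff_disj)
    have FV: "(\<integral>\<^sup>+\<theta>. ennreal (F \<theta> powr p) \<partial>circ) \<le> ennreal (C1 * V)"
    proof -
      have "(\<integral>\<^sup>+\<theta>. ennreal (F \<theta> powr p) \<partial>circ) \<le> ennreal C1 * (\<integral>\<^sup>+x. ennreal (u x powr p) \<partial>circ)"
        unfolding F_def using unn by (intro C1(2)) auto
      also have "\<dots> \<le> ennreal C1 * ennreal V"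
        by (intro mult_left_mono uV) auto
      finally show ?thesis using C1 by (simp add: ennreal_mult')
    qed
    define N where "N \<theta> = enn2real (near_part \<mu> u \<theta>)" for \<theta>
    have [measurable]: "N \<in> borel_measurable circ"
    proof -
      interpret finite_measure \<mu> using \<mu> by (simp add: finite_borel_unit_def)
      interpret P: pair_sigma_finite \<mu> circ ..
      have [measurable]: "(\<lambda>w. near (fst w) (snd (snd w))) \<in> borel_measurable (circ \<Otimes>\<^sub>M (\<mu> \<Otimes>\<^sub>M circ))"
        unfolding near_def by measurable
      show ?thesis unfolding N_def near_part_def by measurable
    qed
    have "hardy_mean q (cesaro_op \<mu> f) \<rho> \<le> 4 * (D1 * E * h + D2 * E * h)"
    proof (rule hardy_mean_leI'[where a = N and b = "\<lambda>\<theta>. 8 * (F \<theta> * pot \<mu> \<theta>)"])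
      fix \<theta> assume \<theta>: "\<theta> \<in> space circ"
      have "ennreal (pi * cmod (cesaro_op \<mu> f (of_real \<rho> * cis \<theta>))) \<le> near_part \<mu> u \<theta> + ennreal (8 * (pot \<mu> \<theta> * F \<theta>))"
        using cesaro_op_le_poisson[OF \<mu> f \<rho> \<theta>] poisson_le_near_far[OF \<mu> um unn uB \<theta>]
        unfolding F_def[symmetric] u_def[symmetric] by (rule order_trans)
      also have "near_part \<mu> u \<theta> = ennreal (N \<theta>)"
        using near_part_less_top[OF \<mu> um unn uB \<theta>] by (simp add: N_def)
      finally have "pi * cmod (cesaro_op \<mu> f (of_real \<rho> * cis \<theta>)) \<le> N \<theta> + 8 * (pot \<mu> \<theta> * F \<theta>)"
        using F by (simp add: N_def pot_nonneg flip: ennreal_plus)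
      moreover have "1 * cmod (cesaro_op \<mu> f (of_real \<rho> * cis \<theta>)) \<le> pi * cmod (cesaro_op \<mu> f (of_real \<rho> * cis \<theta>))"
        using pi_gt3 by (intro mult_right_mono) auto
      ultimately show "cmod (cesaro_op \<mu> f (of_real \<rho> * cis \<theta>)) \<le> N \<theta> + 8 * (F \<theta> * pot \<mu> \<theta>)"
        by (simp add: mult.commute)
    next
      have 1: "x \<le> 2 * pi * x" if "0 \<le> x" for x
        using that pi_gt3 mult_right_mono[of 1 "2 * pi" x] by simp
      have "(\<integral>\<^sup>+\<theta>. ennreal (N \<theta> powr q) \<partial>circ) \<le> ennreal ((4 * pi) powr q) * (\<integral>\<^sup>+\<phi>. ennreal ((u \<phi> * pot \<mu> \<phi>) powr q) \<partial>circ)"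
        unfolding N_def by (rule nn_integral_near_part_le[OF \<mu> um unn uB q(1)])
      also have "\<dots> \<le> ennreal ((4 * pi) powr q) * ennreal ((V powr (1 / p) * W powr (1 / r)) powr q)"
        using unn V W uV pW q r by (intro mult_left_mono nn_integral_mult_pot_powr_le) (auto simp: pot_nonneg)
      also have "\<dots> = ennreal ((D1 * E * h) powr q)"
        using p h E C2 by (simp add: WE V_def D1_def powr_mult powr_powr mult_ac flip: ennreal_mult')
      also have "\<dots> \<le> ennreal (2 * pi * (D1 * E * h) powr q)"
        by (intro ennreal_leI 1) auto
      finally show "(\<integral>\<^sup>+\<theta>. ennreal (N \<theta> powr q) \<partial>circ) \<le> ennreal (2 * pi * (D1 * E * h) powr q)" .
      have "(\<integral>\<^sup>+\<theta>. ennreal ((8 * (F \<theta> * pot \<mu> \<theta>)) powr q) \<partial>circ) = (\<integral>\<^sup>+\<theta>. ennreal (8 powr q) * ennreal ((F \<theta> * pot \<mu> \<theta>) powr q) \<partial>circ)"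
        using F by (intro nn_integral_cong) (simp add: powr_mult pot_nonneg flip: ennreal_mult')
      also have "\<dots> = ennreal (8 powr q) * (\<integral>\<^sup>+\<theta>. ennreal ((F \<theta> * pot \<mu> \<theta>) powr q) \<partial>circ)"
        by (intro nn_integral_cmult) measurable
      also have "\<dots> \<le> ennreal (8 powr q) * ennreal (((C1 * V) powr (1 / p) * W powr (1 / r)) powr q)"
        using F V W FV pW q r C1 by (intro mult_left_mono nn_integral_mult_pot_powr_le) (auto simp: pot_nonneg)
      also have "\<dots> = ennreal ((D2 * E * h) powr q)"
        using p h E C1 C2 by (simp add: WE V_def D2_def powr_mult powr_powr mult_ac flip: ennreal_mult')
      also have "\<dots> \<le> ennreal (2 * pi * (D2 * E * h) powr q)"
        by (intro ennreal_leI 1) auto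
      finally show "(\<integral>\<^sup>+\<theta>. ennreal ((8 * (F \<theta> * pot \<mu> \<theta>)) powr q) \<partial>circ) \<le> ennreal (2 * pi * (D2 * E * h) powr q)" .
    qed (use D E h F \<rho> q in \<open>auto simp: N_def pot_nonneg holomorphic_cesaro_op[OF \<mu> f]\<close>)
    then show "hardy_mean q (cesaro_op \<mu> f) \<rho> \<le> 4 * (D1 + D2) * (A + measure \<mu> (space \<mu>) powr r) powr (1 / r) * hardy_mean p f \<rho>"
      by (simp add: E_def h_def algebra_simps)
  qed
qed

text \<open>Since s r + 1 = r, the factor 1 / (1 - t) merges with the weight into (1 -
  t)^(-r).\<close>

lemma tail_condition_iff:
  assumes "1 < r" "s = 1 - 1 / r"
  shows "tail_condition r s \<mu> \<longleftrightarrow> (\<integral>\<^sup>+t. ennreal (tail \<mu> t powr r) \<partial>unit_len) < \<infinity>"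
proof -
  have "(measure \<mu> {t..<1} / (1 - t) powr s) powr r / (1 - t) = tail \<mu> t powr r" if "t \<in> {0..<1}" for t
  proof -
    have "s * r + 1 = r" using assms by (simp add: field_simps)
    then have "(1 - t) powr (s * r) * (1 - t) powr 1 = (1 - t) powr r"
      by (simp only: powr_add[symmetric])
    then show ?thesis
      using that by (simp add: tail_def powr_divide powr_powr)
  qed
  then show ?thesis
    unfolding tail_condition_def nn_integral_unit_len
    by (auto intro!: arg_cong[where f = "\<lambda>x. x < top"] nn_integral_cong simp: indicator_def)
qed

lemma hardy_spaceD:
  assumes "f \<in> hardy_space p"
  shows "f holomorphic_on ball 0 1" "0 \<le> \<rho> \<Longrightarrow> \<rho> < 1 \<Longrightarrow> hardy_mean p f \<rho> \<le> hardy_norm p f"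
  using assms by (auto simp: hardy_space_def hardy_norm_def intro!: cSUP_upper)

lemma hardy_spaceI:
  assumes "f holomorphic_on ball 0 1" "\<And>\<rho>. 0 \<le> \<rho> \<Longrightarrow> \<rho> < 1 \<Longrightarrow> hardy_mean p f \<rho> \<le> K"
  shows "f \<in> hardy_space p" "hardy_norm p f \<le> K"
  using assms by (auto simp: hardy_space_def hardy_norm_def intro!: cSUP_least bdd_aboveI2)

lemma tail_condition_imp_bounded:
  assumes q: "1 \<le> q" "q < p" and r: "r = p * q / (p - q)" and s: "s = 1 - 1 / r"
    and \<mu>: "finite_borel_unit \<mu>" and tc: "tail_condition r s \<mu>"
  shows "hardy_bounded p q (cesaro_op \<mu>)"
proof -
  have fin: "(\<integral>\<^sup>+t. ennreal (tail \<mu> t powr r) \<partial>unit_len) < \<infinity>"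
    using tc tail_condition_iff[OF conjugate_gt_1[OF q r] s] by simp
  then obtain A where A: "0 \<le> A" "(\<integral>\<^sup>+t. ennreal (tail \<mu> t powr r) \<partial>unit_len) = ennreal A"
    by (auto simp: less_top_ennreal)
  obtain C where C: "C \<ge> 0" "\<And>f \<rho>. f holomorphic_on ball 0 1 \<Longrightarrow> 0 \<le> \<rho> \<Longrightarrow> \<rho> < 1 \<Longrightarrow>
    hardy_mean q (cesaro_op \<mu> f) \<rho> \<le> C * (A + measure \<mu> (space \<mu>) powr r) powr (1 / r) * hardy_mean p f \<rho>"
    using cesaro_op_circle_bound[OF q r] \<mu> A by (metis order_refl)
  define K where "K = C * (A + measure \<mu> (space \<mu>) powr r) powr (1 / r)"
  have K: "K \<ge> 0" using C by (simp add: K_def)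
  have *: "hardy_mean q (cesaro_op \<mu> f) \<rho> \<le> K * hardy_norm p f" if "f \<in> hardy_space p" "0 \<le> \<rho>" "\<rho> < 1" for f \<rho>
  proof -
    have "hardy_mean q (cesaro_op \<mu> f) \<rho> \<le> K * hardy_mean p f \<rho>"
      unfolding K_def using that by (intro C hardy_spaceD)
    also have "\<dots> \<le> K * hardy_norm p f"
      using that K by (intro mult_left_mono hardy_spaceD)
    finally show ?thesis .
  qed
  show ?thesis
    unfolding hardy_bounded_def using *
    by (intro exI[of _ K] ballI conjI hardy_spaceI holomorphic_cesaro_op \<mu>) (auto intro: hardy_spaceD)
qed

section \<open>Compactness\<close>

text \<open>Point evaluations are bounded: the Poisson kernel is at most (1 + t) / (1 - t) \<le> 2 /
  (1 - t), and this constant serves as the weight in Jensen's inequality.\<close>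

lemma norm_le_hardy_mean:
  assumes f: "f holomorphic_on ball 0 1" and \<rho>: "0 \<le> \<rho>" "\<rho> < 1" and t: "0 \<le> t" "t < 1" and p: "1 \<le> p"
  shows "cmod (f (of_real t * (of_real \<rho> * cis \<theta>))) \<le> 2 / (1 - t) * hardy_mean p f \<rho>"
proof -
  let ?u = "\<lambda>\<phi>. cmod (f (of_real \<rho> * cis \<phi>))" and ?c = "2 / (1 - t)"
  let ?S = "2 * pi * cmod (f (of_real t * (of_real \<rho> * cis \<theta>)))"
  define h where "h = hardy_mean p f \<rho>"
  define B where "B = ?c * (2 * pi)"
  have B: "0 < B" using t by (simp add: B_def)
  have h: "0 \<le> h" by (simp add: h_def hardy_mean_nonneg)
  have um [measurable]: "?u \<in> borel_measurable circ"
    by (intro measurable_circI borel_measurable_continuous_onI continuous_on_circle_norm f \<rho>)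
  have P: "poisson t \<theta> \<phi> \<le> ?c" for \<phi>
  proof -
    have "poisson t \<theta> \<phi> \<le> (1 - t\<^sup>2) / (1 - t)\<^sup>2"
      unfolding poisson_def using t cis_minus_ge[of t \<phi> \<theta>]
      by (intro divide_left_mono power_mono mult_pos_pos) (auto simp: power_le_one)
    also have "1 - t\<^sup>2 = (1 + t) * (1 - t)" by (simp add: power2_eq_square algebra_simps)
    also have "(1 + t) * (1 - t) / (1 - t)\<^sup>2 = (1 + t) / (1 - t)"
      using t by (simp add: power2_eq_square)
    also have "\<dots> \<le> ?c" using t by (intro divide_right_mono) auto
    finally show ?thesis .
  qed
  have "ennreal (?S powr p) \<le> ennreal (B powr (p - 1)) * (\<integral>\<^sup>+\<phi>. ennreal (?c * ?u \<phi> powr p) \<partial>circ)"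
  proof (rule nn_integral_weighted_Jensen)
    show "ennreal ?S \<le> (\<integral>\<^sup>+\<phi>. ennreal (?c * ?u \<phi>) \<partial>circ)"
      using norm_le_poisson_dilation[OF f \<rho> t, of \<theta>] P
      by (elim order_trans) (intro nn_integral_mono ennreal_leI mult_right_mono, auto)
    show "(\<integral>\<^sup>+\<phi>. ennreal ?c \<partial>circ) \<le> ennreal B"
      using t by (simp add: B_def circ_def emeasure_restrict_space space_restrict_space flip: ennreal_mult')
  qed (use t p B in auto)
  also have "(\<integral>\<^sup>+\<phi>. ennreal (?c * ?u \<phi> powr p) \<partial>circ) = (\<integral>\<^sup>+\<phi>. ennreal ?c * ennreal (?u \<phi> powr p) \<partial>circ)"
    using t by (intro nn_integral_cong ennreal_mult') auto
  also have "\<dots> = ennreal ?c * ennreal (2 * pi * h powr p)"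
    using p by (subst nn_integral_cmult) (auto simp: nn_integral_circle_powr[OF f \<rho>] h_def)
  also have "ennreal (B powr (p - 1)) * (ennreal ?c * ennreal (2 * pi * h powr p)) = ennreal ((B powr (p - 1) * B) * h powr p)"
    using t by (simp add: B_def mult_ac flip: ennreal_mult' ennreal_mult'')
  also have "B powr (p - 1) * B = B powr p"
    using B powr_add[of B "p - 1" 1] by simp
  also have "B powr p * h powr p = (B * h) powr p"
    using B h by (simp add: powr_mult)
  finally have "?S powr p \<le> (B * h) powr p"
    by (subst (asm) ennreal_le_iff) auto
  moreover have "0 \<le> ?S" "0 \<le> B * h" using B h by auto
  ultimately have "?S \<le> B * h"
    using p by (metis powr_less_mono2 not_le order_less_le_trans zero_less_one)
  then have "2 * pi * cmod (f (of_real t * (of_real \<rho> * cis \<theta>))) \<le> 2 * pi * (?c * h)"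
    by (simp add: B_def mult_ac)
  then show ?thesis
    unfolding h_def by (rule mult_left_le_imp_le) simp
qed

lemma compact_subset_unit_ball:
  assumes "compact (T :: complex set)" "T \<subseteq> ball 0 1"
  obtains R where "0 \<le> R" "R < 1" "T \<subseteq> cball 0 R"
proof (cases "T = {}")
  case False
  obtain x where "x \<in> T" "\<forall>y\<in>T. cmod y \<le> cmod x"
    using continuous_attains_sup[OF assms(1) False, of cmod] by (auto intro: continuous_intros)
  then show ?thesis using assms by (intro that[of "cmod x"]) auto
qed (use that[of 0] in auto)

lemma hardy_norm_nonneg: "f \<in> hardy_space p \<Longrightarrow> 0 \<le> hardy_norm p f"
  by (rule order_trans[OF hardy_mean_nonneg hardy_spaceD(2)[of f p 0]]) auto

lemma hardy_norm_locally_bounded: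
  assumes f: "f \<in> hardy_space p" and K: "hardy_norm p f \<le> K" and p: "1 \<le> p" and R: "0 \<le> R" "R < 1" and z: "cmod z \<le> R"
  shows "cmod (f z) \<le> 2 / (1 - R / ((1 + R) / 2)) * K"
proof -
  \<comment> \<open>The circle halfway between R and 1: relative to it, a point of modulus at most R
    has radius t \<le> R / \<rho> < 1, away from 1.\<close>
  define \<rho> where "\<rho> = (1 + R) / 2"
  have \<rho>: "0 < \<rho>" "\<rho> < 1" "R < \<rho>" using R by (auto simp: \<rho>_def)
  define t where "t = cmod z / \<rho>"
  have t: "0 \<le> t" "t \<le> R / \<rho>" "R / \<rho> < 1" using \<rho> z by (auto simp: t_def divide_right_mono)
  have z: "z = of_real t * (of_real \<rho> * cis (Arg z))"
    using \<rho> rcis_cmod_Arg[of z] by (simp add: t_def rcis_def)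
  have t1: "t < 1" using t by linarith
  have "cmod (f z) \<le> 2 / (1 - t) * hardy_mean p f \<rho>"
    using norm_le_hardy_mean[OF hardy_spaceD(1)[OF f], of \<rho> t p "Arg z"] z \<rho> t t1 p by simp
  also have "\<dots> \<le> 2 / (1 - t) * K"
    using t1 \<rho> K hardy_spaceD(2)[OF f, of \<rho>] by (intro mult_left_mono) auto
  also have "\<dots> \<le> 2 / (1 - R / \<rho>) * K"
    using t t1 order_trans[OF hardy_norm_nonneg[OF f] K] by (intro mult_right_mono divide_left_mono mult_pos_pos) auto
  finally show ?thesis by (simp add: \<rho>_def)
qed

text \<open>The bound for point evaluations makes the sequence locally bounded, so Montel's theorem
  applies; Fatou's lemma on each circle passes the norm bound K to the limit.\<close>

lemma hardy_Montel:
  assumes F: "\<And>n. F n \<in> hardy_space p" and K: "\<And>n. hardy_norm p (F n) \<le> K" and p: "1 \<le> p"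
  obtains \<sigma> g where "strict_mono (\<sigma> :: nat \<Rightarrow> nat)" "g \<in> hardy_space p" "hardy_norm p g \<le> K"
    "\<And>R. 0 \<le> R \<Longrightarrow> R < 1 \<Longrightarrow> uniform_limit (cball 0 R) (\<lambda>n. F (\<sigma> n)) g sequentially"
proof -
  have hol: "F n holomorphic_on ball 0 1" for n using F hardy_spaceD(1) by blast
  have K0: "0 \<le> K"
    by (rule order_trans[OF hardy_norm_nonneg[OF F] K])
  obtain g \<sigma> where g: "g holomorphic_on ball 0 1" and \<sigma>: "strict_mono (\<sigma> :: nat \<Rightarrow> nat)"
    and lim: "\<And>x. x \<in> ball 0 1 \<Longrightarrow> (\<lambda>n. F (\<sigma> n) x) \<longlonglongrightarrow> g x"
    and unif: "\<And>T. \<lbrakk>compact T; T \<subseteq> ball 0 1\<rbrakk> \<Longrightarrow> uniform_limit T (F \<circ> \<sigma>) g sequentially"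
  proof (rule Montel[of "ball 0 1" "range F" F])
    fix T :: "complex set" assume "compact T" "T \<subseteq> ball 0 1"
    then obtain R where R: "0 \<le> R" "R < 1" "T \<subseteq> cball 0 R" by (rule compact_subset_unit_ball)
    show "\<exists>B. \<forall>h\<in>range F. \<forall>z\<in>T. norm (h z) \<le> B"
      using R hardy_norm_locally_bounded[OF F K p R(1,2)]
      by (intro exI[of _ "2 / (1 - R / ((1 + R) / 2)) * K"]) auto
  qed (use hol in auto)
  have mean: "hardy_mean p g \<rho> \<le> K" if \<rho>: "0 \<le> \<rho>" "\<rho> < 1" for \<rho>
  proof (rule hardy_mean_leI[OF g \<rho>])
    let ?u = "\<lambda>f \<theta>. ennreal (cmod (f (of_real \<rho> * cis \<theta>)) powr p)"
    have m: "?u (F n) \<in> borel_measurable circ" for n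
      using p by (intro measurable_circI measurable_compose[OF _ measurable_ennreal] borel_measurable_continuous_onI
        continuous_on_powr' continuous_on_circle_norm hol \<rho> continuous_intros) auto
    have l: "(\<lambda>n. ?u (F (\<sigma> n)) \<theta>) \<longlonglongrightarrow> ?u g \<theta>" for \<theta>
      using p \<rho> by (intro tendsto_ennrealI tendsto_powr' tendsto_norm lim tendsto_const) (auto simp: norm_mult)
    have "(\<integral>\<^sup>+\<theta>. ?u g \<theta> \<partial>circ) = (\<integral>\<^sup>+\<theta>. liminf (\<lambda>n. ?u (F (\<sigma> n)) \<theta>) \<partial>circ)"
      using l by (intro nn_integral_cong) (metis lim_imp_Liminf sequentially_bot)
    also have "\<dots> \<le> liminf (\<lambda>n. \<integral>\<^sup>+\<theta>. ?u (F (\<sigma> n)) \<theta> \<partial>circ)"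
      by (intro nn_integral_liminf m)
    also have "\<dots> \<le> liminf (\<lambda>n :: nat. ennreal (2 * pi * K powr p))"
    proof (rule Liminf_mono, rule always_eventually, rule allI)
      fix n
      have "hardy_mean p (F (\<sigma> n)) \<rho> \<le> K"
        by (rule order_trans[OF hardy_spaceD(2)[OF F \<rho>] K])
      then have "hardy_mean p (F (\<sigma> n)) \<rho> powr p \<le> K powr p"
        using p by (intro powr_mono2 hardy_mean_nonneg) auto
      then show "(\<integral>\<^sup>+\<theta>. ?u (F (\<sigma> n)) \<theta> \<partial>circ) \<le> ennreal (2 * pi * K powr p)"
        using p by (subst nn_integral_circle_powr[OF hol \<rho>]) (auto intro!: ennreal_leI)
    qed
    also have "\<dots> = ennreal (2 * pi * K powr p)"
      by (simp add: Liminf_const)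
    finally show "(\<integral>\<^sup>+\<theta>. ?u g \<theta> \<partial>circ) \<le> ennreal (2 * pi * K powr p)" .
  qed (use p K0 in auto)
  show ?thesis
  proof (rule that[OF \<sigma>])
    show "g \<in> hardy_space p" "hardy_norm p g \<le> K"
      using hardy_spaceI[OF g mean] by auto
    show "uniform_limit (cball 0 R) (\<lambda>n. F (\<sigma> n)) g sequentially" if "0 \<le> R" "R < 1" for R
      using unif[of "cball 0 R"] that by (simp add: o_def cball_subset_ball_iff)
  qed
qed

lemma hardy_mean_diff_le:
  assumes f: "f holomorphic_on ball 0 1" and g: "g holomorphic_on ball 0 1" and \<rho>: "0 \<le> \<rho>" "\<rho> < 1" and p: "1 \<le> p"
  shows "hardy_mean p (\<lambda>z. f z - g z) \<rho> \<le> 4 * (hardy_mean p f \<rho> + hardy_mean p g \<rho>)"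
proof (rule hardy_mean_leI'[where a = "\<lambda>\<theta>. cmod (f (of_real \<rho> * cis \<theta>))" and b = "\<lambda>\<theta>. cmod (g (of_real \<rho> * cis \<theta>))"])
  have p0: "0 < p" using p by simp
  show "(\<integral>\<^sup>+\<theta>. ennreal (cmod (f (of_real \<rho> * cis \<theta>)) powr p) \<partial>circ) \<le> ennreal (2 * pi * hardy_mean p f \<rho> powr p)"
    "(\<integral>\<^sup>+\<theta>. ennreal (cmod (g (of_real \<rho> * cis \<theta>)) powr p) \<partial>circ) \<le> ennreal (2 * pi * hardy_mean p g \<rho> powr p)"
    by (simp_all add: nn_integral_circle_powr[OF f \<rho> p0] nn_integral_circle_powr[OF g \<rho> p0])
  show "(\<lambda>\<theta>. cmod (f (of_real \<rho> * cis \<theta>))) \<in> borel_measurable circ"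
     "(\<lambda>\<theta>. cmod (g (of_real \<rho> * cis \<theta>))) \<in> borel_measurable circ"
    by (intro measurable_circI borel_measurable_continuous_onI continuous_on_circle_norm f g \<rho>)+
qed (use f g \<rho> p in \<open>auto simp: hardy_mean_nonneg norm_triangle_ineq4 intro!: holomorphic_intros\<close>)

text \<open>A density instead of a restricted space: the result is again a finite measure on [0,1),
  so the uniform circle bound applies to it.\<close>

definition outer_part :: "real measure \<Rightarrow> real \<Rightarrow> real measure" where
  "outer_part \<mu> R = density \<mu> (indicator {R..<1})"

lemma finite_borel_unit_outer_part:
  assumes \<mu>: "finite_borel_unit \<mu>" and R: "0 \<le> R"
  shows "finite_borel_unit (outer_part \<mu> R)"
proof -
  interpret finite_measure \<mu> using \<mu> by (simp add: finite_borel_unit_def)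
  show ?thesis
    using \<mu> finite_measure_restricted[OF sets_atLeastLessThan_1[OF \<mu> R]]
    by (simp add: finite_borel_unit_def outer_part_def)
qed

lemma measure_outer_part:
  assumes \<mu>: "finite_borel_unit \<mu>" and R: "0 \<le> R" "0 \<le> t"
  shows "measure (outer_part \<mu> R) {t..<1} = measure \<mu> {max R t..<1}"
proof -
  have "{R..<1} \<inter> {t..<1} = {max R t..<1}" by auto
  then show ?thesis
    unfolding outer_part_def by (simp add: measure_restricted sets_atLeastLessThan_1[OF \<mu>] R)
qed

text \<open>For t < R the integrand only sees values of f on the disc of radius R, and |1 - tz|
  \<ge> 1 - R. This part is therefore small wherever f is small on a compact disc, uniformly in
  z.\<close>

lemma cesaro_op_le_outer_part:
  assumes \<mu>: "finite_borel_unit \<mu>" and R: "0 \<le> R" "R < 1" and f: "f holomorphic_on ball 0 1"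
    and z: "cmod z < 1" and M: "\<And>w. cmod w \<le> R \<Longrightarrow> cmod (f w) \<le> M"
  shows "cmod (cesaro_op \<mu> f z) \<le> cmod (cesaro_op (outer_part \<mu> R) f z) + measure \<mu> (space \<mu>) * (M / (1 - R))"
proof -
  interpret finite_measure \<mu> using \<mu> by (simp add: finite_borel_unit_def)
  let ?g = "\<lambda>t. f (of_real t * z) / (1 - of_real t * z)"
  let ?i = "\<lambda>t. indicator {R..<1} t :: real"
  have S [measurable]: "{R..<1} \<in> sets \<mu>" using sets_atLeastLessThan_1[OF \<mu>] R by auto
  have I: "integrable \<mu> ?g" by (rule cesaro_op_integral(1)[OF \<mu> f z])
  have M0: "0 \<le> M" using order_trans[OF norm_ge_zero M[of 0]] R by simp
  have I1: "integrable \<mu> (\<lambda>t. ?i t *\<^sub>R ?g t)"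
    using I S by (rule integrable_mult_indicator[rotated])
  have I2: "integrable \<mu> (\<lambda>t. ?g t - ?i t *\<^sub>R ?g t)"
    by (intro Bochner_Integration.integrable_diff I I1)
  have "cesaro_op (outer_part \<mu> R) f z = (\<integral>t. ?g t \<partial>density \<mu> (\<lambda>t. ennreal (?i t)))"
    using cesaro_op_integral(2)[OF finite_borel_unit_outer_part[OF \<mu> R(1)] f z]
    by (simp add: outer_part_def ennreal_indicator)
  also have "\<dots> = (\<integral>t. ?i t *\<^sub>R ?g t \<partial>\<mu>)"
    using I by (intro integral_density) auto
  finally have "cesaro_op \<mu> f z = cesaro_op (outer_part \<mu> R) f z + (\<integral>t. ?g t - ?i t *\<^sub>R ?g t \<partial>\<mu>)"
    using I I1 by (simp add: cesaro_op_integral(2)[OF \<mu> f z])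
  then have "cmod (cesaro_op \<mu> f z) \<le> cmod (cesaro_op (outer_part \<mu> R) f z) + cmod (\<integral>t. ?g t - ?i t *\<^sub>R ?g t \<partial>\<mu>)"
    by (simp add: norm_triangle_ineq)
  also have "cmod (\<integral>t. ?g t - ?i t *\<^sub>R ?g t \<partial>\<mu>) \<le> (\<integral>t. cmod (?g t - ?i t *\<^sub>R ?g t) \<partial>\<mu>)"
    by (rule integral_norm_bound)
  also have "\<dots> \<le> (\<integral>t. M / (1 - R) \<partial>\<mu>)"
  proof (intro integral_mono integrable_norm I2)
    fix t assume "t \<in> space \<mu>"
    then have t: "0 \<le> t" "t < 1" using \<mu> by (auto simp: space_finite_borel_unit)
    show "cmod (?g t - ?i t *\<^sub>R ?g t) \<le> M / (1 - R)"
    proof (cases "R \<le> t")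
      case True
      then show ?thesis using t R M0 by simp
    next
      case False
      have tz: "cmod (of_real t * z) \<le> t * 1"
        unfolding norm_mult using t z by (intro mult_mono) auto
      have "1 - t \<le> cmod (1 - of_real t * z)"
        using norm_triangle_ineq2[of 1 "of_real t * z"] tz by simp
      then have "cmod (f (of_real t * z)) / cmod (1 - of_real t * z) \<le> M / (1 - R)"
        using M[of "of_real t * z"] tz False R M0 by (intro frac_le) auto
      then show ?thesis using False by (simp add: norm_divide)
    qed
  qed auto
  finally show ?thesis by simp
qed

text \<open>Dominated convergence with the tail of \<mu> itself as majorant. At fixed t the tail of
  the outer part is at most \<mu>[R n,1) / (1 - t), which vanishes because the intervals decrease to
  the empty set.\<close>

lemma tail_outer_part_tendsto_0:
  assumes \<mu>: "finite_borel_unit \<mu>" and r: "0 < r"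
    and fin: "(\<integral>\<^sup>+t. ennreal (tail \<mu> t powr r) \<partial>unit_len) < \<infinity>"
  defines "R \<equiv> \<lambda>n. 1 - 1 / (real n + 1)"
  shows "(\<lambda>n. measure (outer_part \<mu> (R n)) (space (outer_part \<mu> (R n)))) \<longlonglongrightarrow> 0"
    and "(\<lambda>n. \<integral>\<^sup>+t. ennreal (tail (outer_part \<mu> (R n)) t powr r) \<partial>unit_len) \<longlonglongrightarrow> 0"
proof -
  interpret finite_measure \<mu> using \<mu> by (simp add: finite_borel_unit_def)
  have R: "0 \<le> R n" "R n < 1" for n by (auto simp: R_def field_simps)
  have fb: "finite_borel_unit (outer_part \<mu> (R n))" for n
    by (intro finite_borel_unit_outer_part \<mu> R)
  have mlim: "(\<lambda>n. measure \<mu> {R n..<1}) \<longlonglongrightarrow> measure \<mu> (\<Inter>n. {R n..<1})"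
  proof (rule finite_Lim_measure_decseq)
    show "range (\<lambda>n. {R n..<1}) \<subseteq> sets \<mu>" using sets_atLeastLessThan_1[OF \<mu> R(1)] by auto
    have "R m \<le> R n" if "m \<le> n" for m n
      using that unfolding R_def by (intro diff_left_mono divide_left_mono) auto
    then show "decseq (\<lambda>n. {R n..<1})"
      by (auto simp: decseq_def intro: order_trans)
  qed
  have "(\<Inter>n. {R n..<1}) = {}"
  proof (rule ccontr)
    assume "(\<Inter>n. {R n..<1}) \<noteq> {}"
    then obtain x where "x \<in> (\<Inter>n. {R n..<1})" by blast
    then have x: "x < 1" "\<And>n. R n \<le> x" by auto
    obtain n where n: "inverse (real (Suc n)) < 1 - x" using reals_Archimedean[of "1 - x"] x by auto
    then show False using x(2)[of n] by (simp add: R_def inverse_eq_divide add.commute)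
  qed
  with mlim have mlim: "(\<lambda>n. measure \<mu> {R n..<1}) \<longlonglongrightarrow> 0" by simp
  have "measure (outer_part \<mu> (R n)) (space (outer_part \<mu> (R n))) = measure \<mu> {R n..<1}" for n
    using measure_outer_part[OF \<mu> R(1), of 0 n] R[of n] by (simp add: space_finite_borel_unit[OF fb])
  then show "(\<lambda>n. measure (outer_part \<mu> (R n)) (space (outer_part \<mu> (R n)))) \<longlonglongrightarrow> 0"
    using mlim by simp
  have le: "measure (outer_part \<mu> (R n)) {t..<1} \<le> measure \<mu> {t..<1}"
    "measure (outer_part \<mu> (R n)) {t..<1} \<le> measure \<mu> {R n..<1}" if "0 \<le> t" for t n
    using that R by (auto simp: measure_outer_part[OF \<mu>] intro!: antimono_tail_measure[OF \<mu>])
  have "(\<lambda>n. \<integral>\<^sup>+t. ennreal (tail (outer_part \<mu> (R n)) t powr r) \<partial>unit_len) \<longlonglongrightarrow> (\<integral>\<^sup>+t. 0 \<partial>unit_len)"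
  proof (rule nn_integral_dominated_convergence[where w = "\<lambda>t. ennreal (tail \<mu> t powr r)"])
    note [measurable] = measurable_tail[OF \<mu>] measurable_tail[OF fb]
    show "(\<lambda>t. ennreal (tail (outer_part \<mu> (R n)) t powr r)) \<in> borel_measurable unit_len" for n by measurable
    show "(\<lambda>t. ennreal (tail \<mu> t powr r)) \<in> borel_measurable unit_len" by measurable
    show "AE t in unit_len. ennreal (tail (outer_part \<mu> (R n)) t powr r) \<le> ennreal (tail \<mu> t powr r)" for n
      using r le(1) by (intro AE_I2 ennreal_leI powr_mono2) (auto simp: tail_def divide_right_mono)
    show "AE t in unit_len. (\<lambda>n. ennreal (tail (outer_part \<mu> (R n)) t powr r)) \<longlonglongrightarrow> 0"
    proof (intro AE_I2)
      fix t assume "t \<in> space unit_len"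
      then have t: "0 \<le> t" "t < 1" by auto
      have "(\<lambda>n. measure (outer_part \<mu> (R n)) {t..<1}) \<longlonglongrightarrow> 0"
        by (rule real_tendsto_sandwich[OF _ _ tendsto_const mlim]) (use le(2) t in auto)
      then have "(\<lambda>n. tail (outer_part \<mu> (R n)) t powr r) \<longlonglongrightarrow> 0"
        unfolding tail_def using t r
        by (intro tendsto_zero_powrI tendsto_const) (auto intro!: tendsto_eq_intros)
      then show "(\<lambda>n. ennreal (tail (outer_part \<mu> (R n)) t powr r)) \<longlonglongrightarrow> 0"
        using tendsto_ennrealI by fastforce
    qed
  qed (use fin in auto)
  then show "(\<lambda>n. \<integral>\<^sup>+t. ennreal (tail (outer_part \<mu> (R n)) t powr r) \<partial>unit_len) \<longlonglongrightarrow> 0"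
    by simp
qed

lemma tail_condition_imp_compact:
  assumes q: "1 \<le> q" "q < p" and r: "r = p * q / (p - q)" and s: "s = 1 - 1 / r"
    and \<mu>: "finite_borel_unit \<mu>" and tc: "tail_condition r s \<mu>"
  shows "hardy_compact p q (cesaro_op \<mu>)"
proof -
  have r1: "1 < r" by (rule conjugate_gt_1[OF q r])
  have p: "1 \<le> p" using q by simp
  have bd: "cesaro_op \<mu> f \<in> hardy_space q" if "f \<in> hardy_space p" for f
    using tail_condition_imp_bounded[OF assms] that by (auto simp: hardy_bounded_def)
  have fin: "(\<integral>\<^sup>+t. ennreal (tail \<mu> t powr r) \<partial>unit_len) < \<infinity>"
    using tc tail_condition_iff[OF r1 s] by simp
  obtain C where C: "C \<ge> 0" "\<And>\<mu> A f \<rho>. finite_borel_unit \<mu> \<Longrightarrow> 0 \<le> A \<Longrightarrow>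
    (\<integral>\<^sup>+t. ennreal (tail \<mu> t powr r) \<partial>unit_len) \<le> ennreal A \<Longrightarrow> f holomorphic_on ball 0 1 \<Longrightarrow> 0 \<le> \<rho> \<Longrightarrow> \<rho> < 1 \<Longrightarrow>
    hardy_mean q (cesaro_op \<mu> f) \<rho> \<le> C * (A + measure \<mu> (space \<mu>) powr r) powr (1 / r) * hardy_mean p f \<rho>"
    using cesaro_op_circle_bound[OF q r] by metis
  define R where "R n = 1 - 1 / (real n + 1)" for n
  have R: "0 \<le> R n" "R n < 1" for n by (auto simp: R_def field_simps)
  define \<nu> where "\<nu> n = outer_part \<mu> (R n)" for n
  have \<nu>: "finite_borel_unit (\<nu> n)" for n unfolding \<nu>_def by (intro finite_borel_unit_outer_part \<mu> R)
  define A where "A n = (\<integral>\<^sup>+t. ennreal (tail (\<nu> n) t powr r) \<partial>unit_len)" for n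
  define m where "m = measure \<mu> (space \<mu>)"
  have m0: "0 \<le> m" by (simp add: m_def)
  \<comment> \<open>The operator bound that \<open>cesaro_op_circle_bound\<close> gives for the n-th
    outer part.\<close>
  define \<epsilon> where "\<epsilon> n = C * (enn2real (A n) + measure (\<nu> n) (space (\<nu> n)) powr r) powr (1 / r)" for n
  have \<epsilon>0: "0 \<le> \<epsilon> n" for n using C by (simp add: \<epsilon>_def)
  have Alim: "A \<longlonglongrightarrow> 0" and mlim: "(\<lambda>n. measure (\<nu> n) (space (\<nu> n))) \<longlonglongrightarrow> 0"
    using tail_outer_part_tendsto_0[OF \<mu> _ fin] r1 unfolding A_def \<nu>_def R_def by auto
  have \<epsilon>lim: "\<epsilon> \<longlonglongrightarrow> 0"
  proof -
    have "(\<lambda>n. enn2real (A n)) \<longlonglongrightarrow> 0" using Alim by (intro tendsto_enn2real) auto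
    moreover have "(\<lambda>n. measure (\<nu> n) (space (\<nu> n)) powr r) \<longlonglongrightarrow> 0"
      using r1 by (intro tendsto_zero_powrI mlim tendsto_const) auto
    ultimately have "(\<lambda>n. enn2real (A n) + measure (\<nu> n) (space (\<nu> n)) powr r) \<longlonglongrightarrow> 0"
      using tendsto_add by fastforce
    then have "(\<lambda>n. (enn2real (A n) + measure (\<nu> n) (space (\<nu> n)) powr r) powr (1 / r)) \<longlonglongrightarrow> 0"
      using r1 by (intro tendsto_zero_powrI tendsto_const) auto
    then show ?thesis
      unfolding \<epsilon>_def using tendsto_mult_right_zero by blast
  qed
  have "\<exists>\<sigma> :: nat \<Rightarrow> nat. \<exists>g\<in>hardy_space q. strict_mono \<sigma> \<and>
           (\<lambda>n. hardy_norm q (\<lambda>z. cesaro_op \<mu> (F (\<sigma> n)) z - g z)) \<longlonglongrightarrow> 0"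
    if F: "\<And>n. F n \<in> hardy_space p" and K: "\<And>n. hardy_norm p (F n) \<le> K" for F :: "nat \<Rightarrow> complex \<Rightarrow> complex" and K
  proof -
    have K0: "0 \<le> K"
      by (rule order_trans[OF hardy_norm_nonneg[OF F] K])
    obtain \<sigma> g where \<sigma>: "strict_mono (\<sigma> :: nat \<Rightarrow> nat)" and g: "g \<in> hardy_space p" "hardy_norm p g \<le> K"
      and unif: "\<And>R. 0 \<le> R \<Longrightarrow> R < 1 \<Longrightarrow> uniform_limit (cball 0 R) (\<lambda>n. F (\<sigma> n)) g sequentially"
      by (rule hardy_Montel[where F = F, OF F K p]) (rule that)
    define f where "f n z = F (\<sigma> n) z - g z" for n z
    have f: "f n holomorphic_on ball 0 1" for n
      unfolding f_def by (intro holomorphic_intros hardy_spaceD(1)[OF F] hardy_spaceD(1)[OF g(1)])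
    \<comment> \<open>8 K is 4 (K + K), from the crude triangle inequality.\<close>
    have fK: "hardy_mean p (f n) \<rho> \<le> 8 * K" if \<rho>: "0 \<le> \<rho>" "\<rho> < 1" for n \<rho>
    proof -
      have "hardy_mean p (F (\<sigma> n)) \<rho> \<le> K" "hardy_mean p g \<rho> \<le> K"
        by (rule order_trans[OF hardy_spaceD(2)[OF F \<rho>] K], rule order_trans[OF hardy_spaceD(2)[OF g(1) \<rho>] g(2)])
      then show ?thesis
        using hardy_mean_diff_le[OF hardy_spaceD(1)[OF F] hardy_spaceD(1)[OF g(1)] \<rho> p, of "\<sigma> n"]
        by (simp add: f_def[abs_def])
    qed
    define D where "D n z = cesaro_op \<mu> (F (\<sigma> n)) z - cesaro_op \<mu> g z" for n z
    have D: "D n z = cesaro_op \<mu> (f n) z" if "cmod z < 1" for n z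
      unfolding D_def f_def using that
      by (intro cesaro_op_diff[symmetric] \<mu> hardy_spaceD(1)[OF F] hardy_spaceD(1)[OF g(1)])
    have Dhol: "D n holomorphic_on ball 0 1" for n
      unfolding D_def by (intro holomorphic_intros hardy_spaceD(1)[OF bd] F g)
    \<comment> \<open>The outer part contributes a small operator bound times the bounded norm of f
      n, the rest the small values of f n on the disc of radius R k. Hence k is fixed first and n is
      taken large afterwards.\<close>
    have main: "hardy_mean q (D n) \<rho> \<le> 4 * (\<epsilon> k * (8 * K) + m * (M / (1 - R k)))"
      if \<rho>: "0 \<le> \<rho>" "\<rho> < 1" and M: "0 \<le> M" "\<And>w. cmod w \<le> R k \<Longrightarrow> cmod (f n w) \<le> M" and fk: "A k < \<infinity>" for n k M \<rho>
    proof (rule hardy_mean_leI'[where a = "\<lambda>\<theta>. cmod (cesaro_op (\<nu> k) (f n) (of_real \<rho> * cis \<theta>))" and b = "\<lambda>_. m * (M / (1 - R k))"])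
      have h: "cesaro_op (\<nu> k) (f n) holomorphic_on ball 0 1"
        by (intro holomorphic_cesaro_op \<nu> f)
      have "hardy_mean q (cesaro_op (\<nu> k) (f n)) \<rho> \<le> \<epsilon> k * hardy_mean p (f n) \<rho>"
        unfolding \<epsilon>_def using fk by (intro C(2) \<nu> f \<rho>) (auto simp: A_def)
      also have "\<dots> \<le> \<epsilon> k * (8 * K)"
        using \<epsilon>0 by (intro mult_left_mono fK \<rho>) auto
      finally have "hardy_mean q (cesaro_op (\<nu> k) (f n)) \<rho> powr q \<le> (\<epsilon> k * (8 * K)) powr q"
        using q by (intro powr_mono2 hardy_mean_nonneg) auto
      then show "(\<integral>\<^sup>+\<theta>. ennreal (cmod (cesaro_op (\<nu> k) (f n) (of_real \<rho> * cis \<theta>)) powr q) \<partial>circ) \<le> ennreal (2 * pi * (\<epsilon> k * (8 * K)) powr q)"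
        using q by (subst nn_integral_circle_powr[OF h \<rho>]) (auto intro!: ennreal_leI)
      show "(\<lambda>\<theta>. cmod (cesaro_op (\<nu> k) (f n) (of_real \<rho> * cis \<theta>))) \<in> borel_measurable circ"
        by (intro measurable_circI borel_measurable_continuous_onI continuous_on_circle_norm h \<rho>)
      show "(\<integral>\<^sup>+\<theta>. ennreal ((m * (M / (1 - R k))) powr q) \<partial>circ) \<le> ennreal (2 * pi * (m * (M / (1 - R k))) powr q)"
        by (simp add: circ_def emeasure_restrict_space space_restrict_space mult.commute flip: ennreal_mult')
      fix \<theta>
      have z: "cmod (of_real \<rho> * cis \<theta>) < 1" using \<rho> by (simp add: norm_mult)
      show "cmod (D n (of_real \<rho> * cis \<theta>)) \<le> cmod (cesaro_op (\<nu> k) (f n) (of_real \<rho> * cis \<theta>)) + m * (M / (1 - R k))"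
        unfolding D[OF z] \<nu>_def m_def by (intro cesaro_op_le_outer_part \<mu> R f z M)
    qed (use Dhol \<rho> q \<epsilon>0 K0 m0 M R[of k] in auto)
    have "(\<lambda>n. hardy_norm q (D n)) \<longlonglongrightarrow> 0"
    proof (rule LIMSEQ_I)
      fix e :: real assume e: "0 < e"
      have "(\<lambda>k. \<epsilon> k * (8 * K)) \<longlonglongrightarrow> 0" using \<epsilon>lim tendsto_mult_left_zero by blast
      then have "\<forall>\<^sub>F k in sequentially. \<epsilon> k * (8 * K) < e / 16"
        using e by (intro order_tendstoD) auto
      \<comment> \<open>Since \<open>enn2real\<close> sends \<infinity> to 0, the bound by
        \<epsilon> k is used only where A k is finite.\<close>
      moreover have "\<forall>\<^sub>F k in sequentially. A k < \<infinity>"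
        using Alim by (intro order_tendstoD) auto
      ultimately have "\<forall>\<^sub>F k in sequentially. \<epsilon> k * (8 * K) < e / 16 \<and> A k < \<infinity>"
        by eventually_elim auto
      then obtain k where k: "\<epsilon> k * (8 * K) < e / 16" "A k < \<infinity>"
        by (auto simp: eventually_sequentially)
      \<comment> \<open>Chosen so that m M / (1 - R k) \<le> e / 16; the divisor m + 1 stays
        positive for the zero measure. Altogether 4 (e / 16 + e / 16) = e / 2.\<close>
      define M where "M = e / 16 * (1 - R k) / (m + 1)"
      have M: "0 < M" using e R[of k] m0 by (simp add: M_def)
      have "m * (M / (1 - R k)) = e / 16 * (m / (m + 1))"
        using R[of k] m0 by (simp add: M_def)
      also have "\<dots> \<le> e / 16 * 1"
        using e m0 by (intro mult_left_mono) auto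
      finally have M': "m * (M / (1 - R k)) \<le> e / 16" by simp
      have "\<forall>\<^sub>F n in sequentially. \<forall>w\<in>cball 0 (R k). dist (F (\<sigma> n) w) (g w) < M"
        using unif[OF R, of k] M by (rule uniform_limitD)
      then obtain N where "\<forall>n\<ge>N. \<forall>w\<in>cball 0 (R k). cmod (f n w) < M"
        by (auto simp: eventually_sequentially f_def dist_norm)
      then have N: "cmod (f n w) < M" if "N \<le> n" "cmod w \<le> R k" for n w
        using that by simp
      have "norm (hardy_norm q (D n) - 0) < e" if "N \<le> n" for n
      proof -
        have le: "hardy_mean q (D n) \<rho> \<le> e / 2" if "0 \<le> \<rho>" "\<rho> < 1" for \<rho>
        proof -
          have "hardy_mean q (D n) \<rho> \<le> 4 * (\<epsilon> k * (8 * K) + m * (M / (1 - R k)))"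
            by (rule main[OF that less_imp_le[OF M] less_imp_le[OF N[OF \<open>N \<le> n\<close>]] k(2)])
          also have "\<dots> \<le> 4 * (e / 16 + e / 16)"
            using k(1) M' by (intro mult_left_mono add_mono) auto
          finally show ?thesis by simp
        qed
        then have "hardy_norm q (D n) \<le> e / 2"
          by (rule hardy_spaceI(2)[OF Dhol])
        moreover have "0 \<le> hardy_norm q (D n)"
          by (rule hardy_norm_nonneg[OF hardy_spaceI(1)[OF Dhol le]])
        ultimately show ?thesis using e by simp
      qed
      then show "\<exists>N. \<forall>n\<ge>N. norm (hardy_norm q (D n) - 0) < e" by blast
    qed
    then show ?thesis
      using \<sigma> bd[OF g(1)] unfolding D_def by blast
  qed
  then show ?thesis
    unfolding hardy_compact_def using bd by blast
qed

section \<open>Stieltjes-type test functions\<close>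

text \<open>A Fejer-Riesz type inequality. Let G0 = G - G 0. Integrating the derivative of (pi -
  \<theta>) G0(\<rho> e^(i\<theta>)) over a full turn, both boundary terms equal -pi G0(\<rho>),
  while the term with the undifferentiated G0 vanishes by the mean value property. What remains is H
  times a factor of modulus at most pi.\<close>

lemma norm_primitive_le:
  assumes G: "\<And>z. z \<in> ball 0 1 \<Longrightarrow> (G has_field_derivative H z) (at z)"
    and H: "H holomorphic_on ball 0 1" and \<rho>: "0 \<le> \<rho>" "\<rho> < 1"
  shows "cmod (G (of_real \<rho>) - G 0) \<le> (1 / 2) * integral {0..2 * pi} (\<lambda>\<theta>. cmod (H (of_real \<rho> * cis \<theta>)))"
proof -
  let ?z = "\<lambda>\<theta>. of_real \<rho> * cis \<theta>"
  define G0 where "G0 z = G z - G 0" for z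
  have z: "?z \<theta> \<in> ball 0 1" for \<theta> using \<rho> by (simp add: norm_mult)
  have G0: "(G0 has_field_derivative H z) (at z)" if "z \<in> ball 0 1" for z
    unfolding G0_def using G[OF that] by (auto intro!: derivative_eq_intros)
  have G0hol: "G0 holomorphic_on ball 0 1"
    unfolding holomorphic_on_open[OF open_ball] using G0 by blast
  define R where "R = (if \<rho> = 0 then 2 else 1 / \<rho>)"
  have R: "1 < R" using \<rho> by (auto simp: R_def)
  have "(\<lambda>w. complex_of_real \<rho> * w) ` ball 0 R \<subseteq> ball 0 1"
    using \<rho> by (auto simp: R_def norm_mult field_simps split: if_splits)
  then have "(\<lambda>w. G0 (of_real \<rho> * w)) holomorphic_on ball 0 R"
    by (intro holomorphic_on_compose_gen[OF _ G0hol, unfolded o_def] holomorphic_intros) auto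
  from poisson_formula[OF this R, of 0 0] have mv: "((\<lambda>\<theta>. G0 (?z \<theta>)) has_integral 0) {0..2 * pi}"
    by (simp add: poisson_def G0_def)
  define \<Psi> where "\<Psi> \<theta> = of_real (pi - \<theta>) * (of_real \<rho> * (\<i> * cis \<theta>) * H (?z \<theta>))" for \<theta>
  define \<Phi>' where "\<Phi>' \<theta> = \<Psi> \<theta> + of_real (-1) * G0 (?z \<theta>)" for \<theta>
  have "((\<lambda>\<theta>. of_real (pi - \<theta>) * G0 (?z \<theta>)) has_vector_derivative \<Phi>' \<theta>) (at \<theta> within {0..2 * pi})" for \<theta>
  proof -
    have c: "(cis has_vector_derivative \<i> * cis \<theta>) (at \<theta>)"
    proof -
      have "((\<lambda>x. exp (\<i> * of_real x)) has_vector_derivative \<i> * exp (\<i> * of_real \<theta>)) (at \<theta>)"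
        by (rule has_vector_derivative_real_field) (auto intro!: derivative_eq_intros)
      then show ?thesis by (simp add: cis_conv_exp[abs_def])
    qed
    have "(?z has_vector_derivative of_real \<rho> * (\<i> * cis \<theta>)) (at \<theta>)"
      by (intro has_vector_derivative_mult_right c)
    from field_vector_diff_chain_at[OF this G0[OF z]]
    have 1: "((\<lambda>\<theta>. G0 (?z \<theta>)) has_vector_derivative of_real \<rho> * (\<i> * cis \<theta>) * H (?z \<theta>)) (at \<theta>)"
      by (simp add: o_def)
    have 2: "((\<lambda>\<theta>. complex_of_real (pi - \<theta>)) has_vector_derivative of_real (-1)) (at \<theta>)"
      by (intro has_vector_derivative_of_real) (auto intro!: derivative_eq_intros)
    from has_vector_derivative_mult[OF 2 1] show ?thesis
      unfolding \<Phi>'_def \<Psi>_def by (rule has_vector_derivative_at_within)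
  qed
  then have "(\<Phi>' has_integral of_real (pi - 2 * pi) * G0 (?z (2 * pi)) - of_real (pi - 0) * G0 (?z 0)) {0..2 * pi}"
    by (intro fundamental_theorem_of_calculus) auto
  moreover have "of_real (pi - 2 * pi) * G0 (?z (2 * pi)) - of_real (pi - 0) * G0 (?z 0) = - (2 * pi * G0 (of_real \<rho>))"
    by simp
  ultimately have "(\<Phi>' has_integral - (2 * pi * G0 (of_real \<rho>))) {0..2 * pi}"
    by (simp only:)
  from has_integral_add[OF this mv] have I: "(\<Psi> has_integral - (2 * pi * G0 (of_real \<rho>))) {0..2 * pi}"
    by (simp add: \<Phi>'_def)
  have c: "continuous_on {0..2 * pi} (\<lambda>\<theta>. pi * cmod (H (?z \<theta>)))"
    by (intro continuous_intros continuous_on_circle_norm H \<rho>)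
  have "cmod (integral {0..2 * pi} \<Psi>)
     \<le> integral {0..2 * pi} (\<lambda>\<theta>. pi * cmod (H (?z \<theta>)))"
  proof (rule integral_norm_bound_integral[OF has_integral_integrable[OF I] integrable_continuous_interval[OF c]])
    fix \<theta> assume "\<theta> \<in> {0..2 * pi}"
    then have "\<bar>pi - \<theta>\<bar> * (cmod (H (?z \<theta>)) * \<rho>) \<le> pi * (cmod (H (?z \<theta>)) * 1)"
      using \<rho> by (intro mult_mono mult_left_mono) auto
    moreover have "cmod (\<Psi> \<theta>) = \<bar>pi - \<theta>\<bar> * (cmod (H (?z \<theta>)) * \<rho>)"
      using \<rho> unfolding \<Psi>_def norm_mult norm_of_real by simp
    ultimately show "cmod (\<Psi> \<theta>) \<le> pi * cmod (H (?z \<theta>))" by simp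
  qed
  then have "2 * pi * cmod (G0 (of_real \<rho>)) \<le> pi * integral {0..2 * pi} (\<lambda>\<theta>. cmod (H (?z \<theta>)))"
    unfolding integral_unique[OF I] by (simp add: norm_mult)
  then show ?thesis by (simp add: G0_def)
qed

text \<open>Where H is real and nonnegative on the radius, its radial L^1 norm is the increment of a
  primitive.\<close>

lemma radial_integral_le:
  assumes H: "H holomorphic_on ball 0 1" and \<rho>: "0 \<le> \<rho>" "\<rho> < 1"
    and k: "\<And>x. 0 \<le> x \<Longrightarrow> x < 1 \<Longrightarrow> H (of_real x) = of_real (k x)" "\<And>x. 0 \<le> x \<Longrightarrow> x < 1 \<Longrightarrow> 0 \<le> k x"
  shows "(\<integral>\<^sup>+x. ennreal (k x) * indicator {0..\<rho>} x \<partial>lborel) \<le> ennreal (1 / 2) * (\<integral>\<^sup>+\<theta>. ennreal (cmod (H (of_real \<rho> * cis \<theta>))) \<partial>circ)"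
proof -
  obtain G where G: "\<And>z. z \<in> ball 0 1 \<Longrightarrow> (G has_field_derivative H z) (at z)"
    by (rule holomorphic_convex_primitive'[OF convex_ball open_ball H]) (metis at_within_open open_ball)
  have "((\<lambda>x. G (of_real x)) has_vector_derivative of_real (k x)) (at x within {0..\<rho>})" if "x \<in> {0..\<rho>}" for x
  proof -
    have "(G has_field_derivative of_real (k x)) (at (of_real x))"
      using G[of "of_real x"] that \<rho> k by auto
    then show ?thesis
      by (rule has_vector_derivative_at_within[OF has_vector_derivative_real_field])
  qed
  then have "((\<lambda>x. complex_of_real (k x)) has_integral G (of_real \<rho>) - G (of_real 0)) {0..\<rho>}"
    using \<rho> by (intro fundamental_theorem_of_calculus) auto
  from has_integral_linear[OF this bounded_linear_Re]
  have "(k has_integral Re (G (of_real \<rho>) - G 0)) {0..\<rho>}"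
    by (simp add: o_def)
  then have "(\<integral>\<^sup>+x. ennreal (k x) * indicator {0..\<rho>} x \<partial>lborel) = ennreal (Re (G (of_real \<rho>) - G 0))"
    using \<rho> k by (intro nn_integral_has_integral_lebesgue') auto
  also have "\<dots> \<le> ennreal ((1 / 2) * integral {0..2 * pi} (\<lambda>\<theta>. cmod (H (of_real \<rho> * cis \<theta>))))"
    using norm_primitive_le[OF G H \<rho>] by (intro ennreal_leI order_trans[OF complex_Re_le_cmod])
  also have "\<dots> = ennreal (1 / 2) * ennreal (integral {0..2 * pi} (\<lambda>\<theta>. cmod (H (of_real \<rho> * cis \<theta>))))"
    by (rule ennreal_mult') simp
  also have "ennreal (integral {0..2 * pi} (\<lambda>\<theta>. cmod (H (of_real \<rho> * cis \<theta>)))) = (\<integral>\<^sup>+\<theta>. ennreal (cmod (H (of_real \<rho> * cis \<theta>))) \<partial>circ)"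
    by (intro nn_integral_circ_eq_integral[symmetric] continuous_on_circle_norm H \<rho>) simp
  finally show ?thesis .
qed

text \<open>The poles 2 - t mirror t at the boundary point 1. On the radius the denominator is (1 -
  t) + (1 - x), so the kernel is comparable with 1 / max of the two sizes, yet it is holomorphic in
  the disc.\<close>

definition stieltjes :: "(real \<Rightarrow> real) \<Rightarrow> complex \<Rightarrow> complex" where
  "stieltjes h z = (\<integral>t. of_real (h t) / (of_real (2 - t) - z) \<partial>unit_len)"

definition stieltjes_real :: "(real \<Rightarrow> real) \<Rightarrow> real \<Rightarrow> real" where
  "stieltjes_real h x = (\<integral>t. h t / (2 - t - x) \<partial>unit_len)"

lemma stieltjes_of_real: "stieltjes h (of_real x) = of_real (stieltjes_real h x)"
proof -
  have "complex_of_real (h t) / (of_real (2 - t) - of_real x) = of_real (h t / (2 - t - x))" for t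
    by (simp only: of_real_divide of_real_diff)
  then show ?thesis
    unfolding stieltjes_def stieltjes_real_def by (simp only: integral_complex_of_real)
qed

text \<open>With c = 2 - t factored out, this is \<open>inverse_norm_le\<close> at 1/c in place of
  t; the size transforms correctly since c (1 - 1/c) = 1 - t.\<close>

lemma norm_stieltjes_kernel_ge:
  assumes t: "0 \<le> t" "t < 1" and \<rho>: "0 \<le> \<rho>" "\<rho> < 1" and pos: "0 < chord \<theta>"
  shows "1 / cmod (of_real (2 - t) - of_real \<rho> * cis \<theta>) \<le> 2 / max (1 - t) (chord \<theta>)"
proof -
  let ?c = "2 - t"
  have c: "1 < ?c" using t by simp
  have e: "of_real ?c - of_real \<rho> * cis \<theta> = of_real ?c * (1 - of_real (1 / ?c * \<rho>) * cis \<theta>)"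
  proof -
    have "of_real ?c * (1 - of_real (1 / ?c * \<rho>) * cis \<theta>) = of_real ?c - of_real (?c * (1 / ?c * \<rho>)) * cis \<theta>"
      by (simp only: of_real_mult right_diff_distrib mult_1_right mult.assoc)
    moreover have "?c * (1 / ?c * \<rho>) = \<rho>" using c by simp
    ultimately show ?thesis by simp
  qed
  have "1 / cmod (of_real ?c - of_real \<rho> * cis \<theta>) = 1 / ?c * (1 / cmod (1 - of_real (1 / ?c * \<rho>) * cis \<theta>))"
    unfolding e norm_mult norm_of_real using c by simp
  also have "\<dots> \<le> 1 / ?c * (2 / max (1 - 1 / ?c) (chord \<theta>))"
    using c by (intro mult_left_mono inverse_norm_le \<rho> pos) auto
  also have "\<dots> = 2 / (?c * max (1 - 1 / ?c) (chord \<theta>))" by simp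
  also have "\<dots> \<le> 2 / max (1 - t) (chord \<theta>)"
  proof (intro divide_left_mono mult_pos_pos)
    have "1 - t = ?c * (1 - 1 / ?c)" using c by (simp add: field_simps)
    also have "\<dots> \<le> ?c * max (1 - 1 / ?c) (chord \<theta>)"
      using c by (intro mult_left_mono) auto
    finally have 1: "1 - t \<le> ?c * max (1 - 1 / ?c) (chord \<theta>)" .
    have "1 * chord \<theta> \<le> ?c * max (1 - 1 / ?c) (chord \<theta>)"
      using c by (intro mult_mono) auto
    with 1 show "max (1 - t) (chord \<theta>) \<le> ?c * max (1 - 1 / ?c) (chord \<theta>)" by simp
  qed (use c pos t in \<open>auto simp: less_max_iff_disj\<close>)
  finally show ?thesis .
qed

lemma measurable_ident_unit_len [measurable]: "(\<lambda>t. t) \<in> borel_measurable unit_len"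
  by (intro measurable_unit_lenI) simp

lemma integrable_unit_len_bounded:
  fixes f :: "real \<Rightarrow> 'b :: {banach, second_countable_topology}"
  assumes "f \<in> borel_measurable unit_len" "\<And>t. t \<in> {0..<1} \<Longrightarrow> norm (f t) \<le> K"
  shows "integrable unit_len f"
proof -
  interpret finite_measure unit_len by (rule finite_measure_unit_len)
  show ?thesis using assms by (intro integrable_const_bound[where B = K] AE_I2) auto
qed

context
  fixes h :: "real \<Rightarrow> real" and B :: real
  assumes h [measurable]: "h \<in> borel_measurable unit_len"
    and hB: "\<And>t. t \<in> {0..<1} \<Longrightarrow> 0 \<le> h t" "\<And>t. t \<in> {0..<1} \<Longrightarrow> h t \<le> B"
begin

interpretation L: finite_measure unit_len by (rule finite_measure_unit_len)

lemma integrable_stieltjes_real: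
  assumes "x < 1"
  shows "integrable unit_len (\<lambda>t. h t / (2 - t - x))"
proof (rule integrable_unit_len_bounded[where K = "B / (1 - x)"])
  fix t :: real assume t: "t \<in> {0..<1}"
  then have "h t / (2 - t - x) \<le> B / (1 - x)"
    using hB[OF t] assms by (intro frac_le) auto
  then show "norm (h t / (2 - t - x)) \<le> B / (1 - x)"
    using hB[OF t] t assms by simp
qed measurable

lemma stieltjes_real_nonneg: "x < 1 \<Longrightarrow> 0 \<le> stieltjes_real h x"
  unfolding stieltjes_real_def using hB by (intro integral_nonneg_AE AE_I2) auto

lemma stieltjes_real_mono:
  assumes "x \<le> y" "y < 1"
  shows "stieltjes_real h x \<le> stieltjes_real h y"
  unfolding stieltjes_real_def using assms hB
  by (intro integral_mono integrable_stieltjes_real) (auto intro!: divide_left_mono)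

text \<open>Geometric expansion in z / (2 - t). Since 2 - t \<ge> 1, the n-th term is dominated by B
  |z|^n, so sum and integral may be exchanged and a power series in z results.\<close>

lemma holomorphic_stieltjes: "stieltjes h holomorphic_on ball 0 1"
proof (rule power_series_holomorphic)
  fix z :: complex assume "z \<in> ball 0 1"
  then have z: "cmod z < 1" by simp
  define a where "a n = (\<integral>t. complex_of_real (h t) / of_real (2 - t) ^ Suc n \<partial>unit_len)" for n
  let ?f = "\<lambda>n t. complex_of_real (h t) / of_real (2 - t) ^ Suc n * z ^ n"
  have B0: "0 \<le> B" using hB[of 0] by simp
  have bnd: "cmod (complex_of_real (h t) / of_real (2 - t) ^ Suc n) \<le> B" if t: "t \<in> {0..<1}" for n t
  proof -
    have "1 \<le> (2 - t) ^ Suc n" using t by (intro one_le_power) auto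
    then have "h t / (2 - t) ^ Suc n \<le> B / 1"
      using hB[OF t] t B0 by (intro frac_le) auto
    then show ?thesis
      using hB[OF t] t by (simp add: norm_divide norm_power norm_mult del: of_real_diff power_Suc)
  qed
  have int0: "integrable unit_len (\<lambda>t. complex_of_real (h t) / of_real (2 - t) ^ Suc n)" for n
    by (intro integrable_unit_len_bounded[where K = B] bnd) measurable
  then have int: "integrable unit_len (?f n)" for n by (intro integrable_mult_left)
  have sums: "(\<lambda>n. ?f n t) sums (of_real (h t) / (of_real (2 - t) - z))"
    and sn: "summable (\<lambda>n. cmod (?f n t))" if t: "t \<in> {0..<1}" for t
  proof -
    let ?w = "z / of_real (2 - t)"
    have w: "cmod ?w < 1" using z t by (simp add: norm_divide del: of_real_diff)
    have nz: "complex_of_real (2 - t) \<noteq> 0" using t by (simp del: of_real_diff)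
    have eq: "?f n t = of_real (h t) / of_real (2 - t) * ?w ^ n" for n
      by (simp add: power_divide del: of_real_diff)
    have "(\<lambda>n. of_real (h t) / of_real (2 - t) * ?w ^ n) sums (of_real (h t) / of_real (2 - t) * (1 / (1 - ?w)))"
      by (intro sums_mult geometric_sums w)
    also have "of_real (h t) / of_real (2 - t) * (1 / (1 - ?w)) = of_real (h t) / (of_real (2 - t) - z)"
    proof -
      have "of_real (2 - t) * (1 - ?w) = of_real (2 - t) - z"
        using nz by (simp add: right_diff_distrib del: of_real_diff)
      then show ?thesis by (simp del: of_real_diff)
    qed
    finally show "(\<lambda>n. ?f n t) sums (of_real (h t) / (of_real (2 - t) - z))"
      unfolding eq .
    show "summable (\<lambda>n. cmod (?f n t))"
      unfolding eq norm_mult norm_power using w by (intro summable_mult summable_geometric) simp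
  qed
  have sI: "summable (\<lambda>n. \<integral>t. cmod (?f n t) \<partial>unit_len)"
  proof (rule summable_comparison_test', rule summable_mult[of _ "B"])
    show "summable (\<lambda>n. cmod z ^ n)" using z by (intro summable_geometric) simp
    fix n :: nat
    have "(\<integral>t. cmod (?f n t) \<partial>unit_len) \<le> (\<integral>t. B * cmod z ^ n \<partial>unit_len)"
    proof (intro integral_mono integrable_norm int)
      fix t assume "t \<in> space unit_len"
      then show "cmod (?f n t) \<le> B * cmod z ^ n"
        unfolding norm_mult[of _ "z ^ n"] norm_power[of z] by (intro mult_right_mono bnd) auto
    qed auto
    also have "\<dots> = B * cmod z ^ n"
      by (simp add: unit_len_def measure_restrict_space)
    finally show "norm (\<integral>t. cmod (?f n t) \<partial>unit_len) \<le> B * cmod z ^ n" by simp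
  qed
  have AE: "AE t in unit_len. summable (\<lambda>n. cmod (?f n t))"
    using sn by (intro AE_I2) auto
  have "(\<lambda>n. \<integral>t. ?f n t \<partial>unit_len) sums (\<integral>t. (\<Sum>n. ?f n t) \<partial>unit_len)"
    by (rule sums_integral[OF int AE sI])
  also have "(\<integral>t. (\<Sum>n. ?f n t) \<partial>unit_len) = stieltjes h z"
    unfolding stieltjes_def using sums_unique[OF sums]
    by (intro Bochner_Integration.integral_cong) (auto simp del: of_real_diff power_Suc)
  also have "(\<lambda>n. \<integral>t. ?f n t \<partial>unit_len) = (\<lambda>n. a n * (z - 0) ^ n)"
    unfolding a_def diff_zero by (intro ext integral_mult_left_zero)
  finally show "(\<lambda>n. a n * (z - 0) ^ n) sums stieltjes h z" .
qed

lemma norm_stieltjes_le: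
  assumes \<rho>: "0 \<le> \<rho>" "\<rho> < 1" and \<theta>: "\<theta> \<in> space circ"
  shows "cmod (stieltjes h (of_real \<rho> * cis \<theta>)) \<le> 2 * (\<integral>t. h t / max (1 - t) (chord \<theta>) \<partial>unit_len)"
proof -
  have pos: "0 < chord \<theta>" using \<theta> chord_pos by auto
  have i: "integrable unit_len (\<lambda>t. h t / max (1 - t) (chord \<theta>))"
  proof (rule integrable_unit_len_bounded[where K = "B / chord \<theta>"])
    fix t :: real assume t: "t \<in> {0..<1}"
    then have "h t / max (1 - t) (chord \<theta>) \<le> B / chord \<theta>"
      using hB[OF t] pos by (intro frac_le) auto
    then show "norm (h t / max (1 - t) (chord \<theta>)) \<le> B / chord \<theta>"
      using hB[OF t] t pos by simp
  qed measurable
  have "cmod (stieltjes h (of_real \<rho> * cis \<theta>)) \<le> (\<integral>t. cmod (of_real (h t) / (of_real (2 - t) - of_real \<rho> * cis \<theta>)) \<partial>unit_len)"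
    unfolding stieltjes_def by (rule integral_norm_bound)
  also have "\<dots> \<le> (\<integral>t. 2 * (h t / max (1 - t) (chord \<theta>)) \<partial>unit_len)"
  proof (rule integral_mono')
    show "integrable unit_len (\<lambda>t. 2 * (h t / max (1 - t) (chord \<theta>)))" by (intro Bochner_Integration.integrable_mult_right i)
    fix t assume "t \<in> space unit_len"
    then have t: "t \<in> {0..<1}" by simp
    have "h t * (1 / cmod (of_real (2 - t) - of_real \<rho> * cis \<theta>)) \<le> h t * (2 / max (1 - t) (chord \<theta>))"
      using norm_stieltjes_kernel_ge[OF _ _ \<rho> pos, of t] t hB[OF t] by (intro mult_left_mono) auto
    then show "cmod (of_real (h t) / (of_real (2 - t) - of_real \<rho> * cis \<theta>)) \<le> 2 * (h t / max (1 - t) (chord \<theta>))"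
      using hB[OF t] by (simp add: norm_divide mult_ac del: of_real_diff)
    show "0 \<le> 2 * (h t / max (1 - t) (chord \<theta>))"
      using hB[OF t] t by (simp add: le_max_iff_disj)
  qed
  finally show ?thesis by (simp only: integral_mult_right_zero)
qed

end

text \<open>The radius-to-circle inequality. D is chosen before h and its bound B, so all
  truncations share it.\<close>

lemma hardy_mean_stieltjes_le:
  assumes P: "1 < P"
  shows "\<exists>D\<ge>0. \<forall>h B I \<rho>. h \<in> borel_measurable unit_len \<longrightarrow> (\<forall>t\<in>{0..<1}. 0 \<le> h t \<and> h t \<le> B) \<longrightarrow> 0 \<le> I \<longrightarrow>
    (\<integral>\<^sup>+t. ennreal (h t powr P) \<partial>unit_len) \<le> ennreal I \<longrightarrow> 0 \<le> \<rho> \<longrightarrow> \<rho> < 1 \<longrightarrow>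
    hardy_mean P (stieltjes h) \<rho> \<le> D * I powr (1 / P)"
proof -
  obtain C where C: "C \<ge> 0" "\<And>f. f \<in> borel_measurable unit_len \<Longrightarrow> \<forall>x\<in>space unit_len. 0 \<le> f x \<Longrightarrow>
    (\<integral>\<^sup>+y. ennreal ((\<integral>x. f x / max (1 - x) (chord y) \<partial>unit_len) powr P) \<partial>circ)
      \<le> ennreal C * (\<integral>\<^sup>+x. ennreal (f x powr P) \<partial>unit_len)"
    using hilbert_inequality[OF size_weight_unit_len size_weight_circ P] by blast
  show ?thesis
  proof (intro exI[of _ "2 * C powr (1 / P)"] conjI allI impI)
    show "0 \<le> 2 * C powr (1 / P)" by simp
    fix h B I and \<rho> :: real
    assume h [measurable]: "h \<in> borel_measurable unit_len" and hB: "\<forall>t\<in>{0..<1}. 0 \<le> h t \<and> h t \<le> B"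
      and I: "0 \<le> I" "(\<integral>\<^sup>+t. ennreal (h t powr P) \<partial>unit_len) \<le> ennreal I" and \<rho>: "0 \<le> \<rho>" "\<rho> < 1"
    have h1: "\<And>t. t \<in> {0..<1} \<Longrightarrow> 0 \<le> h t" "\<And>t. t \<in> {0..<1} \<Longrightarrow> h t \<le> B" using hB by auto
    define J where "J \<theta> = (\<integral>t. h t / max (1 - t) (chord \<theta>) \<partial>unit_len)" for \<theta>
    interpret L: finite_measure unit_len by (rule finite_measure_unit_len)
    note [measurable] = measurable_circI[OF borel_measurable_chord]
    have [measurable]: "J \<in> borel_measurable circ" unfolding J_def by measurable
    have J: "0 \<le> J \<theta>" for \<theta>
      unfolding J_def using h1 by (intro integral_nonneg_AE AE_I2) (auto simp: le_max_iff_disj)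
    show "hardy_mean P (stieltjes h) \<rho> \<le> 2 * C powr (1 / P) * I powr (1 / P)"
    proof (rule hardy_mean_leI[OF holomorphic_stieltjes[OF h h1] \<rho>])
      have "(\<integral>\<^sup>+\<theta>. ennreal (cmod (stieltjes h (of_real \<rho> * cis \<theta>)) powr P) \<partial>circ) \<le> (\<integral>\<^sup>+\<theta>. ennreal (2 powr P) * ennreal (J \<theta> powr P) \<partial>circ)"
      proof (intro nn_integral_mono)
        fix \<theta> assume \<theta>: "\<theta> \<in> space circ"
        have "cmod (stieltjes h (of_real \<rho> * cis \<theta>)) powr P \<le> (2 * J \<theta>) powr P"
          using norm_stieltjes_le[OF h h1 \<rho> \<theta>] P by (intro powr_mono2) (auto simp: J_def)
        then show "ennreal (cmod (stieltjes h (of_real \<rho> * cis \<theta>)) powr P) \<le> ennreal (2 powr P) * ennreal (J \<theta> powr P)"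
          using J by (simp add: powr_mult ennreal_leI flip: ennreal_mult')
      qed
      also have "\<dots> = ennreal (2 powr P) * (\<integral>\<^sup>+\<theta>. ennreal (J \<theta> powr P) \<partial>circ)"
        by (intro nn_integral_cmult) measurable
      also have "\<dots> \<le> ennreal (2 powr P) * (ennreal C * ennreal I)"
      proof (intro mult_left_mono)
        have "(\<integral>\<^sup>+\<theta>. ennreal (J \<theta> powr P) \<partial>circ) \<le> ennreal C * (\<integral>\<^sup>+x. ennreal (h x powr P) \<partial>unit_len)"
          unfolding J_def using h1 by (intro C(2)) auto
        also have "\<dots> \<le> ennreal C * ennreal I" by (intro mult_left_mono I) auto
        finally show "(\<integral>\<^sup>+\<theta>. ennreal (J \<theta> powr P) \<partial>circ) \<le> ennreal C * ennreal I" .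
      qed auto
      also have "\<dots> = ennreal ((2 * C powr (1 / P) * I powr (1 / P)) powr P)"
        using P C I by (simp add: powr_mult powr_powr mult_ac flip: ennreal_mult' ennreal_mult'')
      also have "\<dots> \<le> ennreal (2 * pi * (2 * C powr (1 / P) * I powr (1 / P)) powr P)"
      proof -
        have "1 * x \<le> 2 * pi * x" if "0 \<le> x" for x
          using that pi_gt3 by (intro mult_right_mono) auto
        then show ?thesis by (intro ennreal_leI) simp
      qed
      finally show "(\<integral>\<^sup>+\<theta>. ennreal (cmod (stieltjes h (of_real \<rho> * cis \<theta>)) powr P) \<partial>circ)
        \<le> ennreal (2 * pi * (2 * C powr (1 / P) * I powr (1 / P)) powr P)" .
    qed (use P in auto)
  qed
qed

declare measurable_ident_unit_len [measurable del]

section \<open>Necessity of the tail condition\<close>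

text \<open>The truncation is bounded by the mass of \<mu> over \<epsilon>, so its powers are
  admissible densities for the Stieltjes transform.\<close>

definition trunc_tail :: "real measure \<Rightarrow> real \<Rightarrow> real \<Rightarrow> real" where
  "trunc_tail \<mu> \<epsilon> t = (if t \<le> 1 - \<epsilon> then tail \<mu> t else 0)"

lemma tail_le:
  assumes \<mu>: "finite_borel_unit \<mu>" and t: "0 \<le> t" "t \<le> 1 - \<epsilon>" and \<epsilon>: "0 < \<epsilon>"
  shows "tail \<mu> t \<le> measure \<mu> (space \<mu>) / \<epsilon>"
proof -
  interpret finite_measure \<mu> using \<mu> by (simp add: finite_borel_unit_def)
  show ?thesis
    unfolding tail_def using t \<epsilon> bounded_measure[of "{t..<1}"] by (intro frac_le) auto
qed

lemma trunc_tail_bounds: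
  assumes \<mu>: "finite_borel_unit \<mu>" and \<epsilon>: "0 < \<epsilon>" and t: "t \<in> {0..<1}"
  shows "0 \<le> trunc_tail \<mu> \<epsilon> t" "trunc_tail \<mu> \<epsilon> t \<le> measure \<mu> (space \<mu>) / \<epsilon>"
  using tail_nonneg[OF t, of \<mu>] tail_le[OF \<mu> _ _ \<epsilon>, of t] \<epsilon> t by (auto simp: trunc_tail_def)

lemma measurable_trunc_tail:
  assumes "finite_borel_unit \<mu>"
  shows "trunc_tail \<mu> \<epsilon> \<in> borel_measurable unit_len"
proof -
  note [measurable] = measurable_tail[OF assms] measurable_ident_unit_len
  show ?thesis unfolding trunc_tail_def by measurable
qed

lemma trunc_tail_powr:
  assumes \<mu>: "finite_borel_unit \<mu>" and \<epsilon>: "0 < \<epsilon>" and \<gamma>: "0 \<le> \<gamma>"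
  shows "(\<lambda>t. trunc_tail \<mu> \<epsilon> t powr \<gamma>) \<in> borel_measurable unit_len"
    and "\<And>t. t \<in> {0..<1} \<Longrightarrow> 0 \<le> trunc_tail \<mu> \<epsilon> t powr \<gamma>"
    and "\<And>t. t \<in> {0..<1} \<Longrightarrow> trunc_tail \<mu> \<epsilon> t powr \<gamma> \<le> (measure \<mu> (space \<mu>) / \<epsilon>) powr \<gamma>"
proof -
  note [measurable] = measurable_trunc_tail[OF \<mu>]
  show "(\<lambda>t. trunc_tail \<mu> \<epsilon> t powr \<gamma>) \<in> borel_measurable unit_len" by measurable
  show "0 \<le> trunc_tail \<mu> \<epsilon> t powr \<gamma>" for t by simp
  show "trunc_tail \<mu> \<epsilon> t powr \<gamma> \<le> (measure \<mu> (space \<mu>) / \<epsilon>) powr \<gamma>" if "t \<in> {0..<1}" for t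
    using trunc_tail_bounds[OF \<mu> \<epsilon> that] \<gamma> by (intro powr_mono2) auto
qed

text \<open>Only t in [2 y - 1, y] is kept, an interval of length 1 - y. There 1 - t \<le> 2 (1 -
  y), so the tail has at least half its value at y, and the denominator is at most 4 (1 - y). The
  condition y \<ge> 1/2 keeps the interval in [0,1). The point y^2 is where the operator will need
  the bound.\<close>

lemma stieltjes_real_ge_tail:
  assumes \<mu>: "finite_borel_unit \<mu>" and \<epsilon>: "0 < \<epsilon>" and \<gamma>: "0 \<le> \<gamma>" and y: "1 / 2 \<le> y" "y \<le> 1 - \<epsilon>"
  shows "1 / 4 * (tail \<mu> y / 2) powr \<gamma> \<le> stieltjes_real (\<lambda>t. trunc_tail \<mu> \<epsilon> t powr \<gamma>) (y\<^sup>2)"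
proof -
  have y1: "y < 1" using y \<epsilon> by simp
  have y2: "y\<^sup>2 < 1" using y y1 by (simp add: power_less_one_iff)
  define c where "c = (tail \<mu> y / 2) powr \<gamma> / (4 * (1 - y))"
  note h = trunc_tail_powr[OF \<mu> \<epsilon> \<gamma>]
  have "(\<integral>t. c * indicator {2 * y - 1..y} t \<partial>unit_len) \<le> stieltjes_real (\<lambda>t. trunc_tail \<mu> \<epsilon> t powr \<gamma>) (y\<^sup>2)"
    unfolding stieltjes_real_def
  proof (rule integral_mono'[OF integrable_stieltjes_real[OF h y2]])
    fix t assume "t \<in> space unit_len"
    then have t: "t \<in> {0..<1}" by simp
    have nn: "0 \<le> trunc_tail \<mu> \<epsilon> t powr \<gamma> / (2 - t - y\<^sup>2)" using t y2 by simp
    then show "0 \<le> trunc_tail \<mu> \<epsilon> t powr \<gamma> / (2 - t - y\<^sup>2)" .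
    show "c * indicator {2 * y - 1..y} t \<le> trunc_tail \<mu> \<epsilon> t powr \<gamma> / (2 - t - y\<^sup>2)"
    proof (cases "t \<in> {2 * y - 1..y}")
      case True
      have "tail \<mu> y / 2 = measure \<mu> {y..<1} / (2 * (1 - y))" by (simp add: tail_def)
      also have "\<dots> \<le> measure \<mu> {t..<1} / (1 - t)"
        using True t y1 antimono_tail_measure[OF \<mu>, of t y] by (intro frac_le) auto
      also have "\<dots> = trunc_tail \<mu> \<epsilon> t"
        using True y by (simp add: trunc_tail_def tail_def)
      finally have 1: "(tail \<mu> y / 2) powr \<gamma> \<le> trunc_tail \<mu> \<epsilon> t powr \<gamma>"
        using \<gamma> y1 y tail_nonneg[of y \<mu>] by (intro powr_mono2) auto
      have "1 - y\<^sup>2 = (1 - y) * (1 + y)" by (simp add: power2_eq_square algebra_simps)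
      also have "\<dots> \<le> (1 - y) * 2" using y1 by (intro mult_left_mono) auto
      finally have 2: "2 - t - y\<^sup>2 \<le> 4 * (1 - y)" using True by simp
      have "c \<le> trunc_tail \<mu> \<epsilon> t powr \<gamma> / (2 - t - y\<^sup>2)"
        unfolding c_def using 1 2 t y2 by (intro frac_le) auto
      then show ?thesis using True by simp
    qed (use nn in simp)
  qed
  also have "(\<integral>t. c * indicator {2 * y - 1..y} t \<partial>unit_len) = c * measure unit_len {2 * y - 1..y}"
  proof -
    have "{2 * y - 1..y} \<inter> {0..<1} = {2 * y - 1..y}"
      using y y1 by auto
    then show ?thesis by simp
  qed
  also have "measure unit_len {2 * y - 1..y} = 1 - y"
  proof -
    have "{2 * y - 1..y} \<subseteq> {0..<1}" using y y1 by auto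
    then show ?thesis using y1 by (simp add: unit_len_def measure_restrict_space)
  qed
  also have "c * (1 - y) = 1 / 4 * (tail \<mu> y / 2) powr \<gamma>"
  proof -
    have "X / (4 * d) * d = 1 / 4 * X" if "d \<noteq> 0" for X d :: real using that by simp
    from this[of "1 - y" "(tail \<mu> y / 2) powr \<gamma>"] y1 show ?thesis unfolding c_def by linarith
  qed
  finally show ?thesis .
qed

definition cesaro_real :: "real measure \<Rightarrow> (real \<Rightarrow> real) \<Rightarrow> real \<Rightarrow> real" where
  "cesaro_real \<mu> g y = (\<integral>t. g (t * y) / (1 - t * y) \<partial>\<mu>)"

text \<open>The integrand is nonnegative, so only t \<ge> y is kept, where ty \<ge> y^2 and both the
  transform and 1 / (1 - ty) are at least their values at y^2. The mass of [y,1) over 1 - y^2 \<le>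
  2 (1 - y) yields half the tail.\<close>

lemma cesaro_op_stieltjes:
  assumes \<mu>: "finite_borel_unit \<mu>" and h: "h \<in> borel_measurable unit_len"
    "\<And>t. t \<in> {0..<1} \<Longrightarrow> 0 \<le> h t" "\<And>t. t \<in> {0..<1} \<Longrightarrow> h t \<le> B" and y: "0 \<le> y" "y < 1"
  shows "cesaro_op \<mu> (stieltjes h) (of_real y) = of_real (cesaro_real \<mu> (stieltjes_real h) y)"
    and "tail \<mu> y * stieltjes_real h (y\<^sup>2) / 2 \<le> cesaro_real \<mu> (stieltjes_real h) y"
proof -
  interpret finite_measure \<mu> using \<mu> by (simp add: finite_borel_unit_def)
  let ?g = "\<lambda>t. stieltjes_real h (t * y) / (1 - t * y)"
  have eq: "stieltjes h (of_real t * of_real y) / (1 - of_real t * of_real y) = complex_of_real (?g t)" for t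
    using stieltjes_of_real[of h "t * y"] by simp
  note hol = holomorphic_stieltjes[OF h]
  have z: "cmod (of_real y) < 1" using y by simp
  have "integrable \<mu> (\<lambda>t. complex_of_real (?g t))"
    using cesaro_op_integral(1)[OF \<mu> hol z] unfolding eq .
  then have "integrable \<mu> (\<lambda>t. Re (complex_of_real (?g t)))"
    by (rule integrable_Re)
  then have I: "integrable \<mu> ?g" by (simp only: Re_complex_of_real)
  show "cesaro_op \<mu> (stieltjes h) (of_real y) = of_real (cesaro_real \<mu> (stieltjes_real h) y)"
    using cesaro_op_integral(2)[OF \<mu> hol z] unfolding eq by (simp only: cesaro_real_def integral_complex_of_real)
  have y2: "y\<^sup>2 < 1" using y by (simp add: power_less_one_iff)
  define c where "c = stieltjes_real h (y\<^sup>2) / (1 - y\<^sup>2)"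
  have "(\<integral>t. c * indicator {y..<1} t \<partial>\<mu>) \<le> cesaro_real \<mu> (stieltjes_real h) y"
    unfolding cesaro_real_def
  proof (rule integral_mono'[OF I])
    fix t assume "t \<in> space \<mu>"
    then have t: "0 \<le> t" "t < 1" using \<mu> by (auto simp: space_finite_borel_unit)
    have "t * y \<le> 1 * y" using t y by (intro mult_right_mono) auto
    then have ty: "t * y < 1" using y by simp
    show nn: "0 \<le> ?g t" using ty stieltjes_real_nonneg[OF h ty] by simp
    show "c * indicator {y..<1} t \<le> ?g t"
    proof (cases "y \<le> t")
      case True
      then have le: "y\<^sup>2 \<le> t * y" using y by (simp add: power2_eq_square mult_right_mono)
      have "c \<le> ?g t"
        unfolding c_def using stieltjes_real_mono[OF h le ty] stieltjes_real_nonneg[OF h y2] le ty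
        by (intro frac_le) auto
      then show ?thesis using True t by simp
    qed (use nn in simp)
  qed
  also have "(\<integral>t. c * indicator {y..<1} t \<partial>\<mu>) = c * measure \<mu> {y..<1}"
    using sets_atLeastLessThan_1[OF \<mu> y(1)] by simp
  finally have 1: "c * measure \<mu> {y..<1} \<le> cesaro_real \<mu> (stieltjes_real h) y" .
  have "1 - y\<^sup>2 = (1 - y) * (1 + y)" by (simp add: power2_eq_square algebra_simps)
  also have "\<dots> \<le> (1 - y) * 2" using y by (intro mult_left_mono) auto
  finally have "tail \<mu> y * stieltjes_real h (y\<^sup>2) / 2 \<le> c * measure \<mu> {y..<1}"
    using y y2 stieltjes_real_nonneg[OF h y2] unfolding tail_def c_def
    by (simp add: mult.commute[of "measure _ _"]) (intro frac_le mult_nonneg_nonneg, auto simp: mult_ac)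
  with 1 show "tail \<mu> y * stieltjes_real h (y\<^sup>2) / 2 \<le> cesaro_real \<mu> (stieltjes_real h) y" by simp
qed

text \<open>Duality: \<open>\<kappa>\<close> plays the role of an extremal function for the dual exponent of \<open>q\<close>, so that
  an \<open>L\<^sup>q\<close> lower bound can be read off from an \<open>L\<^sup>1\<close> one; for \<open>q = 1\<close> it is constant.\<close>

definition dual_test :: "real \<Rightarrow> real \<Rightarrow> real measure \<Rightarrow> real \<Rightarrow> real \<Rightarrow> real \<Rightarrow> real
    \<Rightarrow> (complex \<Rightarrow> complex) \<Rightarrow> (real \<Rightarrow> real) \<Rightarrow> bool" where
  "dual_test q r \<mu> \<epsilon> D c I \<kappa> k \<longleftrightarrow> \<kappa> holomorphic_on ball 0 1 \<and>
      (\<forall>x. 0 \<le> x \<longrightarrow> x < 1 \<longrightarrow> \<kappa> (of_real x) = of_real (k x) \<and> 0 \<le> k x) \<and>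
      (\<forall>y. 1 / 2 \<le> y \<longrightarrow> y \<le> 1 - \<epsilon> \<longrightarrow> c * tail \<mu> y powr (r * (1 - 1 / q)) \<le> k y) \<and>
      (\<forall>F \<rho>. F holomorphic_on ball 0 1 \<longrightarrow> 0 \<le> \<rho> \<longrightarrow> \<rho> < 1 \<longrightarrow>
        (\<integral>\<^sup>+\<theta>. ennreal (cmod (F (of_real \<rho> * cis \<theta>) * \<kappa> (of_real \<rho> * cis \<theta>))) \<partial>circ)
          \<le> ennreal (D * hardy_mean q F \<rho> * I powr (1 - 1 / q)))"

text \<open>For q > 1, \<kappa> is the Stieltjes transform of a power of the truncated tail, paired
  with F by Hoelder on the circle. D and c are fixed before \<epsilon> and I, which makes the final
  bound uniform in the truncation.\<close>

lemma dual_test_function: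
  assumes q: "1 \<le> q" and r: "0 < r"
  shows "\<exists>D\<ge>0. \<exists>c>0. \<forall>\<mu> \<epsilon> I. finite_borel_unit \<mu> \<longrightarrow> 0 < \<epsilon> \<longrightarrow> 0 < I \<longrightarrow>
    (\<integral>\<^sup>+t. ennreal (trunc_tail \<mu> \<epsilon> t powr r) \<partial>unit_len) \<le> ennreal I \<longrightarrow>
    (\<exists>\<kappa> k. dual_test q r \<mu> \<epsilon> D c I \<kappa> k)"
proof (cases "q = 1")
  case True
  show ?thesis
  proof (rule exI[of _ "2 * pi"], rule conjI, simp, rule exI[of _ 1], rule conjI, simp, intro allI impI)
    fix \<mu> \<epsilon> and I :: real assume "0 < I"
    have "(\<integral>\<^sup>+\<theta>. ennreal (cmod (F (of_real \<rho> * cis \<theta>))) \<partial>circ) = ennreal (2 * pi * hardy_mean 1 F \<rho>)"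
      if "F holomorphic_on ball 0 1" "0 \<le> \<rho>" "\<rho> < 1" for F and \<rho> :: real
      using nn_integral_circle_powr[OF that, of 1] by (simp add: hardy_mean_nonneg)
    \<comment> \<open>Here 1 - 1/q = 0. The factor \<open>I powr 0\<close> is 1 because I > 0,
      whereas \<open>0 powr 0\<close> would be 0.\<close>
    then show "\<exists>\<kappa> k. dual_test q r \<mu> \<epsilon> (2 * pi) 1 I \<kappa> k"
      using \<open>0 < I\<close> True unfolding dual_test_def
      by (intro exI[of _ "\<lambda>_ :: complex. 1 :: complex"] exI[of _ "\<lambda>_ :: real. 1 :: real"]) auto
  qed
next
  case False
  then have q1: "1 < q" using q by simp
  define q' where "q' = q / (q - 1)"
  have q': "1 < q'" "1 / q + 1 / q' = 1" "1 - 1 / q = 1 / q'"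
    using q1 by (auto simp: q'_def field_simps)
  \<comment> \<open>The q'-th power of the density is then the r-th power of the truncated tail,
    whose integral I bounds.\<close>
  define \<gamma> where "\<gamma> = r / q'"
  have \<gamma>: "0 \<le> \<gamma>" "\<gamma> * q' = r" using q' r by (auto simp: \<gamma>_def)
  obtain D where D: "D \<ge> 0" "\<And>h B I \<rho>. h \<in> borel_measurable unit_len \<Longrightarrow> \<forall>t\<in>{0..<1}. 0 \<le> h t \<and> h t \<le> B \<Longrightarrow> 0 \<le> I \<Longrightarrow>
    (\<integral>\<^sup>+t. ennreal (h t powr q') \<partial>unit_len) \<le> ennreal I \<Longrightarrow> 0 \<le> \<rho> \<Longrightarrow> \<rho> < 1 \<Longrightarrow>
    hardy_mean q' (stieltjes h) \<rho> \<le> D * I powr (1 / q')"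
    using hardy_mean_stieltjes_le[OF q'(1)] by blast
  show ?thesis
  proof (rule exI[of _ "2 * pi * D"], rule conjI, use D(1) in simp,
      rule exI[of _ "1 / 4 * (1 / 2) powr \<gamma>"], rule conjI, simp, intro allI impI)
    fix \<mu> \<epsilon> and I :: real
    assume \<mu>: "finite_borel_unit \<mu>" and \<epsilon>: "0 < \<epsilon>" and I: "0 < I" "(\<integral>\<^sup>+t. ennreal (trunc_tail \<mu> \<epsilon> t powr r) \<partial>unit_len) \<le> ennreal I"
    define h where "h t = trunc_tail \<mu> \<epsilon> t powr \<gamma>" for t
    note h = trunc_tail_powr[OF \<mu> \<epsilon> \<gamma>(1), folded h_def]
    show "\<exists>\<kappa> k. dual_test q r \<mu> \<epsilon> (2 * pi * D) (1 / 4 * (1 / 2) powr \<gamma>) I \<kappa> k"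
      unfolding dual_test_def
    proof (intro exI[of _ "stieltjes h"] exI[of _ "stieltjes_real h"] conjI allI impI)
      show hol: "stieltjes h holomorphic_on ball 0 1" by (rule holomorphic_stieltjes[OF h])
      show "stieltjes h (of_real x) = of_real (stieltjes_real h x)" for x by (rule stieltjes_of_real)
      show "0 \<le> stieltjes_real h x" if "x < 1" for x by (rule stieltjes_real_nonneg[OF h that])
      show "1 / 4 * (1 / 2) powr \<gamma> * tail \<mu> y powr (r * (1 - 1 / q)) \<le> stieltjes_real h y" if y: "1 / 2 \<le> y" "y \<le> 1 - \<epsilon>" for y
      proof -
        have y1: "y < 1" using y \<epsilon> by simp
        have "y * y \<le> y * 1" using y y1 by (intro mult_left_mono) auto
        have "1 / 4 * (1 / 2) powr \<gamma> * tail \<mu> y powr (r * (1 - 1 / q)) = 1 / 4 * (tail \<mu> y / 2) powr \<gamma>"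
          using y y1 tail_nonneg[of y \<mu>] unfolding q'(3) by (simp add: \<gamma>_def powr_divide powr_mult)
        also have "\<dots> \<le> stieltjes_real h (y\<^sup>2)"
          unfolding h_def by (rule stieltjes_real_ge_tail[OF \<mu> \<epsilon> \<gamma>(1) y])
        also have "\<dots> \<le> stieltjes_real h y"
          using \<open>y * y \<le> y * 1\<close> y1 by (intro stieltjes_real_mono[OF h]) (auto simp: power2_eq_square)
        finally show ?thesis .
      qed
      fix F and \<rho> :: real assume F: "F holomorphic_on ball 0 1" and \<rho>: "0 \<le> \<rho>" "\<rho> < 1"
      define M N where "M = hardy_mean q F \<rho>" and "N = hardy_mean q' (stieltjes h) \<rho>"
      have MN: "0 \<le> M" "0 \<le> N" by (auto simp: M_def N_def hardy_mean_nonneg)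
      have "N \<le> D * I powr (1 / q')"
        unfolding N_def
      proof (rule D(2)[where B = "(measure \<mu> (space \<mu>) / \<epsilon>) powr \<gamma>", OF h(1) _ _ _ \<rho>])
        show "(\<integral>\<^sup>+t. ennreal (h t powr q') \<partial>unit_len) \<le> ennreal I"
          using I by (simp add: h_def powr_powr \<gamma>)
      qed (use h I in auto)
      have "(\<integral>\<^sup>+\<theta>. ennreal (cmod (F (of_real \<rho> * cis \<theta>)) * cmod (stieltjes h (of_real \<rho> * cis \<theta>))) \<partial>circ)
        \<le> ennreal ((2 * pi * M powr q) powr (1 / q) * (2 * pi * N powr q') powr (1 / q'))"
        using q1 q'
        by (intro nn_integral_Hoelder measurable_circI borel_measurable_continuous_onI continuous_on_circle_norm F hol \<rho>)
          (auto simp: nn_integral_circle_powr[OF F \<rho>] nn_integral_circle_powr[OF hol \<rho>] M_def N_def)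
      also have "(2 * pi * M powr q) powr (1 / q) * (2 * pi * N powr q') powr (1 / q') = ((2 * pi) powr (1 / q) * (2 * pi) powr (1 / q')) * M * N"
        using q1 q' MN by (simp add: powr_mult powr_powr)
      also have "(2 * pi) powr (1 / q) * (2 * pi) powr (1 / q') = 2 * pi"
        unfolding powr_add[symmetric] q'(2) by simp
      also have "2 * pi * M * N \<le> 2 * pi * M * (D * I powr (1 / q'))"
        using MN \<open>N \<le> _\<close> by (intro mult_left_mono) auto
      finally show "(\<integral>\<^sup>+\<theta>. ennreal (cmod (F (of_real \<rho> * cis \<theta>) * stieltjes h (of_real \<rho> * cis \<theta>))) \<partial>circ)
          \<le> ennreal (2 * pi * D * hardy_mean q F \<rho> * I powr (1 - 1 / q))"
        unfolding q'(3) by (simp add: norm_mult M_def mult_ac ennreal_leI order_trans)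
    qed
  qed
qed

text \<open>Either I \<le> 2 a, or a is less than half of I and can be absorbed, leaving I \<le> 2 C
  I^\<gamma>, which is solved for I.\<close>

lemma le_of_sublinear_bound:
  fixes I a C \<gamma> :: real
  assumes "0 < I" "\<gamma> < 1" "0 \<le> a" "0 \<le> C" "I \<le> a + C * I powr \<gamma>"
  shows "I \<le> max (2 * a) ((2 * C) powr (1 / (1 - \<gamma>)))"
proof (cases "I \<le> 2 * a")
  case False
  then have "I \<le> 2 * C * I powr \<gamma>" using assms by simp
  then have "I / I powr \<gamma> \<le> 2 * C" using assms by (simp add: divide_le_eq)
  then have "I powr (1 - \<gamma>) \<le> 2 * C" using assms by (simp add: powr_diff)
  then have "(I powr (1 - \<gamma>)) powr (1 / (1 - \<gamma>)) \<le> (2 * C) powr (1 / (1 - \<gamma>))"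
    using assms by (intro powr_mono2) auto
  then have "I \<le> (2 * C) powr (1 / (1 - \<gamma>))"
    using assms by (simp add: powr_powr)
  then show ?thesis by simp
qed simp

lemma bounded_imp_tail_condition:
  assumes q: "1 \<le> q" "q < p" and r: "r = p * q / (p - q)" and s: "s = 1 - 1 / r"
    and \<mu>: "finite_borel_unit \<mu>" and bd: "hardy_bounded p q (cesaro_op \<mu>)"
  shows "tail_condition r s \<mu>"
proof -
  have r1: "1 < r" by (rule conjugate_gt_1[OF q r])
  have p: "1 < p" using q by simp
  have r_eq: "1 / r = 1 / q - 1 / p" using q p by (simp add: r field_simps)
  interpret finite_measure \<mu> using \<mu> by (simp add: finite_borel_unit_def)
  define m where "m = measure \<mu> (space \<mu>)"
  \<comment> \<open>The p-th power of the density is then the r-th power of the truncated tail, so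
    the norm of the test function is at most D1 I^(1/p).\<close>
  define \<gamma> where "\<gamma> = r / p"
  have \<gamma>: "0 \<le> \<gamma>" "\<gamma> * p = r" using p r1 by (auto simp: \<gamma>_def)
  obtain K where K: "\<And>f. f \<in> hardy_space p \<Longrightarrow> cesaro_op \<mu> f \<in> hardy_space q"
    "\<And>f. f \<in> hardy_space p \<Longrightarrow> hardy_norm q (cesaro_op \<mu> f) \<le> K * hardy_norm p f"
    using bd unfolding hardy_bounded_def by blast
  obtain D1 where D1: "D1 \<ge> 0" "\<And>h B I \<rho>. h \<in> borel_measurable unit_len \<Longrightarrow> \<forall>t\<in>{0..<1}. 0 \<le> h t \<and> h t \<le> B \<Longrightarrow> 0 \<le> I \<Longrightarrow>
    (\<integral>\<^sup>+t. ennreal (h t powr p) \<partial>unit_len) \<le> ennreal I \<Longrightarrow> 0 \<le> \<rho> \<Longrightarrow> \<rho> < 1 \<Longrightarrow>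
    hardy_mean p (stieltjes h) \<rho> \<le> D1 * I powr (1 / p)"
    using hardy_mean_stieltjes_le[OF p] by blast
  have r0: "0 < r" using r1 by simp
  from dual_test_function[OF q(1) r0] obtain D2 c where D2: "D2 \<ge> 0" and c: "c > 0"
    and dual: "\<forall>\<mu> \<epsilon> I. finite_borel_unit \<mu> \<longrightarrow> 0 < \<epsilon> \<longrightarrow> 0 < I \<longrightarrow>
      (\<integral>\<^sup>+t. ennreal (trunc_tail \<mu> \<epsilon> t powr r) \<partial>unit_len) \<le> ennreal I \<longrightarrow> (\<exists>\<kappa> k. dual_test q r \<mu> \<epsilon> D2 c I \<kappa> k)"
    by blast
  \<comment> \<open>8 is the 4 of \<open>stieltjes_real_ge_tail\<close> times the 2 of
    \<open>cesaro_op_stieltjes\<close>; the power of 1/2 comes from the halved tail in the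
    former.\<close>
  define c' where "c' = c / 8 * (1 / 2) powr \<gamma>"
  have c': "c' > 0" using c by (simp add: c'_def)
  define a where "a = (2 * m) powr r"
  define C where "C = 1 / c' * (1 / 2 * (D2 * (\<bar>K\<bar> * D1)))"
  have C: "0 \<le> C" using c' D1 D2 by (simp add: C_def)
  define Bd where "Bd = max (2 * (a + 1)) ((2 * C) powr (1 / (1 - (1 - 1 / r))))"
  have main: "(\<integral>\<^sup>+t. ennreal (trunc_tail \<mu> \<epsilon> t powr r) \<partial>unit_len) \<le> ennreal Bd" if \<epsilon>: "0 < \<epsilon>" "\<epsilon> \<le> 1 / 2" for \<epsilon>
  proof -
    define J where "J = (\<integral>\<^sup>+t. ennreal (trunc_tail \<mu> \<epsilon> t powr r) \<partial>unit_len)"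
    have "J \<le> (\<integral>\<^sup>+t. ennreal ((m / \<epsilon>) powr r) \<partial>unit_len)"
      unfolding J_def m_def using trunc_tail_powr(3)[OF \<mu> \<epsilon>(1), of r] r1
      by (intro nn_integral_mono ennreal_leI) auto
    also have "\<dots> < \<infinity>"
      by (simp add: unit_len_def emeasure_restrict_space space_restrict_space ennreal_mult_less_top)
    finally have "J < \<infinity>" .
    then obtain I0 where I0: "0 \<le> I0" "J = ennreal I0" by (auto simp: less_top_ennreal)
    \<comment> \<open>A positive upper bound for the integral, as the dual test function and the
      absorption step require; the added 1 reappears as a + 1 in \<open>Bd\<close>.\<close>
    define I where "I = I0 + 1"
    have I: "0 < I" "J \<le> ennreal I" using I0 by (auto simp: I_def ennreal_leI)
    define h where "h t = trunc_tail \<mu> \<epsilon> t powr \<gamma>" for t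
    note h = trunc_tail_powr[OF \<mu> \<epsilon>(1) \<gamma>(1), folded h_def]
    define f where "f = stieltjes h"
    define g where "g = stieltjes_real h"
    have fhol: "f holomorphic_on ball 0 1" unfolding f_def by (rule holomorphic_stieltjes[OF h])
    have fN: "hardy_mean p f \<rho> \<le> D1 * I powr (1 / p)" if "0 \<le> \<rho>" "\<rho> < 1" for \<rho>
      unfolding f_def
    proof (rule D1(2)[where B = "(measure \<mu> (space \<mu>) / \<epsilon>) powr \<gamma>", OF h(1) _ _ _ that])
      show "(\<integral>\<^sup>+t. ennreal (h t powr p) \<partial>unit_len) \<le> ennreal I"
        using I by (simp add: h_def powr_powr \<gamma> J_def)
    qed (use h I in auto)
    note fH = hardy_spaceI[OF fhol fN]
    define F where "F = cesaro_op \<mu> f"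
    have FH: "F \<in> hardy_space q" unfolding F_def by (intro K fH)
    \<comment> \<open>The constant in \<open>hardy_bounded\<close> may be any real number, hence the
      absolute value.\<close>
    have FN: "hardy_mean q F \<rho> \<le> \<bar>K\<bar> * (D1 * I powr (1 / p))" if \<rho>: "0 \<le> \<rho>" "\<rho> < 1" for \<rho>
    proof -
      have "hardy_mean q F \<rho> \<le> hardy_norm q F" by (intro hardy_spaceD FH \<rho>)
      also have "\<dots> \<le> K * hardy_norm p f" unfolding F_def by (intro K fH)
      also have "\<dots> \<le> \<bar>K\<bar> * hardy_norm p f"
        by (intro mult_right_mono hardy_norm_nonneg fH) auto
      also have "\<dots> \<le> \<bar>K\<bar> * (D1 * I powr (1 / p))"
        by (intro mult_left_mono fH) auto
      finally show ?thesis .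
    qed
    have Fhol: "F holomorphic_on ball 0 1" by (rule hardy_spaceD(1)[OF FH])
    obtain \<kappa> k where "dual_test q r \<mu> \<epsilon> D2 c I \<kappa> k"
      using dual \<mu> \<epsilon>(1) I unfolding J_def by blast
    then have \<kappa>: "\<kappa> holomorphic_on ball 0 1"
      and k: "\<And>x. 0 \<le> x \<Longrightarrow> x < 1 \<Longrightarrow> \<kappa> (of_real x) = of_real (k x)" "\<And>x. 0 \<le> x \<Longrightarrow> x < 1 \<Longrightarrow> 0 \<le> k x"
      and k_ge: "\<And>y. 1 / 2 \<le> y \<Longrightarrow> y \<le> 1 - \<epsilon> \<Longrightarrow> c * tail \<mu> y powr (r * (1 - 1 / q)) \<le> k y"
      and int: "\<And>F \<rho>. F holomorphic_on ball 0 1 \<Longrightarrow> 0 \<le> \<rho> \<Longrightarrow> \<rho> < 1 \<Longrightarrow>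
        (\<integral>\<^sup>+\<theta>. ennreal (cmod (F (of_real \<rho> * cis \<theta>) * \<kappa> (of_real \<rho> * cis \<theta>))) \<partial>circ)
          \<le> ennreal (D2 * hardy_mean q F \<rho> * I powr (1 - 1 / q))"
      by (simp_all add: dual_test_def)
    define H where "H z = F z * \<kappa> z" for z
    have Hhol: "H holomorphic_on ball 0 1" unfolding H_def by (intro holomorphic_intros Fhol \<kappa>)
    have F_real: "F (of_real y) = of_real (cesaro_real \<mu> g y)" if "0 \<le> y" "y < 1" for y
      unfolding F_def f_def g_def by (rule cesaro_op_stieltjes(1)[OF \<mu> h that])
    have F_ge: "tail \<mu> y * g (y\<^sup>2) / 2 \<le> cesaro_real \<mu> g y" if "0 \<le> y" "y < 1" for y
      unfolding g_def by (rule cesaro_op_stieltjes(2)[OF \<mu> h that])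
    have F_nn: "0 \<le> cesaro_real \<mu> g y" if "0 \<le> y" "y < 1" for y
    proof -
      have "y\<^sup>2 < 1" using that by (simp add: power_less_one_iff)
      then have "0 \<le> tail \<mu> y * g (y\<^sup>2) / 2"
        using that tail_nonneg[of y \<mu>] stieltjes_real_nonneg[OF h, of "y\<^sup>2"] by (simp add: g_def)
      then show ?thesis using F_ge[OF that] by simp
    qed
    define \<rho> where "\<rho> = 1 - \<epsilon>"
    have \<rho>: "0 \<le> \<rho>" "\<rho> < 1" using \<epsilon> by (auto simp: \<rho>_def)
    define w where "w x = cesaro_real \<mu> g x * k x" for x
    have Hw: "H (of_real x) = of_real (w x)" "0 \<le> w x" if "0 \<le> x" "x < 1" for x
      using that by (auto simp: H_def w_def F_real k F_nn)
    \<comment> \<open>This equals w on [0,\<rho>]; written through H it is measurable by continuity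
      of H on the disc.\<close>
    define W where "W x = indicator {0..\<rho>} x *\<^sub>R Re (H (of_real x))" for x :: real
    have Wm: "W \<in> borel_measurable borel"
      unfolding W_def using \<rho>
      by (intro borel_measurable_continuous_on_indicator continuous_intros
          continuous_on_compose2[OF holomorphic_on_imp_continuous_on[OF Hhol]]) auto
    have "(\<integral>\<^sup>+x. ennreal (W x) \<partial>lborel) = (\<integral>\<^sup>+x. ennreal (w x) * indicator {0..\<rho>} x \<partial>lborel)"
      using \<rho> by (intro nn_integral_cong) (auto simp: W_def Hw indicator_def)
    also have "\<dots> \<le> ennreal (1 / 2) * (\<integral>\<^sup>+\<theta>. ennreal (cmod (H (of_real \<rho> * cis \<theta>))) \<partial>circ)"
      by (intro radial_integral_le Hhol \<rho> Hw)
    also have "\<dots> \<le> ennreal (1 / 2) * ennreal (D2 * hardy_mean q F \<rho> * I powr (1 - 1 / q))"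
      unfolding H_def by (intro mult_left_mono int Fhol \<rho>) auto
    also have "\<dots> \<le> ennreal (1 / 2) * ennreal (D2 * (\<bar>K\<bar> * (D1 * I powr (1 / p))) * I powr (1 - 1 / q))"
      using D2 by (intro mult_left_mono ennreal_leI mult_right_mono FN \<rho>) auto
    also have "\<dots> = ennreal (1 / 2 * (D2 * (\<bar>K\<bar> * (D1 * I powr (1 / p))) * I powr (1 - 1 / q)))"
      by (rule ennreal_mult'[symmetric]) simp
    also have "1 / 2 * (D2 * (\<bar>K\<bar> * (D1 * I powr (1 / p))) * I powr (1 - 1 / q)) = 1 / 2 * (D2 * (\<bar>K\<bar> * D1)) * (I powr (1 / p) * I powr (1 - 1 / q))"
      by (simp only: mult_ac)
    also have "I powr (1 / p) * I powr (1 - 1 / q) = I powr (1 - 1 / r)"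
      unfolding powr_add[symmetric] r_eq by (simp add: algebra_simps)
    finally have W_le: "(\<integral>\<^sup>+x. ennreal (W x) \<partial>lborel) \<le> ennreal (1 / 2 * (D2 * (\<bar>K\<bar> * D1)) * I powr (1 - 1 / r))" .
    have point: "ennreal (trunc_tail \<mu> \<epsilon> t powr r) \<le> ennreal a + ennreal (1 / c') * ennreal (W t)" if t: "t \<in> {0..<1}" for t
    proof -
      consider "t < 1 / 2" | "1 / 2 \<le> t" "t \<le> 1 - \<epsilon>" | "1 - \<epsilon> < t" by linarith
      then show ?thesis
      proof cases
        case 1
        have "trunc_tail \<mu> \<epsilon> t \<le> 2 * m"
          using 1 t \<epsilon> tail_le[OF \<mu>, of t "1 / 2"] by (simp add: trunc_tail_def m_def)
        then have "trunc_tail \<mu> \<epsilon> t powr r \<le> a"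
          unfolding a_def using r1 trunc_tail_bounds(1)[OF \<mu> \<epsilon>(1) t] by (intro powr_mono2) auto
        then have "ennreal (trunc_tail \<mu> \<epsilon> t powr r) \<le> ennreal a" by (rule ennreal_leI)
        then show ?thesis by (simp add: add_increasing2)
      next
        case 2
        have t1: "0 \<le> t" "t < 1" using t by auto
        let ?T = "tail \<mu> t"
        have T: "0 \<le> ?T" by (rule tail_nonneg[OF t])
        have "1 / 4 * (?T / 2) powr \<gamma> \<le> g (t\<^sup>2)"
          unfolding g_def h_def by (rule stieltjes_real_ge_tail[OF \<mu> \<epsilon>(1) \<gamma>(1) 2])
        then have "?T * (1 / 4 * (?T / 2) powr \<gamma>) / 2 \<le> ?T * g (t\<^sup>2) / 2"
          using T by (intro divide_right_mono mult_left_mono) auto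
        also have "\<dots> \<le> cesaro_real \<mu> g t" by (rule F_ge[OF t1])
        finally have "?T * (1 / 4 * (?T / 2) powr \<gamma>) / 2 * (c * ?T powr (r * (1 - 1 / q))) \<le> w t"
          unfolding w_def using k_ge[OF 2] T c F_nn[OF t1] by (intro mult_mono) auto
        also have "?T * (1 / 4 * (?T / 2) powr \<gamma>) / 2 * (c * ?T powr (r * (1 - 1 / q))) = c' * (?T * ?T powr \<gamma> * ?T powr (r * (1 - 1 / q)))"
          using T by (simp add: c'_def powr_divide)
        also have "?T * ?T powr \<gamma> * ?T powr (r * (1 - 1 / q)) = ?T powr (1 + \<gamma> + r * (1 - 1 / q))"
          using T by (simp add: powr_add)
        also have "1 + \<gamma> + r * (1 - 1 / q) = 1 + r - r * (1 / q - 1 / p)"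
          by (simp add: \<gamma>_def algebra_simps)
        also have "\<dots> = r"
          unfolding r_eq[symmetric] using r1 by simp
        finally have "?T powr r \<le> 1 / c' * w t"
          using c' by (simp add: field_simps)
        moreover have "trunc_tail \<mu> \<epsilon> t = ?T" using 2 by (simp add: trunc_tail_def)
        moreover have "W t = w t" using 2 t1 by (simp add: W_def Hw \<rho>_def)
        ultimately have "ennreal (trunc_tail \<mu> \<epsilon> t powr r) \<le> ennreal (1 / c') * ennreal (W t)"
          using c' by (simp add: ennreal_leI flip: ennreal_mult')
        then show ?thesis by (simp add: add_increasing)
      next
        case 3
        then show ?thesis by (simp add: trunc_tail_def)
      qed
    qed
    have "ennreal I0 \<le> (\<integral>\<^sup>+t. ennreal a + ennreal (1 / c') * ennreal (W t) \<partial>unit_len)"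
      unfolding I0(2)[symmetric] J_def using point by (intro nn_integral_mono) auto
    also have "\<dots> = (\<integral>\<^sup>+t. ennreal a \<partial>unit_len) + ennreal (1 / c') * (\<integral>\<^sup>+t. ennreal (W t) \<partial>unit_len)"
      using measurable_unit_lenI[OF Wm] by (subst nn_integral_add) (auto simp: nn_integral_cmult)
    also have "(\<integral>\<^sup>+t. ennreal a \<partial>unit_len) = ennreal a"
      by (simp add: unit_len_def emeasure_restrict_space space_restrict_space)
    also have "(\<integral>\<^sup>+t. ennreal (W t) \<partial>unit_len) \<le> (\<integral>\<^sup>+t. ennreal (W t) \<partial>lborel)"
      unfolding nn_integral_unit_len by (intro nn_integral_mono) (auto simp: indicator_def)
    also note W_le
    also have "ennreal a + ennreal (1 / c') * ennreal (1 / 2 * (D2 * (\<bar>K\<bar> * D1)) * I powr (1 - 1 / r)) = ennreal (a + C * I powr (1 - 1 / r))"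
    proof -
      have "ennreal (1 / c') * ennreal (1 / 2 * (D2 * (\<bar>K\<bar> * D1)) * I powr (1 - 1 / r)) = ennreal (C * I powr (1 - 1 / r))"
        using c' by (subst ennreal_mult'[symmetric]) (auto simp: C_def)
      then show ?thesis using C by (simp add: a_def)
    qed
    finally have "ennreal I0 \<le> ennreal (a + C * I powr (1 - 1 / r))"
      by (simp add: add_left_mono mult_left_mono)
    then have "I0 \<le> a + C * I powr (1 - 1 / r)"
      using C by (subst (asm) ennreal_le_iff) (auto simp: a_def)
    then have "I \<le> (a + 1) + C * I powr (1 - 1 / r)" by (simp add: I_def)
    then have "I \<le> Bd"
      unfolding Bd_def using I C r1 by (intro le_of_sublinear_bound) (auto simp: a_def)
    then have "ennreal I \<le> ennreal Bd" by (rule ennreal_leI)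
    with I(2) show ?thesis unfolding J_def by (rule order_trans)
  qed
  \<comment> \<open>Fatou along \<epsilon> = 1 / (n + 2), which never exceeds 1/2 as
    \<open>main\<close> demands.\<close>
  have "(\<integral>\<^sup>+t. ennreal (tail \<mu> t powr r) \<partial>unit_len)
    \<le> (\<integral>\<^sup>+t. liminf (\<lambda>n. ennreal (trunc_tail \<mu> (1 / (real n + 2)) t powr r)) \<partial>unit_len)"
  proof (intro nn_integral_mono)
    fix t assume "t \<in> space unit_len"
    then have t: "t < 1" by simp
    have "(\<lambda>n. 1 / (real n + 2)) \<longlonglongrightarrow> 0"
      using LIMSEQ_ignore_initial_segment[OF lim_inverse_n', of 2] by (simp add: add.commute)
    then have "\<forall>\<^sub>F n in sequentially. 1 / (real n + 2) < 1 - t"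
      using t by (intro order_tendstoD) auto
    then have "\<forall>\<^sub>F n in sequentially. ennreal (trunc_tail \<mu> (1 / (real n + 2)) t powr r) = ennreal (tail \<mu> t powr r)"
      by eventually_elim (simp add: trunc_tail_def)
    then have "(\<lambda>n. ennreal (trunc_tail \<mu> (1 / (real n + 2)) t powr r)) \<longlonglongrightarrow> ennreal (tail \<mu> t powr r)"
      by (rule tendsto_eventually)
    from lim_imp_Liminf[OF sequentially_bot this]
    show "ennreal (tail \<mu> t powr r) \<le> liminf (\<lambda>n. ennreal (trunc_tail \<mu> (1 / (real n + 2)) t powr r))"
      by (simp only: order_refl)
  qed
  also have "\<dots> \<le> liminf (\<lambda>n. \<integral>\<^sup>+t. ennreal (trunc_tail \<mu> (1 / (real n + 2)) t powr r) \<partial>unit_len)"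
  proof (rule nn_integral_liminf)
    fix n
    note [measurable] = measurable_trunc_tail[OF \<mu>]
    show "(\<lambda>t. ennreal (trunc_tail \<mu> (1 / (real n + 2)) t powr r)) \<in> borel_measurable unit_len" by measurable
  qed
  also have "\<dots> \<le> liminf (\<lambda>n :: nat. ennreal Bd)"
    by (rule Liminf_mono, rule always_eventually) (auto intro!: main)
  also have "\<dots> < \<infinity>" by (simp add: Liminf_const)
  finally show ?thesis using tail_condition_iff[OF r1 s] by simp
qed

section \<open>The logarithmic measures and the stronger conditions\<close>

text \<open>The antiderivative exists on [0,1) only, as the integrands in question are singular at
  1. The fundamental theorem is applied on [0, b n] with b n tending to 1, and Fatou's lemma passes
  to the limit.\<close>

lemma nn_integral_half_open_le:
  fixes f F :: "real \<Rightarrow> real"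
  assumes f: "f \<in> borel_measurable borel" and F: "\<And>x. 0 \<le> x \<Longrightarrow> x < 1 \<Longrightarrow> (F has_real_derivative f x) (at x)"
    and nn: "\<And>x. 0 \<le> x \<Longrightarrow> x < 1 \<Longrightarrow> 0 \<le> f x" and M: "\<And>x. 0 \<le> x \<Longrightarrow> x < 1 \<Longrightarrow> F x - F 0 \<le> M"
  shows "(\<integral>\<^sup>+x. ennreal (f x) \<partial>unit_len) \<le> ennreal M"
proof -
  define b where "b n = 1 - 1 / (real n + 1)" for n
  have b: "0 \<le> b n" "b n < 1" for n by (auto simp: b_def field_simps)
  have blim: "b \<longlonglongrightarrow> 1 - 0"
    unfolding b_def using LIMSEQ_inverse_real_of_nat
    by (intro tendsto_diff tendsto_const) (simp add: inverse_eq_divide add.commute)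
  have "(\<integral>\<^sup>+x. ennreal (f x) \<partial>unit_len) \<le> (\<integral>\<^sup>+x. liminf (\<lambda>n. ennreal (f x) * indicator {0..b n} x) \<partial>lborel)"
    unfolding nn_integral_unit_len
  proof (intro nn_integral_mono)
    fix x :: real
    show "ennreal (f x) * indicator {0..<1} x \<le> liminf (\<lambda>n. ennreal (f x) * indicator {0..b n} x)"
    proof (cases "x \<in> {0..<1}")
      case True
      then have "\<forall>\<^sub>F n in sequentially. x < b n"
        using blim by (intro order_tendstoD) auto
      then have "\<forall>\<^sub>F n in sequentially. ennreal (f x) * indicator {0..b n} x = ennreal (f x)"
        by eventually_elim (use True in auto)
      then have "(\<lambda>n. ennreal (f x) * indicator {0..b n} x) \<longlonglongrightarrow> ennreal (f x)"
        by (rule tendsto_eventually)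
      from lim_imp_Liminf[OF sequentially_bot this] show ?thesis using True by simp
    qed simp
  qed
  also have "\<dots> \<le> liminf (\<lambda>n. \<integral>\<^sup>+x. ennreal (f x) * indicator {0..b n} x \<partial>lborel)"
    using f
    by (intro nn_integral_liminf borel_measurable_times_ennreal borel_measurable_indicator
        measurable_compose[OF _ measurable_ennreal]) auto
  also have "\<dots> \<le> liminf (\<lambda>n :: nat. ennreal M)"
  proof (rule Liminf_mono, rule always_eventually, rule allI)
    fix n
    have "(\<integral>\<^sup>+x. ennreal (f x) * indicator {0..b n} x \<partial>lborel) = ennreal (F (b n) - F 0)"
      using b[of n] by (intro nn_integral_FTC_Icc f F nn) auto
    then show "(\<integral>\<^sup>+x. ennreal (f x) * indicator {0..b n} x \<partial>lborel) \<le> ennreal M"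
      using M[OF b] by (simp add: ennreal_leI)
  qed
  also have "\<dots> = ennreal M" by (simp add: Liminf_const)
  finally show ?thesis .
qed

lemma nn_integral_half_open_ge:
  fixes f F :: "real \<Rightarrow> real"
  assumes f: "f \<in> borel_measurable borel" and F: "\<And>x. 0 \<le> x \<Longrightarrow> x < 1 \<Longrightarrow> (F has_real_derivative f x) (at x)"
    and nn: "\<And>x. 0 \<le> x \<Longrightarrow> x < 1 \<Longrightarrow> 0 \<le> f x" and b: "0 \<le> b" "b < 1"
  shows "ennreal (F b - F 0) \<le> (\<integral>\<^sup>+x. ennreal (f x) \<partial>unit_len)"
proof -
  have "ennreal (F b - F 0) = (\<integral>\<^sup>+x. ennreal (f x) * indicator {0..b} x \<partial>lborel)"
    using b by (intro nn_integral_FTC_Icc[symmetric] f F nn) auto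
  also have "\<dots> \<le> (\<integral>\<^sup>+x. ennreal (f x) \<partial>unit_len)"
    unfolding nn_integral_unit_len using b by (intro nn_integral_mono) (auto simp: indicator_def)
  finally show ?thesis .
qed

lemma nn_integral_powr_tail:
  assumes s: "0 < s" and a: "0 \<le> a" "a < 1"
  shows "(\<integral>\<^sup>+t. ennreal ((1 - t) powr (s - 1)) * indicator {a..<1} t \<partial>lborel) = ennreal ((1 - a) powr s / s)"
proof -
  have "(\<integral>\<^sup>+t. ennreal ((1 - t) powr (s - 1)) * indicator {a..<1} t \<partial>lborel)
    = (\<integral>\<^sup>+t. ennreal ((1 - t) powr (s - 1)) * indicator {0..1 - a} (1 - t) \<partial>lborel)"
    by (intro nn_integral_cong_AE AE_I[where N = "{1}"]) (auto simp: indicator_def)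
  also have "\<dots> = (\<integral>\<^sup>+x. ennreal (x powr (s - 1)) * indicator {0..1 - a} x \<partial>lborel)"
    by (subst (2) nn_integral_real_affine[where c = "-1" and t = 1]) auto
  also have "\<dots> = ennreal ((1 - a) powr s / s)"
    using has_integral_powr_from_0[of "s - 1" "1 - a"] s a by (intro nn_integral_has_integral_lebesgue') auto
  finally show ?thesis .
qed

section \<open>The logarithmic factor and the measures \<open>mu_log\<close>\<close>

definition log_term :: "real \<Rightarrow> real" where
  "log_term t = ln (exp 1 / (1 - t))"

lemma log_term_eq: "t < 1 \<Longrightarrow> log_term t = 1 - ln (1 - t)"
  by (simp add: log_term_def ln_div)

lemma log_term_ge_1: "0 \<le> t \<Longrightarrow> t < 1 \<Longrightarrow> 1 \<le> log_term t"
  by (simp add: log_term_eq)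

lemma log_term_mono: "s \<le> t \<Longrightarrow> t < 1 \<Longrightarrow> log_term s \<le> log_term t"
  by (simp add: log_term_eq)

lemma borel_measurable_log_term [measurable]: "log_term \<in> borel_measurable borel"
  unfolding log_term_def by measurable

lemma has_derivative_log_term: "t < 1 \<Longrightarrow> (log_term has_real_derivative 1 / (1 - t)) (at t)"
  by (rule has_field_derivative_transform_within_open[where f = "\<lambda>t. 1 - ln (1 - t)" and S = "{..<1}"])
    (auto intro!: derivative_eq_intros simp: log_term_eq)

definition mu_log_density :: "real \<Rightarrow> real \<Rightarrow> real \<Rightarrow> real" where
  "mu_log_density s \<beta> t = (1 - t) powr (s - 1) * log_term t powr (- \<beta>)"

lemma mu_log_eq: "mu_log s \<beta> = density unit_len (\<lambda>t. ennreal (mu_log_density s \<beta> t))"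
  by (simp add: mu_log_def unit_len_def mu_log_density_def log_term_def)

lemma measurable_mu_log_density: "mu_log_density s \<beta> \<in> borel_measurable borel"
  unfolding mu_log_density_def by measurable

lemma nn_integral_mu_log:
  assumes "f \<in> borel_measurable borel"
  shows "(\<integral>\<^sup>+t. f t \<partial>mu_log s \<beta>) = (\<integral>\<^sup>+t. ennreal (mu_log_density s \<beta> t) * f t \<partial>unit_len)"
proof -
  have "f \<in> borel_measurable unit_len"
    unfolding unit_len_def using assms by (intro measurable_restrict_space1) simp
  then show ?thesis
    unfolding mu_log_eq
    using measurable_compose[OF measurable_unit_lenI[OF measurable_mu_log_density] measurable_ennreal]
    by (intro nn_integral_density)
qed

text \<open>The logarithmic factor is decreasing since \<beta> \<ge> 0, so it is pulled out at the
  left endpoint; the remaining power integrates exactly.\<close>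

lemma emeasure_mu_log_le:
  assumes s: "0 < s" and \<beta>: "0 \<le> \<beta>" and a: "0 \<le> a" "a < 1"
  shows "emeasure (mu_log s \<beta>) {a..<1} \<le> ennreal (log_term a powr (- \<beta>) * ((1 - a) powr s / s))"
proof -
  have sets: "{a..<1} \<in> sets (mu_log s \<beta>)"
    using a by (auto simp: mu_log_eq unit_len_def sets_restrict_space_iff)
  then have "emeasure (mu_log s \<beta>) {a..<1} = (\<integral>\<^sup>+t. indicator {a..<1} t \<partial>mu_log s \<beta>)" by simp
  also have "\<dots> = (\<integral>\<^sup>+t. ennreal (mu_log_density s \<beta> t) * indicator {a..<1} t \<partial>unit_len)"
    by (intro nn_integral_mu_log) simp
  also have "\<dots> \<le> (\<integral>\<^sup>+t. ennreal (log_term a powr (- \<beta>)) * (ennreal ((1 - t) powr (s - 1)) * indicator {a..<1} t) \<partial>lborel)"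
    unfolding nn_integral_unit_len
  proof (intro nn_integral_mono)
    fix t :: real
    show "ennreal (mu_log_density s \<beta> t) * indicator {a..<1} t * indicator {0..<1} t
      \<le> ennreal (log_term a powr (- \<beta>)) * (ennreal ((1 - t) powr (s - 1)) * indicator {a..<1} t)"
    proof (cases "t \<in> {a..<1}")
      case True
      then have "log_term t powr (- \<beta>) \<le> log_term a powr (- \<beta>)"
        using log_term_ge_1[OF a] log_term_mono[of a t] \<beta> by (intro powr_mono2') auto
      then have "mu_log_density s \<beta> t \<le> log_term a powr (- \<beta>) * (1 - t) powr (s - 1)"
        unfolding mu_log_density_def by (subst mult.commute) (intro mult_right_mono, auto)
      then have "ennreal (mu_log_density s \<beta> t) \<le> ennreal (log_term a powr (- \<beta>)) * ennreal ((1 - t) powr (s - 1))"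
        by (subst ennreal_mult'[symmetric]) (auto intro: ennreal_leI)
      then show ?thesis using True a by simp
    qed simp
  qed
  also have "\<dots> = ennreal (log_term a powr (- \<beta>)) * ennreal ((1 - a) powr s / s)"
    unfolding nn_integral_powr_tail[OF s a, symmetric] by (intro nn_integral_cmult) measurable
  finally show ?thesis by (subst ennreal_mult') auto
qed

lemma finite_borel_unit_mu_log:
  assumes s: "0 < s" and \<beta>: "0 \<le> \<beta>"
  shows "finite_borel_unit (mu_log s \<beta>)"
proof -
  have "space (mu_log s \<beta>) = {0..<1}" by (simp add: mu_log_eq)
  then have "emeasure (mu_log s \<beta>) (space (mu_log s \<beta>)) \<le> ennreal (log_term 0 powr (- \<beta>) * ((1 - 0) powr s / s))"
    using emeasure_mu_log_le[OF s \<beta>, of 0] by simp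
  also have "\<dots> < \<infinity>" by simp
  finally have "finite_measure (mu_log s \<beta>)" by (intro finite_measureI) auto
  then show ?thesis by (simp add: finite_borel_unit_def mu_log_def sets_restrict_space)
qed

lemma tail_condition_mu_log:
  assumes r: "1 < r" and s: "0 < s" and \<beta>: "1 / r < \<beta>"
  shows "tail_condition r s (mu_log s \<beta>)"
proof -
  have \<beta>0: "0 \<le> \<beta>" using r \<beta> less_trans[of 0 "1 / r" \<beta>] by simp
  interpret finite_measure "mu_log s \<beta>"
    using finite_borel_unit_mu_log[OF s \<beta>0] by (simp add: finite_borel_unit_def)
  \<comment> \<open>The majorant L^(-\<beta> r) / (1 - t) is L^(-k-1) times the derivative of L =
    \<open>log_term\<close>, with antiderivative -L^(-k) / k. Positivity of k is the assumption
    \<beta> > 1/r, and L = 1 at 0 gives the bound 1/k.\<close>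
  define k where "k = \<beta> * r - 1"
  have k: "0 < k" using \<beta> r by (simp add: k_def field_simps)
  define f where "f t = log_term t powr (- k - 1) * (1 / (1 - t))" for t
  define F where "F t = - (log_term t powr (- k)) / k" for t
  have "(\<integral>\<^sup>+t. ennreal (f t) \<partial>unit_len) \<le> ennreal (1 / k)"
  proof (rule nn_integral_half_open_le[where F = F])
    show "f \<in> borel_measurable borel" unfolding f_def by measurable
    fix x :: real assume x: "0 \<le> x" "x < 1"
    show "(F has_real_derivative f x) (at x)"
      unfolding F_def f_def using log_term_ge_1[OF x] k x
      by (auto intro!: derivative_eq_intros has_derivative_log_term simp: powr_diff field_simps)
    show "0 \<le> f x" using x by (simp add: f_def)
    have "F x \<le> 0" using k by (simp add: F_def)
    moreover have "- F 0 = 1 / k" by (simp add: F_def log_term_def)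
    ultimately show "F x - F 0 \<le> 1 / k" by simp
  qed
  then have fin: "(\<integral>\<^sup>+t. ennreal ((1 / s) powr r) * ennreal (f t) \<partial>unit_len) < \<infinity>"
    by (subst nn_integral_cmult) (auto intro!: measurable_unit_lenI measurable_compose[OF _ measurable_ennreal]
        simp: ennreal_mult_less_top f_def intro: le_less_trans)
  have "(\<integral>\<^sup>+t\<in>{0..<1}. ennreal ((measure (mu_log s \<beta>) {t..<1} / (1 - t) powr s) powr r / (1 - t)) \<partial>lborel)
    \<le> (\<integral>\<^sup>+t. ennreal ((1 / s) powr r) * ennreal (f t) \<partial>unit_len)"
    unfolding nn_integral_unit_len
  proof (intro nn_integral_mono)
    fix t :: real
    show "ennreal ((measure (mu_log s \<beta>) {t..<1} / (1 - t) powr s) powr r / (1 - t)) * indicator {0..<1} t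
      \<le> ennreal ((1 / s) powr r) * ennreal (f t) * indicator {0..<1} t"
    proof (cases "t \<in> {0..<1}")
      case True
      then have t: "0 \<le> t" "t < 1" by auto
      have "measure (mu_log s \<beta>) {t..<1} \<le> log_term t powr (- \<beta>) * ((1 - t) powr s / s)"
        using emeasure_mu_log_le[OF s \<beta>0 t] s by (simp add: emeasure_eq_measure)
      then have "measure (mu_log s \<beta>) {t..<1} / (1 - t) powr s \<le> log_term t powr (- \<beta>) * ((1 - t) powr s / s) / (1 - t) powr s"
        by (intro divide_right_mono) auto
      also have "\<dots> = 1 / s * log_term t powr (- \<beta>)"
        using t by simp
      finally have "(measure (mu_log s \<beta>) {t..<1} / (1 - t) powr s) powr r \<le> (1 / s * log_term t powr (- \<beta>)) powr r"
        using r by (intro powr_mono2) auto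
      also have "\<dots> = (1 / s) powr r * log_term t powr (- k - 1)"
        using s by (simp add: powr_mult powr_divide powr_powr k_def)
      finally have "(measure (mu_log s \<beta>) {t..<1} / (1 - t) powr s) powr r / (1 - t) \<le> (1 / s) powr r * log_term t powr (- k - 1) / (1 - t)"
        using t by (intro divide_right_mono) auto
      then have "(measure (mu_log s \<beta>) {t..<1} / (1 - t) powr s) powr r / (1 - t) \<le> (1 / s) powr r * f t"
        by (simp add: f_def)
      then have "ennreal ((measure (mu_log s \<beta>) {t..<1} / (1 - t) powr s) powr r / (1 - t)) \<le> ennreal ((1 / s) powr r) * ennreal (f t)"
        by (subst ennreal_mult'[symmetric]) (auto intro: ennreal_leI)
      then show ?thesis using True by simp
    qed simp
  qed
  also note fin
  finally show ?thesis by (simp add: tail_condition_def)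
qed

text \<open>As \<open>log_term\<close> is at least 1 and \<beta> \<le> 1, the integrand dominates
  the case \<beta> = 1, whose antiderivative, the logarithm of \<open>log_term\<close>, is
  unbounded.\<close>

lemma weighted_integral_mu_log:
  assumes \<beta>: "\<beta> \<le> 1"
  shows "(\<integral>\<^sup>+t. ennreal (1 / (1 - t) powr s) \<partial>mu_log s \<beta>) = \<infinity>"
proof (rule ccontr)
  define f where "f t = 1 / (1 - t) * (1 / log_term t)" for t
  assume "(\<integral>\<^sup>+t. ennreal (1 / (1 - t) powr s) \<partial>mu_log s \<beta>) \<noteq> \<infinity>"
  moreover have "(\<integral>\<^sup>+t. ennreal (f t) \<partial>unit_len) \<le> (\<integral>\<^sup>+t. ennreal (1 / (1 - t) powr s) \<partial>mu_log s \<beta>)"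
  proof (subst nn_integral_mu_log)
    show "(\<integral>\<^sup>+t. ennreal (f t) \<partial>unit_len) \<le> (\<integral>\<^sup>+t. ennreal (mu_log_density s \<beta> t) * ennreal (1 / (1 - t) powr s) \<partial>unit_len)"
    proof (intro nn_integral_mono)
      fix t assume "t \<in> space unit_len"
      then have t: "0 \<le> t" "t < 1" by auto
      note L = log_term_ge_1[OF t]
      have "1 / log_term t = log_term t powr (- 1)" using L by (simp add: powr_minus_divide)
      also have "\<dots> \<le> log_term t powr (- \<beta>)" using L \<beta> by (intro powr_mono) auto
      finally have "f t \<le> 1 / (1 - t) * log_term t powr (- \<beta>)"
        unfolding f_def using t by (intro mult_left_mono) auto
      also have "1 / (1 - t) = (1 - t) powr (s - 1) * (1 / (1 - t) powr s)"
        using t by (simp add: powr_diff)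
      finally have "f t \<le> mu_log_density s \<beta> t * (1 / (1 - t) powr s)"
        unfolding mu_log_density_def by (simp only: mult_ac)
      then show "ennreal (f t) \<le> ennreal (mu_log_density s \<beta> t) * ennreal (1 / (1 - t) powr s)"
        by (subst ennreal_mult'[symmetric]) (auto simp: mu_log_density_def intro: ennreal_leI)
    qed
  qed measurable
  ultimately obtain M where M: "0 \<le> M" "(\<integral>\<^sup>+t. ennreal (f t) \<partial>unit_len) \<le> ennreal M"
    by (metis ennreal_cases infinity_ennreal_def)
  \<comment> \<open>The solution of \<open>log_term b = exp (M + 1)\<close>, so the integral up to b
    is already M + 1.\<close>
  define b where "b = 1 - exp (1 - exp (M + 1))"
  have "1 \<le> exp (M + 1)" using M by simp
  then have b: "0 \<le> b" "b < 1" by (auto simp: b_def)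
  have "ennreal (ln (log_term b) - ln (log_term 0)) \<le> (\<integral>\<^sup>+t. ennreal (f t) \<partial>unit_len)"
  proof (rule nn_integral_half_open_ge[OF _ _ _ b])
    show "f \<in> borel_measurable borel" unfolding f_def by measurable
    fix x :: real assume x: "0 \<le> x" "x < 1"
    show "((\<lambda>t. ln (log_term t)) has_real_derivative f x) (at x)"
      unfolding f_def using log_term_ge_1[OF x] x
      by (auto intro!: derivative_eq_intros has_derivative_log_term)
    show "0 \<le> f x" using log_term_ge_1[OF x] x by (simp add: f_def)
  qed
  also note M(2)
  finally have "ennreal (M + 1) \<le> ennreal M"
    using b by (simp add: log_term_eq b_def)
  then show False using M by simp
qed

text \<open>A Markov bound gives \<mu>[t,1) \<le> B (1 - t)^s. It estimates r - 1 of the r powers in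
  the tail condition; the remaining first power is linear in \<mu>, and Fubini reduces it to the
  integral of (1 - t)^(-s-1) over [0,\<tau>], at most (1 - \<tau>)^(-s) / s.\<close>

lemma weighted_integral_imp_tail_condition:
  assumes \<mu>: "finite_borel_unit \<mu>" and r: "1 < r" and s: "s = 1 - 1 / r"
    and fin: "weighted_integral_finite r \<mu>"
  shows "tail_condition r s \<mu>"
proof -
  interpret finite_measure \<mu> using \<mu> by (simp add: finite_borel_unit_def)
  interpret L: finite_measure unit_len by (rule finite_measure_unit_len)
  interpret P: pair_sigma_finite unit_len \<mu> ..
  note [measurable] = measurable_finite_borel_unitI[OF \<mu>, of "\<lambda>t. t", simplified] measurable_tail[OF \<mu>]
    measurable_ident_unit_len
  have s0: "0 < s" using s r by simp
  obtain B where B: "0 \<le> B" "(\<integral>\<^sup>+t. ennreal (1 / (1 - t) powr s) \<partial>\<mu>) = ennreal B"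
    using fin unfolding weighted_integral_finite_def s[symmetric] by (auto simp: less_top_ennreal)
  let ?\<phi> = "\<lambda>t. measure \<mu> {t..<1}"
  have bound: "?\<phi> t / (1 - t) powr s \<le> B" if t: "0 \<le> t" "t < 1" for t
  proof -
    have "ennreal (?\<phi> t / (1 - t) powr s) = (\<integral>\<^sup>+\<tau>. ennreal (1 / (1 - t) powr s) * indicator {t..<1} \<tau> \<partial>\<mu>)"
      using sets_atLeastLessThan_1[OF \<mu> t(1)]
      by (subst nn_integral_cmult_indicator) (auto simp: emeasure_eq_measure simp flip: ennreal_mult')
    also have "\<dots> \<le> (\<integral>\<^sup>+\<tau>. ennreal (1 / (1 - \<tau>) powr s) \<partial>\<mu>)"
      using t s0 by (intro nn_integral_mono)
        (auto simp: indicator_def intro!: ennreal_leI divide_left_mono powr_mono2)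
    finally show ?thesis using B by simp
  qed
  have eq: "(measure \<mu> {t..<1} / (1 - t) powr s) powr r / (1 - t) \<le> B powr (r - 1) * (?\<phi> t * (1 - t) powr (- s - 1))"
    if t: "0 \<le> t" "t < 1" for t
  proof -
    let ?X = "?\<phi> t / (1 - t) powr s"
    have X: "0 \<le> ?X" by simp
    have "?X powr r = ?X powr (r - 1) * ?X"
      using X powr_add[of ?X "r - 1" 1] by simp
    also have "\<dots> \<le> B powr (r - 1) * ?X"
      using bound[OF t] r by (intro mult_right_mono powr_mono2) auto
    finally have "?X powr r / (1 - t) \<le> B powr (r - 1) * ?X / (1 - t)"
      using t by (intro divide_right_mono) auto
    also have "\<dots> = B powr (r - 1) * (?\<phi> t * (1 - t) powr (- s - 1))"
      using t by (simp add: powr_diff powr_minus divide_inverse mult_ac)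
    finally show ?thesis .
  qed
  let ?k = "\<lambda>t \<tau>. if t \<le> \<tau> then ennreal ((1 - t) powr (- s - 1)) else 0"
  have "(\<integral>\<^sup>+t\<in>{0..<1}. ennreal ((?\<phi> t / (1 - t) powr s) powr r / (1 - t)) \<partial>lborel)
    \<le> (\<integral>\<^sup>+t. ennreal (B powr (r - 1)) * (\<integral>\<^sup>+\<tau>. ?k t \<tau> \<partial>\<mu>) \<partial>unit_len)"
    unfolding nn_integral_unit_len
  proof (intro nn_integral_mono)
    fix t :: real
    show "ennreal ((?\<phi> t / (1 - t) powr s) powr r / (1 - t)) * indicator {0..<1} t
      \<le> ennreal (B powr (r - 1)) * (\<integral>\<^sup>+\<tau>. ?k t \<tau> \<partial>\<mu>) * indicator {0..<1} t"
    proof (cases "t \<in> {0..<1}")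
      case True
      then have t: "0 \<le> t" "t < 1" by auto
      have "(\<integral>\<^sup>+\<tau>. ?k t \<tau> \<partial>\<mu>) = (\<integral>\<^sup>+\<tau>. ennreal ((1 - t) powr (- s - 1)) * indicator {t..<1} \<tau> \<partial>\<mu>)"
        using \<mu> by (intro nn_integral_cong) (auto simp: indicator_def space_finite_borel_unit)
      also have "\<dots> = ennreal (?\<phi> t * (1 - t) powr (- s - 1))"
        using sets_atLeastLessThan_1[OF \<mu> t(1)]
        by (subst nn_integral_cmult_indicator) (auto simp: emeasure_eq_measure mult.commute simp flip: ennreal_mult')
      finally have k: "(\<integral>\<^sup>+\<tau>. ?k t \<tau> \<partial>\<mu>) = ennreal (?\<phi> t * (1 - t) powr (- s - 1))" .
      have "ennreal ((?\<phi> t / (1 - t) powr s) powr r / (1 - t)) \<le> ennreal (B powr (r - 1)) * (\<integral>\<^sup>+\<tau>. ?k t \<tau> \<partial>\<mu>)"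
        unfolding k using eq[OF t] by (subst ennreal_mult'[symmetric]) (auto intro: ennreal_leI)
      then show ?thesis using True by simp
    qed simp
  qed
  also have "\<dots> = ennreal (B powr (r - 1)) * (\<integral>\<^sup>+t. (\<integral>\<^sup>+\<tau>. ?k t \<tau> \<partial>\<mu>) \<partial>unit_len)"
    by (intro nn_integral_cmult) measurable
  also have "(\<integral>\<^sup>+t. (\<integral>\<^sup>+\<tau>. ?k t \<tau> \<partial>\<mu>) \<partial>unit_len) = (\<integral>\<^sup>+\<tau>. (\<integral>\<^sup>+t. ?k t \<tau> \<partial>unit_len) \<partial>\<mu>)"
    by (intro P.Fubini'[symmetric]) measurable
  also have "\<dots> \<le> (\<integral>\<^sup>+\<tau>. ennreal (1 / s) * ennreal (1 / (1 - \<tau>) powr s) \<partial>\<mu>)"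
  proof (intro nn_integral_mono)
    fix \<tau> assume "\<tau> \<in> space \<mu>"
    then have \<tau>: "0 \<le> \<tau>" "\<tau> < 1" using \<mu> by (auto simp: space_finite_borel_unit)
    have "(\<integral>\<^sup>+t. ?k t \<tau> \<partial>unit_len) = (\<integral>\<^sup>+t. ennreal ((1 - t) powr (- s - 1)) * indicator {0..\<tau>} t \<partial>lborel)"
      unfolding nn_integral_unit_len using \<tau> by (intro nn_integral_cong) (auto simp: indicator_def)
    also have "\<dots> = ennreal ((1 - \<tau>) powr (- s) / s - (1 - 0) powr (- s) / s)"
    proof (rule nn_integral_FTC_Icc)
      fix x assume "x \<in> {0..\<tau>}"
      then show "((\<lambda>t. (1 - t) powr (- s) / s) has_real_derivative (1 - x) powr (- s - 1)) (at x)"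
        using \<tau> s0 by (auto intro!: derivative_eq_intros simp: powr_diff field_simps)
    qed (use \<tau> in auto)
    also have "\<dots> \<le> ennreal (1 / s * (1 / (1 - \<tau>) powr s))"
      using s0 by (intro ennreal_leI) (simp add: powr_minus_divide mult.commute)
    also have "\<dots> = ennreal (1 / s) * ennreal (1 / (1 - \<tau>) powr s)"
      using s0 by (intro ennreal_mult') simp
    finally show "(\<integral>\<^sup>+t. ?k t \<tau> \<partial>unit_len) \<le> ennreal (1 / s) * ennreal (1 / (1 - \<tau>) powr s)" .
  qed
  also have "\<dots> = ennreal (1 / s) * ennreal B"
    unfolding B(2)[symmetric] by (intro nn_integral_cmult) measurable
  finally have "(\<integral>\<^sup>+t\<in>{0..<1}. ennreal ((?\<phi> t / (1 - t) powr s) powr r / (1 - t)) \<partial>lborel)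
     \<le> ennreal (B powr (r - 1)) * (ennreal (1 / s) * ennreal B)"
    by (simp add: mult_left_mono)
  also have "\<dots> < \<infinity>" by (simp add: ennreal_mult_less_top)
  finally show ?thesis by (simp add: tail_condition_def)
qed

text \<open>The first N terms suffice, with N of order 1 / (1 - t): in each of them t^n \<ge> 1/2 by
  Bernoulli's inequality and the coefficient is at least N^(-1/r), so their sum is at least N^s /
  2.\<close>

lemma power_series_ge:
  assumes r: "1 < r" and s: "s = 1 - 1 / r" and t: "0 \<le> t" "t < 1"
  shows "ennreal (1 / 2 * (1 / 2) powr s * (1 / (1 - t) powr s)) \<le> (\<Sum>n. ennreal ((real n + 1) powr (- 1 / r) * t ^ n))"
proof -
  define x where "x = 1 - t"
  have x: "0 < x" "x \<le> 1" using t by (auto simp: x_def)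
  have s0: "0 \<le> s" using s r by simp
  \<comment> \<open>The successor gives both bounds in play: N \<ge> 1 / (2x) for the size of the
    sum, and N - 1 \<le> 1 / (2x) for Bernoulli at the largest exponent N - 1.\<close>
  define N where "N = Suc (nat \<lfloor>1 / (2 * x)\<rfloor>)"
  have N1: "1 / (2 * x) \<le> real N" unfolding N_def by linarith
  have "real (N - 1) = of_int \<lfloor>1 / (2 * x)\<rfloor>" using x by (simp add: N_def)
  then have N2: "real (N - 1) \<le> 1 / (2 * x)" by linarith
  have "1 / 2 \<le> 1 + real (N - 1) * (- x)"
    using mult_right_mono[OF N2, of x] x by simp
  also have "\<dots> \<le> (1 + (- x)) ^ (N - 1)"
    using x by (intro Bernoulli_inequality) auto
  finally have tN: "1 / 2 \<le> t ^ (N - 1)" by (simp add: x_def)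
  have "1 / 2 * (1 / 2) powr s * (1 / (1 - t) powr s) = 1 / 2 * (1 / (2 * x)) powr s"
  proof -
    have "(1 / (2 * x)) powr s = (1 / 2 * (1 / x)) powr s" by simp
    also have "\<dots> = (1 / 2) powr s * (1 / x) powr s" by (rule powr_mult)
    finally show ?thesis using x by (simp add: powr_divide x_def)
  qed
  also have "\<dots> \<le> 1 / 2 * real N powr s"
    using N1 x s0 by (intro mult_left_mono powr_mono2) auto
  also have "real N powr s = real N * real N powr (- 1 / r)"
    using powr_add[of "real N" 1 "- 1 / r"] by (simp add: s N_def)
  also have "1 / 2 * (real N * real N powr (- 1 / r)) = real (card {..<N}) * (real N powr (- 1 / r) * (1 / 2))"
    by simp
  also have "\<dots> \<le> (\<Sum>n<N. (real n + 1) powr (- 1 / r) * t ^ n)"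
  proof (rule sum_bounded_below)
    fix n assume n: "n \<in> {..<N}"
    have "real N powr (- 1 / r) \<le> (real n + 1) powr (- 1 / r)"
      using n r by (intro powr_mono2') auto
    moreover have "t ^ (N - 1) \<le> t ^ n"
      using n t by (intro power_decreasing) auto
    ultimately show "real N powr (- 1 / r) * (1 / 2) \<le> (real n + 1) powr (- 1 / r) * t ^ n"
      using tN by (intro mult_mono) auto
  qed
  finally have "ennreal (1 / 2 * (1 / 2) powr s * (1 / (1 - t) powr s)) \<le> ennreal (\<Sum>n<N. (real n + 1) powr (- 1 / r) * t ^ n)"
    by (rule ennreal_leI)
  also have "\<dots> = (\<Sum>n<N. ennreal ((real n + 1) powr (- 1 / r) * t ^ n))"
    using t by (intro sum_ennreal[symmetric]) auto
  also have "\<dots> \<le> (\<Sum>n. ennreal ((real n + 1) powr (- 1 / r) * t ^ n))"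
    by (intro sum_le_suminf) auto
  finally show ?thesis .
qed

text \<open>By Tonelli the weighted moment series is the \<mu>-integral of the power series with
  coefficients (n + 1)^(-1/r), which dominates a multiple of (1 - t)^(-s).\<close>

lemma weighted_moments_imp_weighted_integral:
  assumes \<mu>: "finite_borel_unit \<mu>" and r: "1 < r" and sm: "weighted_moments_summable r \<mu>"
  shows "weighted_integral_finite r \<mu>"
proof -
  interpret finite_measure \<mu> using \<mu> by (simp add: finite_borel_unit_def)
  note [measurable] = measurable_finite_borel_unitI[OF \<mu>, of "\<lambda>t. t", simplified]
  define s where "s = 1 - 1 / r"
  define c where "c = 1 / 2 * (1 / 2) powr s"
  have c: "0 < c" by (simp add: c_def)
  let ?a = "\<lambda>n. (real n + 1) powr (- 1 / r)"
  have int: "(\<integral>\<^sup>+t. ennreal (?a n * t ^ n) \<partial>\<mu>) = ennreal (?a n * moment \<mu> n)" for n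
  proof -
    have "integrable \<mu> (\<lambda>t. t ^ n)"
      using \<mu> by (intro integrable_bounded_finite_borel_unit[where B = 1]) (auto simp: power_le_one)
    then have "(\<integral>\<^sup>+t. ennreal (?a n * t ^ n) \<partial>\<mu>) = ennreal (\<integral>t. ?a n * t ^ n \<partial>\<mu>)"
      using \<mu> by (intro nn_integral_eq_integral Bochner_Integration.integrable_mult_right AE_I2) (auto simp: space_finite_borel_unit)
    then show ?thesis by (simp add: moment_def)
  qed
  have "ennreal c * (\<integral>\<^sup>+t. ennreal (1 / (1 - t) powr s) \<partial>\<mu>) = (\<integral>\<^sup>+t. ennreal c * ennreal (1 / (1 - t) powr s) \<partial>\<mu>)"
    by (intro nn_integral_cmult[symmetric]) measurable
  also have "\<dots> \<le> (\<integral>\<^sup>+t. (\<Sum>n. ennreal (?a n * t ^ n)) \<partial>\<mu>)"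
  proof (intro nn_integral_mono)
    fix t assume "t \<in> space \<mu>"
    then have t: "0 \<le> t" "t < 1" using \<mu> by (auto simp: space_finite_borel_unit)
    have "ennreal c * ennreal (1 / (1 - t) powr s) = ennreal (c * (1 / (1 - t) powr s))"
      using c by (intro ennreal_mult'[symmetric]) simp
    also have "\<dots> \<le> (\<Sum>n. ennreal (?a n * t ^ n))"
      unfolding c_def by (rule power_series_ge[OF r s_def t])
    finally show "ennreal c * ennreal (1 / (1 - t) powr s) \<le> (\<Sum>n. ennreal (?a n * t ^ n))" .
  qed
  also have "\<dots> = (\<Sum>n. ennreal (?a n * moment \<mu> n))"
    unfolding int[symmetric] by (intro nn_integral_suminf) measurable
  also have "\<dots> = ennreal (\<Sum>n. ?a n * moment \<mu> n)"
    using sm moment_bound(1)[OF \<mu>] unfolding weighted_moments_summable_def by (intro suminf_ennreal2) auto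
  also have "\<dots> < \<infinity>" by simp
  finally show ?thesis
    using c unfolding weighted_integral_finite_def s_def[symmetric] by (auto simp: ennreal_mult_less_top)
qed

theorem proposition6p2:
  fixes p q r s \<beta> :: real
  assumes "1 \<le> q" and "q < p"
    and "r = p * q / (p - q)" and "s = 1 - 1 / r"
    and "1 / r < \<beta>" and "\<beta> \<le> 1"
  shows "finite_borel_unit (mu_log s \<beta>) \<and>
    hardy_bounded p q (cesaro_op (mu_log s \<beta>)) \<and>
    hardy_compact p q (cesaro_op (mu_log s \<beta>)) \<and>
    (\<integral>\<^sup>+t. ennreal (1 / (1 - t) powr s) \<partial>(mu_log s \<beta>)) = \<infinity> \<and>
    strictly_stronger (weighted_integral_finite r) (tail_condition r s) \<and>
    strictly_stronger (weighted_moments_summable r) (tail_condition r s) \<and>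
    (\<forall>\<mu>. finite_borel_unit \<mu> \<longrightarrow>
       (tail_condition r s \<mu> \<longleftrightarrow> hardy_bounded p q (cesaro_op \<mu>)))"
proof -
  note q = assms(1,2) and r = assms(3) and s = assms(4)
  have r1: "1 < r" by (rule conjugate_gt_1[OF q r])
  have s0: "0 < s" using r1 s by simp
  have \<beta>0: "0 \<le> \<beta>" using r1 assms(5) less_trans[of 0 "1 / r" \<beta>] by simp
  have fb: "finite_borel_unit (mu_log s \<beta>)" by (rule finite_borel_unit_mu_log[OF s0 \<beta>0])
  have tc: "tail_condition r s (mu_log s \<beta>)" by (rule tail_condition_mu_log[OF r1 s0 assms(5)])
  have inf: "(\<integral>\<^sup>+t. ennreal (1 / (1 - t) powr s) \<partial>(mu_log s \<beta>)) = \<infinity>"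
    by (rule weighted_integral_mu_log[OF assms(6)])
  then have nw: "\<not> weighted_integral_finite r (mu_log s \<beta>)"
    by (simp add: weighted_integral_finite_def s)
  have 1: "strictly_stronger (weighted_integral_finite r) (tail_condition r s)"
    unfolding strictly_stronger_def using weighted_integral_imp_tail_condition[OF _ r1 s] fb tc nw by blast
  \<comment> \<open>The weighted integral is the intermediate condition: it links the moments to the
    tail condition, and its failure for \<open>mu_log\<close> excludes summable moments.\<close>
  have 2: "strictly_stronger (weighted_moments_summable r) (tail_condition r s)"
    unfolding strictly_stronger_def
    using weighted_integral_imp_tail_condition[OF _ r1 s] weighted_moments_imp_weighted_integral[OF _ r1] fb tc nw by blast
  have 3: "tail_condition r s \<mu> \<longleftrightarrow> hardy_bounded p q (cesaro_op \<mu>)" if "finite_borel_unit \<mu>" for \<mu>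
    using tail_condition_imp_bounded[OF q r s that] bounded_imp_tail_condition[OF q r s that] by blast
  show ?thesis
    using fb tc inf 1 2 3 tail_condition_imp_compact[OF q r s fb tc] by blast
qed

end
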